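(* Let $\Bbbk$ be a field, let $\lambda=(\lambda_1,\ldots,\lambda_n)$ be a partition with $\lambda_1\ge\cdots\ge\lambda_n\ge 1$ and $m=\lambda_1$, and let $Y$ be an arbitrary filling of the Young diagram of $\lambda$ by positive integers, with value $w(i,j)$ in box $(i,j)$ ($1\le i\le n$, $1\le j\le\lambda_i$). Let $S=\Bbbk[x_1,\ldots,x_n,y_1,\ldots,y_m]$ and $I(Y)=\big((x_iy_j)^{w(i,j)}\mid 1\le i\le n,\ 1\le j\le\lambda_i\big)$. Let $(\gamma,\delta)$ be a minimal box of $Y$. Then $$\operatorname{depth} S/I(Y)=\min\{\operatorname{depth} S/(I(Y)+(x_\gamma)),\ \operatorname{depth} S/(I(Y)+(y_\delta))\}.$$
   Context: $S$ is a standard graded polynomial ring. Let $\omega=\min\{w(i,j)\mid 1\le i\le n,1\le j\le\lambda_i\}$. A box $(\gamma,\delta)$ of the diagram is a minimal box of $Y$ if $w(\gamma,\delta)=\omega$ and $w(i,j)>\omega$ for every box $(i,j)\neq(\gamma,\delta)$ with $i\le\gamma$ and $j\le\delta$. *)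

theory Defs
  imports "HOL-Library.Poly_Mapping"
begin

(* Multivariate polynomials over 'k in variables indexed by nat + nat:
   Inl i stands for x_i, Inr j stands for y_j.  A monomial is an exponent
   vector (nat + nat) \<Rightarrow>\<^sub>0 nat. *)
type_synonym 'k mpoly = "((nat + nat) \<Rightarrow>\<^sub>0 nat) \<Rightarrow>\<^sub>0 'k"

definition Var :: "nat + nat \<Rightarrow> 'k::comm_ring_1 mpoly" where
  "Var v = Poly_Mapping.single (Poly_Mapping.single v 1) 1"

definition polys_in :: "(nat + nat) set \<Rightarrow> 'k::zero mpoly set" where
  "polys_in V = {f :: 'k mpoly. \<forall>\<mu>\<in>Poly_Mapping.keys f. Poly_Mapping.keys \<mu> \<subseteq> V}"

definition ideal_gen :: "'k::comm_ring_1 mpoly set \<Rightarrow> 'k mpoly set \<Rightarrow> 'k mpoly set" where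
  "ideal_gen R G = {(\<Sum>g\<in>F. c g * g) | F c. finite F \<and> F \<subseteq> G \<and> (\<forall>g\<in>F. c g \<in> R)}"

definition max_ideal :: "'k::comm_ring_1 mpoly set \<Rightarrow> 'k mpoly set" where
  "max_ideal R = {f \<in> R. Poly_Mapping.lookup f 0 = 0}"

fun weak_reg_seq :: "'k::comm_ring_1 mpoly set \<Rightarrow> 'k mpoly set \<Rightarrow> 'k mpoly list \<Rightarrow> bool" where
  "weak_reg_seq R J [] = True"
| "weak_reg_seq R J (f # fs) =
     ((\<forall>g\<in>R. f * g \<in> J \<longrightarrow> g \<in> J) \<and> weak_reg_seq R (ideal_gen R (J \<union> {f})) fs)"

definition reg_seq :: "'k::comm_ring_1 mpoly set \<Rightarrow> 'k mpoly set \<Rightarrow> 'k mpoly list \<Rightarrow> bool" where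
  "reg_seq R J fs \<longleftrightarrow> set fs \<subseteq> max_ideal R \<and> weak_reg_seq R J fs
                        \<and> 1 \<notin> ideal_gen R (J \<union> set fs)"

definition depth :: "'k::comm_ring_1 mpoly set \<Rightarrow> 'k mpoly set \<Rightarrow> nat" where
  "depth R J = Sup {length fs | fs. reg_seq R J fs}"

end

theory Submission
  imports Defs "HOL-Library.Nat_Bijection"
begin

text \<open>Both sides of the equation are computed combinatorially. Fix exponents \<open>a i\<close>, \<open>b j\<close> of the variables
  such that the monomial they define is not in the ideal. A variable is dead if a power of it
  multiplies this monomial into the ideal. The live variables span a Ferrers graph, so their
  contribution to the depth is the number of live variables, if there is no edge, or the minimum over
  the edges \<open>(i, j)\<close> of one plus the number of live rows below \<open>i\<close> plus the number of live columns to
  the right of \<open>j\<close>. The depth is the minimum of these values over all exponents.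

  That the depth is at most each of these values is seen on the Koszul complex of high powers of the
  variables: its cohomology vanishes below the length of any regular sequence, while each
  value comes with an explicit nonzero class. Conversely, if all values are at least \<open>k\<close>, the first
  \<open>k\<close> elementary symmetric polynomials form a regular sequence. Indeed, they do so on polynomial rings
  in at least \<open>k\<close> variables, and the quotient has a filtration with such factors, obtained by always
  splitting off a dead variable or the row variable of a minimal box: killing the latter does not
  create smaller values. The last fact, for rows and columns, together with the
  (easy) converse that a value for \<open>I\<close> is at least a value for \<open>I + (x)\<close> or \<open>I + (y)\<close>, is the theorem.\<close>

section \<open>Ideals, exact sequences and monomial ideals\<close>

text \<open>\<open>weak_reg_seq_exact\<close> transports regularity only for one and the same
  sequence on both ends. So the sequence must not depend on the ideal, and since the field may be
  finite, linear forms in general position are no option either. The elementary symmetric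
  polynomials of all variables fit: setting some variables to zero leaves those of the remaining
  variables.

  \<open>depth\<close> is a supremum, so an upper bound has to meet every sequence in the maximal
  ideal. The Koszul complex on the powers \<open>Var v ^ N\<close> treats them all alike, since each
  such element has a power in the ideal of these powers. With \<open>N\<close> above the relevant
  exponents no coboundary reaches the coefficient in question; a large finite \<open>N\<close> thus
  does the work of local cohomology in one multidegree.

  The combinatorial obstacle: a live row that is killed is no longer counted, so killing it might
  lower a value. One has to find other exponents for which this row is dead or its extra count is
  made up for by an edge. Strictness of the weights above the chosen box allows its row to be killed
  through its column while the live rows above stay live.\<close>

locale subring =
  fixes R :: "'k::comm_ring_1 mpoly set"
  assumes zero_in [simp]: "0 \<in> R" and one_in [simp]: "1 \<in> R"
    and add_in [simp]: "f \<in> R \<Longrightarrow> g \<in> R \<Longrightarrow> f + g \<in> R"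
    and uminus_in [simp]: "f \<in> R \<Longrightarrow> - f \<in> R"
    and mult_in [simp]: "f \<in> R \<Longrightarrow> g \<in> R \<Longrightarrow> f * g \<in> R"
begin

lemma diff_in [simp]: "f \<in> R \<Longrightarrow> g \<in> R \<Longrightarrow> f - g \<in> R"
  using add_in[of f "- g"] by simp

lemma sum_in [simp]: "(\<And>i. i \<in> F \<Longrightarrow> c i \<in> R) \<Longrightarrow> sum c F \<in> R"
  by (induction F rule: infinite_finite_induct) auto

lemma prod_in [simp]: "(\<And>i. i \<in> F \<Longrightarrow> c i \<in> R) \<Longrightarrow> prod c F \<in> R"
  by (induction F rule: infinite_finite_induct) auto

lemma power_in [simp]: "f \<in> R \<Longrightarrow> f ^ n \<in> R"
  by (induction n) auto

definition idl :: "'k mpoly set \<Rightarrow> bool" where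
  "idl J \<longleftrightarrow> J \<subseteq> R \<and> 0 \<in> J \<and> (\<forall>f\<in>J. \<forall>g\<in>J. f + g \<in> J) \<and> (\<forall>f\<in>J. \<forall>c\<in>R. c * f \<in> J)"

lemma idlD:
  assumes "idl J"
  shows "f \<in> J \<Longrightarrow> f \<in> R" "0 \<in> J" "f \<in> J \<Longrightarrow> g \<in> J \<Longrightarrow> f + g \<in> J"
    "f \<in> J \<Longrightarrow> c \<in> R \<Longrightarrow> c * f \<in> J" "f \<in> J \<Longrightarrow> c \<in> R \<Longrightarrow> f * c \<in> J"
    "f \<in> J \<Longrightarrow> - f \<in> J" "f \<in> J \<Longrightarrow> g \<in> J \<Longrightarrow> f - g \<in> J"
proof -
  show *: "f \<in> J \<Longrightarrow> f \<in> R" "0 \<in> J" "f \<in> J \<Longrightarrow> g \<in> J \<Longrightarrow> f + g \<in> J" "f \<in> J \<Longrightarrow> c \<in> R \<Longrightarrow> c * f \<in> J" for f g c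
    using assms by (simp_all add: idl_def subset_iff)
  show "f \<in> J \<Longrightarrow> c \<in> R \<Longrightarrow> f * c \<in> J" for c using *(4)[of f c] by (simp add: mult.commute[of f])
  show neg: "f \<in> J \<Longrightarrow> - f \<in> J" for f using *(4)[of f "-1"] by simp
  show "f \<in> J \<Longrightarrow> g \<in> J \<Longrightarrow> f - g \<in> J" using *(3)[of f "- g"] neg by simp
qed

lemma idl_sum: "idl J \<Longrightarrow> (\<And>i. i \<in> F \<Longrightarrow> c i \<in> J) \<Longrightarrow> sum c F \<in> J"
  by (induction F rule: infinite_finite_induct) (auto intro: idlD)

lemma idl_gen:
  assumes "G \<subseteq> R"
  shows "idl (ideal_gen R G)"
  unfolding idl_def
proof (intro conjI ballI)
  show "ideal_gen R G \<subseteq> R" using assms by (auto simp: ideal_gen_def intro!: sum_in)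
  show "0 \<in> ideal_gen R G" unfolding ideal_gen_def by (intro CollectI exI[of _ "{}"]) auto
next
  fix f g assume "f \<in> ideal_gen R G" "g \<in> ideal_gen R G"
  then obtain F c F' c' where 1: "f = (\<Sum>g\<in>F. c g * g)" "finite F" "F \<subseteq> G" "\<forall>g\<in>F. c g \<in> R"
    and 2: "g = (\<Sum>g\<in>F'. c' g * g)" "finite F'" "F' \<subseteq> G" "\<forall>g\<in>F'. c' g \<in> R"
    unfolding ideal_gen_def by auto
  define d where "d = (\<lambda>g. (if g \<in> F then c g else 0) + (if g \<in> F' then c' g else 0))"
  have "f = (\<Sum>g\<in>F \<union> F'. (if g \<in> F then c g else 0) * g)"
    unfolding 1 using 1 2 by (intro sum.mono_neutral_cong_left) auto
  moreover have "g = (\<Sum>g\<in>F \<union> F'. (if g \<in> F' then c' g else 0) * g)"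
    unfolding 2 using 1 2 by (intro sum.mono_neutral_cong_left) auto
  ultimately have "f + g = (\<Sum>g\<in>F \<union> F'. d g * g)"
    by (simp add: sum.distrib[symmetric] d_def distrib_right)
  moreover have "\<forall>g\<in>F \<union> F'. d g \<in> R" using 1 2 by (auto simp: d_def)
  ultimately show "f + g \<in> ideal_gen R G"
    unfolding ideal_gen_def using 1 2 by blast
next
  fix f e assume "f \<in> ideal_gen R G" "e \<in> R"
  then obtain F c where 1: "f = (\<Sum>g\<in>F. c g * g)" "finite F" "F \<subseteq> G" "\<forall>g\<in>F. c g \<in> R"
    unfolding ideal_gen_def by auto
  then have "e * f = (\<Sum>g\<in>F. (e * c g) * g)" by (simp add: sum_distrib_left mult.assoc)
  then show "e * f \<in> ideal_gen R G"
    unfolding ideal_gen_def using 1 \<open>e \<in> R\<close> by (intro CollectI exI[of _ F] exI[of _ "\<lambda>g. e * c g"]) auto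
qed

lemma gen_in: "g \<in> G \<Longrightarrow> g \<in> ideal_gen R G"
  unfolding ideal_gen_def by (intro CollectI exI[of _ "{g}"] exI[of _ "\<lambda>_. 1"]) auto

lemma gen_least: "idl J \<Longrightarrow> G \<subseteq> J \<Longrightarrow> ideal_gen R G \<subseteq> J"
  unfolding ideal_gen_def by (auto intro!: idl_sum idlD(4))

lemma gen_insert:
  assumes J: "idl J" and f: "f \<in> R"
  shows "ideal_gen R (insert f J) = {j + c * f | j c. j \<in> J \<and> c \<in> R}"
proof
  have JR: "insert f J \<subseteq> R" using J f by (auto dest: idlD)
  note I = idl_gen[OF JR]
  show "{j + c * f | j c. j \<in> J \<and> c \<in> R} \<subseteq> ideal_gen R (insert f J)"
    using idlD(3,4)[OF I] gen_in[of _ "insert f J"] by auto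
  have "idl {j + c * f | j c. j \<in> J \<and> c \<in> R}"
    unfolding idl_def
  proof (intro conjI ballI)
    show "{j + c * f | j c. j \<in> J \<and> c \<in> R} \<subseteq> R" using f by (auto dest: idlD(1)[OF J])
    show "0 \<in> {j + c * f | j c. j \<in> J \<and> c \<in> R}"
      by (intro CollectI exI[of _ 0]) (auto simp: idlD(2)[OF J])
  next
    fix g h assume "g \<in> {j + c * f | j c. j \<in> J \<and> c \<in> R}" "h \<in> {j + c * f | j c. j \<in> J \<and> c \<in> R}"
    then obtain j c j' c' where *: "g = j + c * f" "h = j' + c' * f" "j \<in> J" "j' \<in> J" "c \<in> R" "c' \<in> R"
      by auto
    then have "g + h = (j + j') + (c + c') * f" by (simp add: algebra_simps)
    then show "g + h \<in> {j + c * f | j c. j \<in> J \<and> c \<in> R}" using * idlD(3)[OF J] add_in by blast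
  next
    fix g d assume "g \<in> {j + c * f | j c. j \<in> J \<and> c \<in> R}" "d \<in> R"
    then obtain j c where *: "g = j + c * f" "j \<in> J" "c \<in> R" by auto
    then have "d * g = d * j + (d * c) * f" by (simp add: algebra_simps)
    then show "d * g \<in> {j + c * f | j c. j \<in> J \<and> c \<in> R}"
      using * idlD(4)[OF J] mult_in \<open>d \<in> R\<close> by blast
  qed
  moreover have "insert f J \<subseteq> {j + c * f | j c. j \<in> J \<and> c \<in> R}"
  proof
    fix g assume "g \<in> insert f J"
    then have "g = g + 0 * f \<and> g \<in> J \<or> g = 0 + 1 * f" by auto
    then show "g \<in> {j + c * f | j c. j \<in> J \<and> c \<in> R}" using idlD(2)[OF J] zero_in one_in by blast
  qed
  ultimately show "ideal_gen R (insert f J) \<subseteq> {j + c * f | j c. j \<in> J \<and> c \<in> R}"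
    by (rule gen_least)
qed

lemma idl_insert: "idl J \<Longrightarrow> f \<in> R \<Longrightarrow> idl (ideal_gen R (insert f J))"
  by (rule idl_gen) (auto dest: idlD)

lemma gen_insertI: "idl J \<Longrightarrow> f \<in> R \<Longrightarrow> j \<in> J \<Longrightarrow> c \<in> R \<Longrightarrow> g = j + c * f \<Longrightarrow> g \<in> ideal_gen R (insert f J)"
  by (auto simp: gen_insert)

lemma gen_insert_absorb: "idl J \<Longrightarrow> f \<in> J \<Longrightarrow> ideal_gen R (insert f J) = J"
  using gen_least[of J "insert f J"] gen_in[of _ "insert f J"] by blast

lemma gen_insert_commute:
  assumes "idl J" "f \<in> R" "h \<in> R"
  shows "ideal_gen R (insert h (ideal_gen R (insert f J))) = ideal_gen R (insert f (ideal_gen R (insert h J)))"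
proof -
  have *: "ideal_gen R (insert h (ideal_gen R (insert f J))) \<subseteq> ideal_gen R (insert f (ideal_gen R (insert h J)))"
    if fh: "f \<in> R" "h \<in> R" for f h
  proof (rule gen_least)
    show "idl (ideal_gen R (insert f (ideal_gen R (insert h J))))"
      using assms fh by (intro idl_insert)
    have "insert f J \<subseteq> ideal_gen R (insert f (ideal_gen R (insert h J)))" by (auto intro: gen_in)
    then have "ideal_gen R (insert f J) \<subseteq> ideal_gen R (insert f (ideal_gen R (insert h J)))"
      using assms fh by (intro gen_least idl_insert)
    then show "insert h (ideal_gen R (insert f J)) \<subseteq> ideal_gen R (insert f (ideal_gen R (insert h J)))"
      by (auto intro: gen_in)
  qed
  show ?thesis using *[of f h] *[of h f] assms by blast
qed

lemma idl_colon:
  assumes J: "idl J"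
  shows "idl {c \<in> R. c * h \<in> J}"
  unfolding idl_def using idlD[OF J] by (auto simp: distrib_right mult.assoc)

text \<open>Tensoring \<open>0 -> R/(J:h) -> R/J -> R/(J+h) -> 0\<close> with \<open>R/f\<close>
  keeps it exact on the left, because \<open>f\<close> is a nonzerodivisor on the last term. This
  carries the exact sequence through the recursion of \<open>weak_reg_seq\<close>.\<close>

lemma colon_insert:
  assumes J: "idl J" and f: "f \<in> R" and h: "h \<in> R"
    and reg: "\<forall>g\<in>R. f * g \<in> ideal_gen R (insert h J) \<longrightarrow> g \<in> ideal_gen R (insert h J)"
  shows "{c \<in> R. c * h \<in> ideal_gen R (insert f J)} = ideal_gen R (insert f {c \<in> R. c * h \<in> J})"
proof (intro set_eqI iffI)
  fix c assume "c \<in> {c \<in> R. c * h \<in> ideal_gen R (insert f J)}"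
  then obtain j s where c: "c \<in> R" "c * h = j + s * f" "j \<in> J" "s \<in> R"
    by (auto simp: gen_insert[OF J f])
  then have "f * s = - j + c * h" by (simp add: algebra_simps)
  then have "f * s \<in> ideal_gen R (insert h J)" using c idlD(6)[OF J] by (intro gen_insertI[OF J h])
  then have "s \<in> ideal_gen R (insert h J)" using reg c by blast
  then obtain j' s' where s: "s = j' + s' * h" "j' \<in> J" "s' \<in> R" by (auto simp: gen_insert[OF J h])
  have "(c - s' * f) * h = j + f * j'" using c(2) s(1) by (simp add: algebra_simps)
  then have "(c - s' * f) * h \<in> J" using c s f idlD[OF J] by simp
  then show "c \<in> ideal_gen R (insert f {c \<in> R. c * h \<in> J})"
    using c s f by (intro gen_insertI[OF idl_colon[OF J, of h] f, of "c - s' * f" s']) auto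
next
  fix c assume "c \<in> ideal_gen R (insert f {c \<in> R. c * h \<in> J})"
  then obtain j s where c: "c = j + s * f" "j \<in> R" "j * h \<in> J" "s \<in> R"
    by (auto simp: gen_insert[OF idl_colon[OF J] f])
  then have "c * h = j * h + (s * h) * f" by (simp add: algebra_simps)
  then show "c \<in> {c \<in> R. c * h \<in> ideal_gen R (insert f J)}"
    using c f h by (auto intro!: gen_insertI[OF J f, of "j * h" "s * h"])
qed

text \<open>The exact sequence \<open>0 \<rightarrow> R/(J : h) \<rightarrow> R/J \<rightarrow> R/(J + h) \<rightarrow> 0\<close>.\<close>

theorem weak_reg_seq_exact:
  assumes "idl J" "h \<in> R" "set fs \<subseteq> R"
    and "weak_reg_seq R {c \<in> R. c * h \<in> J} fs" "weak_reg_seq R (ideal_gen R (insert h J)) fs"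
  shows "weak_reg_seq R J fs"
  using assms
proof (induction fs arbitrary: J)
  case Nil
  then show ?case by simp
next
  case (Cons f fs)
  note J = \<open>idl J\<close> and h = \<open>h \<in> R\<close>
  have f: "f \<in> R" using Cons.prems by simp
  have r1: "\<forall>g\<in>R. f * g \<in> {c \<in> R. c * h \<in> J} \<longrightarrow> g \<in> {c \<in> R. c * h \<in> J}"
    and r2: "\<forall>g\<in>R. f * g \<in> ideal_gen R (insert h J) \<longrightarrow> g \<in> ideal_gen R (insert h J)"
    using Cons.prems by simp_all
  have "g \<in> J" if g: "g \<in> R" "f * g \<in> J" for g
  proof -
    \<comment> \<open>Cancel \<open>f\<close> first modulo \<open>J + (h)\<close>; a multiple of
      \<open>h\<close> remains, for which \<open>f\<close> is cancelled modulo
      \<open>J : h\<close>.\<close>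
    have "f * g \<in> ideal_gen R (insert h J)" using g by (auto intro: gen_in)
    then have "g \<in> ideal_gen R (insert h J)" using r2 g by blast
    then obtain j s where s: "g = j + s * h" "j \<in> J" "s \<in> R" by (auto simp: gen_insert[OF J h])
    have "f * s * h = f * g - f * j" using s by (simp add: algebra_simps)
    then have "f * s * h \<in> J" using g s f idlD[OF J] by simp
    then have "s * h \<in> J" using r1 s f by auto
    then show "g \<in> J" using s idlD[OF J] by simp
  qed
  moreover have "weak_reg_seq R (ideal_gen R (insert f J)) fs"
  proof (rule Cons.IH)
    show "weak_reg_seq R {c \<in> R. c * h \<in> ideal_gen R (insert f J)} fs"
      unfolding colon_insert[OF J f h r2] using Cons.prems by simp
    show "weak_reg_seq R (ideal_gen R (insert h (ideal_gen R (insert f J)))) fs"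
      unfolding gen_insert_commute[OF J f h] using Cons.prems by simp
  qed (use Cons.prems J f idl_insert in auto)
  ultimately show ?case by simp
qed

end

lemma subring_polys_in: "subring (polys_in V)"
proof
  show "f * g \<in> polys_in V" if fg: "f \<in> polys_in V" "g \<in> polys_in V" for f g :: "'a mpoly"
  proof -
    have "Poly_Mapping.keys (m + m') \<subseteq> V" if "m \<in> Poly_Mapping.keys f" "m' \<in> Poly_Mapping.keys g" for m m'
    proof -
      have "Poly_Mapping.keys m \<subseteq> V" "Poly_Mapping.keys m' \<subseteq> V" using that fg by (auto simp: polys_in_def)
      then show ?thesis using Poly_Mapping.keys_add[of m m'] by blast
    qed
    then show ?thesis using Poly_Mapping.keys_mult[of f g] unfolding polys_in_def by blast
  qed
  show "f + g \<in> polys_in V" if "f \<in> polys_in V" "g \<in> polys_in V" for f g :: "'a mpoly"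
    using that Poly_Mapping.keys_add[of f g] by (force simp: polys_in_def)
  show "- f \<in> polys_in V" if "f \<in> polys_in V" for f :: "'a mpoly"
    using that by (auto simp: polys_in_def in_keys_iff)
qed (auto simp: polys_in_def)

section \<open>Multiplication by monomials, and ideals spanned by monomials\<close>

lemma lookup_times_single:
  fixes f :: "'k::comm_ring_1 mpoly"
  shows "Poly_Mapping.lookup (f * Poly_Mapping.single \<nu> c) (\<mu> + \<nu>) = Poly_Mapping.lookup f \<mu> * c"
    and "\<nexists>\<kappa>. \<mu> = \<kappa> + \<nu> \<Longrightarrow> Poly_Mapping.lookup (f * Poly_Mapping.single \<nu> c) \<mu> = 0"
proof -
  have *: "Poly_Mapping.lookup (f * Poly_Mapping.single \<nu> c) \<mu> =
      (\<Sum>l. Poly_Mapping.lookup f l * (c when \<mu> = l + \<nu>))" for \<mu>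
  proof -
    have "(\<Sum>q. (c when \<nu> = q) when \<mu> = l + q) = (c when \<mu> = l + \<nu>)" for l
      using Sum_any_when_equal[of "\<lambda>q. c when \<mu> = l + q" \<nu>] by (simp add: when_commute eq_commute[of \<nu>])
    then show ?thesis by (simp add: lookup_mult lookup_single)
  qed
  show "Poly_Mapping.lookup (f * Poly_Mapping.single \<nu> c) (\<mu> + \<nu>) = Poly_Mapping.lookup f \<mu> * c"
    using Sum_any_when_equal'[of "\<lambda>l. Poly_Mapping.lookup f l * c" \<mu>] by (simp add: * mult_when)
  show "Poly_Mapping.lookup (f * Poly_Mapping.single \<nu> c) \<mu> = 0" if "\<nexists>\<kappa>. \<mu> = \<kappa> + \<nu>"
    using that by (auto simp: *)
qed

lemma keys_times_single:
  fixes f :: "'k::comm_ring_1 mpoly"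
  shows "Poly_Mapping.keys (f * Poly_Mapping.single \<nu> 1) = (\<lambda>\<mu>. \<mu> + \<nu>) ` Poly_Mapping.keys f"
proof (intro set_eqI iffI)
  fix \<mu> assume \<mu>: "\<mu> \<in> Poly_Mapping.keys (f * Poly_Mapping.single \<nu> 1)"
  then obtain \<kappa> where "\<mu> = \<kappa> + \<nu>" using lookup_times_single(2)[of \<mu> \<nu> f 1] by (force simp: in_keys_iff)
  then show "\<mu> \<in> (\<lambda>\<mu>. \<mu> + \<nu>) ` Poly_Mapping.keys f"
    using \<mu> lookup_times_single(1)[of f \<nu> 1 \<kappa>] by (auto simp: in_keys_iff)
qed (use lookup_times_single(1)[of f \<nu> 1] in \<open>auto simp: in_keys_iff\<close>)

lemma poly_mapping_sum_monomials:
  "f = (\<Sum>\<mu>\<in>Poly_Mapping.keys f. Poly_Mapping.single \<mu> (Poly_Mapping.lookup f \<mu>))"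
  by (rule poly_mapping_eqI)
    (auto simp: lookup_sum lookup_single when_def sum.delta in_keys_iff)

text \<open>Storing the exponents of all monomials instead of generators turns sums, colons and
  membership into conditions on exponent vectors. Only the elements of \<open>T\<close> supported on
  \<open>V\<close> matter.\<close>

definition mon_ideal :: "(nat + nat) set \<Rightarrow> ((nat + nat) \<Rightarrow>\<^sub>0 nat) set \<Rightarrow> 'k::comm_ring_1 mpoly set" where
  "mon_ideal V T = {f \<in> polys_in V. Poly_Mapping.keys f \<subseteq> T}"

definition upclosed :: "(nat + nat) set \<Rightarrow> ((nat + nat) \<Rightarrow>\<^sub>0 nat) set \<Rightarrow> bool" where
  "upclosed V T \<longleftrightarrow> (\<forall>\<mu>\<in>T. \<forall>\<nu>. Poly_Mapping.keys \<nu> \<subseteq> V \<longrightarrow> \<nu> + \<mu> \<in> T)"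

lemma idl_mon_ideal:
  assumes "upclosed V T"
  shows "subring.idl (polys_in V) (mon_ideal V T :: 'k::comm_ring_1 mpoly set)"
proof -
  interpret subring "polys_in V :: 'k mpoly set" by (rule subring_polys_in)
  have 1: "f + g \<in> mon_ideal V T" if "f \<in> mon_ideal V T" "g \<in> mon_ideal V T" for f g :: "'k mpoly"
    using that Poly_Mapping.keys_add[of f g] by (auto simp: mon_ideal_def)
  have 2: "c * f \<in> mon_ideal V T" if "f \<in> mon_ideal V T" "c \<in> polys_in V" for f c :: "'k mpoly"
  proof -
    have "Poly_Mapping.keys (c * f) \<subseteq> T"
      using that Poly_Mapping.keys_mult[of c f] assms
      by (force simp: mon_ideal_def polys_in_def upclosed_def)
    then show ?thesis using that by (auto simp: mon_ideal_def)
  qed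
  show ?thesis unfolding idl_def using 1 2 by (auto simp: mon_ideal_def)
qed

lemma mon_ideal_gen:
  assumes M: "\<And>\<nu>. \<nu> \<in> M \<Longrightarrow> Poly_Mapping.keys \<nu> \<subseteq> V"
    and T: "T = {\<kappa> + \<nu> | \<kappa> \<nu>. \<nu> \<in> M \<and> Poly_Mapping.keys \<kappa> \<subseteq> V}"
  shows "ideal_gen (polys_in V) ((\<lambda>\<nu>. Poly_Mapping.single \<nu> (1::'k::comm_ring_1)) ` M) = mon_ideal V T"
    (is "ideal_gen ?R ?G = _")
proof
  interpret subring ?R by (rule subring_polys_in)
  have up: "upclosed V T"
    unfolding upclosed_def
  proof (intro ballI allI impI)
    fix \<mu> \<nu> :: "(nat + nat) \<Rightarrow>\<^sub>0 nat" assume \<mu>: "\<mu> \<in> T" and \<nu>: "Poly_Mapping.keys \<nu> \<subseteq> V"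
    then obtain \<kappa> \<rho> where *: "\<mu> = \<kappa> + \<rho>" "\<rho> \<in> M" "Poly_Mapping.keys \<kappa> \<subseteq> V" by (auto simp: T)
    then have "\<nu> + \<mu> = (\<nu> + \<kappa>) + \<rho>" by (simp add: add.assoc)
    moreover have "Poly_Mapping.keys (\<nu> + \<kappa>) \<subseteq> V" using Poly_Mapping.keys_add[of \<nu> \<kappa>] * \<nu> by auto
    ultimately show "\<nu> + \<mu> \<in> T" using * T by blast
  qed
  have "?G \<subseteq> mon_ideal V T"
  proof
    fix g assume "g \<in> ?G"
    then obtain \<nu> where \<nu>: "\<nu> \<in> M" "g = Poly_Mapping.single \<nu> 1" by blast
    then have "\<nu> \<in> T" unfolding T by (intro CollectI exI[of _ 0] exI[of _ \<nu>]) auto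
    then show "g \<in> mon_ideal V T" using \<nu> M by (auto simp: mon_ideal_def polys_in_def)
  qed
  then show "ideal_gen ?R ?G \<subseteq> mon_ideal V T" by (rule gen_least[OF idl_mon_ideal[OF up]])
  have GR: "?G \<subseteq> ?R" using M by (auto simp: polys_in_def subset_iff)
  show "mon_ideal V T \<subseteq> ideal_gen ?R ?G"
  proof
    fix f :: "'k mpoly" assume f: "f \<in> mon_ideal V T"
    have "Poly_Mapping.single \<mu> (Poly_Mapping.lookup f \<mu>) \<in> ideal_gen ?R ?G" if key: "\<mu> \<in> Poly_Mapping.keys f" for \<mu>
    proof -
      obtain \<kappa> \<nu> where *: "\<mu> = \<kappa> + \<nu>" "\<nu> \<in> M" "Poly_Mapping.keys \<kappa> \<subseteq> V"
        using f key by (auto simp: mon_ideal_def T)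
      have "Poly_Mapping.single \<mu> (Poly_Mapping.lookup f \<mu>) =
          Poly_Mapping.single \<kappa> (Poly_Mapping.lookup f \<mu>) * Poly_Mapping.single \<nu> 1"
        by (simp add: mult_single *)
      moreover have "Poly_Mapping.single \<kappa> (Poly_Mapping.lookup f \<mu>) \<in> ?R" using * by (auto simp: polys_in_def)
      moreover have "Poly_Mapping.single \<nu> 1 \<in> ideal_gen ?R ?G" using * by (intro gen_in) auto
      ultimately show ?thesis using idlD(4)[OF idl_gen[OF GR]] by simp
    qed
    then show "f \<in> ideal_gen ?R ?G"
      by (subst poly_mapping_sum_monomials) (rule idl_sum[OF idl_gen[OF GR]])
  qed
qed

lemma mon_ideal_insert:
  assumes up: "upclosed V T" and \<nu>: "Poly_Mapping.keys \<nu> \<subseteq> V"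
    and T': "T' = T \<union> {\<kappa> + \<nu> | \<kappa>. Poly_Mapping.keys \<kappa> \<subseteq> V}"
  shows "ideal_gen (polys_in V) (insert (Poly_Mapping.single \<nu> 1) (mon_ideal V T)) =
    (mon_ideal V T' :: 'k::comm_ring_1 mpoly set)" (is "ideal_gen ?R _ = _")
proof
  interpret subring ?R by (rule subring_polys_in)
  have "\<rho> + \<mu> \<in> T'" if asm: "\<mu> \<in> T'" "Poly_Mapping.keys \<rho> \<subseteq> V" for \<mu> \<rho>
  proof (cases "\<mu> \<in> T")
    case True
    then show ?thesis using up asm by (auto simp: upclosed_def T')
  next
    case False
    then obtain \<kappa> where "\<mu> = \<kappa> + \<nu>" "Poly_Mapping.keys \<kappa> \<subseteq> V" using asm by (auto simp: T')
    then have "\<rho> + \<mu> = (\<rho> + \<kappa>) + \<nu>" "Poly_Mapping.keys (\<rho> + \<kappa>) \<subseteq> V"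
      using asm Poly_Mapping.keys_add[of \<rho> \<kappa>] by (auto simp: add.assoc)
    then show ?thesis unfolding T' by blast
  qed
  then have up': "upclosed V T'" by (simp add: upclosed_def)
  have "\<nu> \<in> T'" unfolding T' by (intro UnI2 CollectI exI[of _ 0]) auto
  then have "insert (Poly_Mapping.single \<nu> 1) (mon_ideal V T) \<subseteq> (mon_ideal V T' :: 'k mpoly set)"
    using \<nu> by (auto simp: mon_ideal_def polys_in_def T')
  then show "ideal_gen ?R (insert (Poly_Mapping.single \<nu> 1) (mon_ideal V T)) \<subseteq> mon_ideal V T'"
    by (rule gen_least[OF idl_mon_ideal[OF up']])
  have sR: "Poly_Mapping.single \<nu> 1 \<in> ?R" using \<nu> by (auto simp: polys_in_def)
  note I = idl_insert[OF idl_mon_ideal[OF up] sR]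
  show "mon_ideal V T' \<subseteq> ideal_gen ?R (insert (Poly_Mapping.single \<nu> 1) (mon_ideal V T))" (is "_ \<subseteq> ?I")
  proof
    fix f :: "'k mpoly" assume f: "f \<in> mon_ideal V T'"
    have "Poly_Mapping.single \<mu> (Poly_Mapping.lookup f \<mu>) \<in> ?I" if key: "\<mu> \<in> Poly_Mapping.keys f" for \<mu>
    proof (cases "\<mu> \<in> T")
      case True
      then have "Poly_Mapping.single \<mu> (Poly_Mapping.lookup f \<mu>) \<in> mon_ideal V T"
        using f key by (auto simp: mon_ideal_def polys_in_def)
      then show ?thesis by (auto intro: gen_in)
    next
      case False
      then obtain \<kappa> where *: "\<mu> = \<kappa> + \<nu>" "Poly_Mapping.keys \<kappa> \<subseteq> V"
        using f key by (auto simp: mon_ideal_def T')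
      have "Poly_Mapping.single \<mu> (Poly_Mapping.lookup f \<mu>) =
          Poly_Mapping.single \<kappa> (Poly_Mapping.lookup f \<mu>) * Poly_Mapping.single \<nu> 1"
        by (simp add: mult_single *)
      moreover have "Poly_Mapping.single \<kappa> (Poly_Mapping.lookup f \<mu>) \<in> ?R" using * by (auto simp: polys_in_def)
      moreover have "Poly_Mapping.single \<nu> 1 \<in> ?I" by (rule gen_in) simp
      ultimately show ?thesis using idlD(4)[OF I] by simp
    qed
    then show "f \<in> ?I" by (subst poly_mapping_sum_monomials) (rule idl_sum[OF I])
  qed
qed

lemma mon_ideal_colon:
  assumes "Poly_Mapping.keys \<nu> \<subseteq> V"
  shows "{c \<in> polys_in V. c * Poly_Mapping.single \<nu> 1 \<in> mon_ideal V T} =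
    (mon_ideal V {\<mu>. \<mu> + \<nu> \<in> T} :: 'k::comm_ring_1 mpoly set)"
proof -
  interpret subring "polys_in V :: 'k mpoly set" by (rule subring_polys_in)
  have "Poly_Mapping.single \<nu> 1 \<in> (polys_in V :: 'k mpoly set)" using assms by (auto simp: polys_in_def)
  then show ?thesis by (auto simp: mon_ideal_def keys_times_single)
qed

section \<open>The Koszul complex\<close>

text \<open>An arbitrary total order on the variables; it fixes the Koszul signs on unordered
  sets.\<close>

definition before :: "nat + nat \<Rightarrow> nat + nat \<Rightarrow> bool" where
  "before v w \<longleftrightarrow> sum_encode v < sum_encode w"

lemma before_irrefl [simp]: "\<not> before v v"
  and before_total: "v \<noteq> w \<Longrightarrow> before v w \<or> before w v"
  by (auto simp: before_def not_less le_less dest: injD[OF inj_sum_encode])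

lemma before_asym: "before v w \<Longrightarrow> \<not> before w v"
  by (simp add: before_def)

definition ksign :: "nat + nat \<Rightarrow> (nat + nat) set \<Rightarrow> 'k::comm_ring_1 mpoly" where
  "ksign v G = (- 1) ^ card {w \<in> G. before w v}"

text \<open>The Koszul cochain complex of the elements \<open>g v\<close>; a cochain assigns a coefficient to
  every finite set of variables.\<close>

definition kdiff :: "(nat + nat \<Rightarrow> 'k::comm_ring_1 mpoly) \<Rightarrow> ((nat + nat) set \<Rightarrow> 'k mpoly) \<Rightarrow>
    (nat + nat) set \<Rightarrow> 'k mpoly" where
  "kdiff g \<phi> G = (\<Sum>v\<in>G. ksign v G * g v * \<phi> (G - {v}))"

text \<open>Contraction with the basis vector \<open>w\<close>, the homotopy of
  \<open>kdiff_kcontract\<close>.\<close>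

definition kcontract :: "nat + nat \<Rightarrow> ((nat + nat) set \<Rightarrow> 'k::comm_ring_1 mpoly) \<Rightarrow> (nat + nat) set \<Rightarrow> 'k mpoly" where
  "kcontract w \<phi> G = (if w \<in> G then 0 else ksign w G * \<phi> (insert w G))"

lemma ksign_sq [simp]: "ksign v G * ksign v G = 1"
  by (simp add: ksign_def power_add[symmetric] mult_2[symmetric])

lemma ksign_sq' [simp]: "ksign v G * (ksign v G * x) = x"
  by (simp add: mult.assoc[symmetric])

lemma ksign_insert:
  assumes "finite G" "w \<notin> G"
  shows "ksign v (insert w G) = (if before w v then - ksign v G else ksign v G)"
proof (cases "before w v")
  case True
  then have "{u \<in> insert w G. before u v} = insert w {u \<in> G. before u v}" by auto
  then show ?thesis using True assms by (simp add: ksign_def)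
next
  case False
  then have "{u \<in> insert w G. before u v} = {u \<in> G. before u v}" by auto
  then show ?thesis using False by (simp add: ksign_def)
qed

lemma ksign_remove:
  assumes "finite G" "w \<in> G"
  shows "ksign v (G - {w}) = (if before w v then - ksign v G else ksign v G :: 'k::comm_ring_1 mpoly)"
proof -
  have "insert w (G - {w}) = G" using assms by auto
  then have "ksign v G = (if before w v then - ksign v (G - {w}) else ksign v (G - {w}) :: 'k mpoly)"
    using ksign_insert[of "G - {w}" w v] assms(1) by simp
  then show ?thesis by (simp split: if_splits)
qed

lemma kdiff_add: "kdiff g (\<lambda>G. \<phi> G + \<psi> G) G = kdiff g \<phi> G + kdiff g \<psi> G"
  by (simp add: kdiff_def distrib_left sum.distrib)

lemma kdiff_scale: "kdiff g (\<lambda>G. c * \<phi> G) G = c * kdiff g \<phi> G"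
  by (simp add: kdiff_def sum_distrib_left mult_ac)

lemma kdiff_sum: "kdiff g (\<lambda>G. \<Sum>i\<in>F. \<phi> i G) G = (\<Sum>i\<in>F. kdiff g (\<phi> i) G)"
  by (simp add: kdiff_def sum_distrib_left sum.swap[of _ F])

text \<open>Removing \<open>v\<close> and \<open>w\<close> in either order reaches the same set with
  opposite signs, so ordered pairs cancel against their swaps.\<close>

lemma kdiff_kdiff:
  fixes \<phi> :: "(nat + nat) set \<Rightarrow> 'k::comm_ring_1 mpoly"
  assumes G: "finite G"
  shows "kdiff g (kdiff g \<phi>) G = 0"
proof -
  define t where "t = (\<lambda>(v, w). ksign v G * g v * (ksign w (G - {v}) * g w * \<phi> (G - {v} - {w})))"
  define S where "S = {(v, w). v \<in> G \<and> w \<in> G \<and> before v w}"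
  have S: "finite S" by (rule finite_subset[of _ "G \<times> G"]) (use G in \<open>auto simp: S_def\<close>)
  have anti: "t (w, v) = - t (v, w)" if "(v, w) \<in> S" for v w
  proof -
    have *: "v \<in> G" "w \<in> G" "before v w" "\<not> before w v" using that before_asym by (auto simp: S_def)
    have c: "G - {w} - {v} = G - {v} - {w}" by auto
    have s: "ksign w (G - {v}) = - (ksign w G :: 'k mpoly)" "ksign v (G - {w}) = (ksign v G :: 'k mpoly)"
      using * G by (auto simp: ksign_remove)
    have swap: "a * b * (c * d * x) = - (c * d * (- a * b * x))" for a b c d x :: "'k mpoly"
      by (simp only: mult_minus_left mult_minus_right minus_minus mult.assoc mult.left_commute)
    show ?thesis unfolding t_def prod.case c s by (rule swap)
  qed
  have un: "Sigma G (\<lambda>v. G - {v}) = S \<union> prod.swap ` S"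
    using before_total by (force simp: S_def)
  have disj: "S \<inter> prod.swap ` S = {}"
    by (auto simp: S_def dest: before_asym)
  have "kdiff g (kdiff g \<phi>) G = (\<Sum>p\<in>Sigma G (\<lambda>v. G - {v}). t p)"
    using G by (simp add: kdiff_def sum_distrib_left sum.Sigma t_def)
  also have "\<dots> = sum t S + (\<Sum>p\<in>S. t (prod.swap p))"
    unfolding un using S disj by (simp add: sum.union_disjoint sum.reindex o_def)
  also have "\<dots> = (\<Sum>p\<in>S. t p + t (prod.swap p))" by (simp add: sum.distrib)
  also have "\<dots> = 0" by (rule sum.neutral) (use anti in auto)
  finally show ?thesis .
qed

text \<open>Multiplication by \<open>g w\<close> is null-homotopic and hence annihilates cohomology.
  For \<open>w\<close> outside \<open>G\<close> the mixed terms cancel: comparing the two orders of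
  operations, exactly one of the two signs flips, whichever of \<open>v\<close> and \<open>w\<close>
  comes first.\<close>

lemma kdiff_kcontract:
  assumes G: "finite G"
  shows "kdiff g (kcontract w \<phi>) G + kcontract w (kdiff g \<phi>) G = g w * \<phi> G"
proof (cases "w \<in> G")
  case True
  have "kdiff g (kcontract w \<phi>) G = (\<Sum>v\<in>G. if v = w then ksign w G * g w * (ksign w G * \<phi> G) else 0)"
    unfolding kdiff_def
    by (rule sum.cong) (use True G in \<open>auto simp: kcontract_def ksign_remove insert_absorb\<close>)
  also have "\<dots> = (ksign w G * ksign w G) * (g w * \<phi> G)" using G True by (simp add: mult_ac)
  finally show ?thesis using True by (simp add: kcontract_def)
next
  case False
  have 1: "kdiff g (kcontract w \<phi>) G = (\<Sum>v\<in>G. ksign v G * g v * (ksign w (G - {v}) * \<phi> (insert w (G - {v}))))"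
    unfolding kdiff_def by (rule sum.cong) (use False in \<open>auto simp: kcontract_def\<close>)
  have "kcontract w (kdiff g \<phi>) G = ksign w G * (ksign w (insert w G) * g w * \<phi> G +
      (\<Sum>v\<in>G. ksign v (insert w G) * g v * \<phi> (insert w G - {v})))"
    using False G by (simp add: kcontract_def kdiff_def)
  also have "\<dots> = (ksign w G * ksign w G) * (g w * \<phi> G) +
      (\<Sum>v\<in>G. ksign w G * (ksign v (insert w G) * g v * \<phi> (insert w G - {v})))"
    using False G by (simp add: distrib_left sum_distrib_left ksign_insert mult.assoc)
  finally have 2: "kcontract w (kdiff g \<phi>) G = g w * \<phi> G +
      (\<Sum>v\<in>G. ksign w G * (ksign v (insert w G) * g v * \<phi> (insert w G - {v})))" unfolding ksign_sq by simp
  have "ksign v G * g v * (ksign w (G - {v}) * \<phi> (insert w (G - {v}))) +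
      ksign w G * (ksign v (insert w G) * g v * \<phi> (insert w G - {v})) = 0" if v: "v \<in> G" for v
  proof -
    have "insert w G - {v} = insert w (G - {v})" "v \<noteq> w" using v False by auto
    then consider "before v w" "\<not> before w v" | "before w v" "\<not> before v w"
      using before_total before_asym by blast
    then show ?thesis using v False G \<open>insert w G - {v} = insert w (G - {v})\<close>
      by cases (simp_all add: ksign_insert ksign_remove mult_ac)
  qed
  then show ?thesis unfolding 1 2 by (simp add: sum.distrib[symmetric] add.left_commute)
qed

context subring
begin

lemma ksign_in [simp]: "ksign v G \<in> R"
  by (simp add: ksign_def)

lemma kdiff_in_idl:
  assumes "idl J" "\<And>v. v \<in> G \<Longrightarrow> g v \<in> R" "\<And>v. v \<in> G \<Longrightarrow> \<phi> (G - {v}) \<in> J"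
  shows "kdiff g \<phi> G \<in> J"
  unfolding kdiff_def using assms(2,3) by (intro idl_sum[OF assms(1)] idlD(4)[OF assms(1)]) auto

lemma idl_R: "idl R"
  by (simp add: idl_def)

text \<open>A power of the first element \<open>f\<close> annihilates the cohomology by the
  homotopy. Its exponent is then lowered to 0: \<open>f\<close> is cancelled modulo
  \<open>J\<close>, after the primitive has been corrected by the vanishing for
  \<open>J + (f)\<close> one degree lower. Since only powers of the sequence have to lie in the
  ideal of the \<open>g v\<close>, these may be high powers of the variables.\<close>

theorem koszul_vanish:
  assumes "idl J" "set fs \<subseteq> R" "finite V" and g: "\<And>v. v \<in> V \<Longrightarrow> g v \<in> R"
    and pow: "\<And>f. f \<in> set fs \<Longrightarrow> \<exists>s c. f ^ s = (\<Sum>v\<in>V. c v * g v) \<and> (\<forall>v\<in>V. c v \<in> R)"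
    and "weak_reg_seq R J fs" "i < length fs" "\<And>G. G \<subseteq> V \<Longrightarrow> \<phi> G \<in> R"
    and "\<And>G. G \<subseteq> V \<Longrightarrow> card G = Suc i \<Longrightarrow> kdiff g \<phi> G \<in> J"
  shows "\<exists>\<eta>. (\<forall>G\<subseteq>V. \<eta> G \<in> R) \<and> (\<forall>G\<subseteq>V. card G = i \<longrightarrow> \<phi> G - kdiff g \<eta> G \<in> J)"
  using assms(1,2,5-)
proof (induction fs arbitrary: J i \<phi>)
  case Nil
  then show ?case by simp
next
  case (Cons f fs)
  note J = \<open>idl J\<close> and \<phi>R = Cons.prems(6) and coc = Cons.prems(7)
  have f: "f \<in> R" and reg: "\<And>g. g \<in> R \<Longrightarrow> f * g \<in> J \<Longrightarrow> g \<in> J" using Cons.prems by auto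
  have Jf: "idl (ideal_gen R (insert f J))" using idl_insert[OF J f] .
  have fin: "finite G" if "G \<subseteq> V" for G using that \<open>finite V\<close> by (rule finite_subset)
  have kR: "kdiff g \<psi> G \<in> R" if "\<forall>G\<subseteq>V. \<psi> G \<in> R" "G \<subseteq> V" for \<psi> G
    using that g by (intro kdiff_in_idl[OF idl_R]) blast+
  define exact where "exact = (\<lambda>t. \<exists>\<psi>. (\<forall>G\<subseteq>V. \<psi> G \<in> R) \<and>
    (\<forall>G\<subseteq>V. card G = i \<longrightarrow> f ^ t * \<phi> G - kdiff g \<psi> G \<in> J))"
  obtain s c where s: "f ^ s = (\<Sum>v\<in>V. c v * g v)" "\<forall>v\<in>V. c v \<in> R" using Cons.prems(3)[of f] by auto
  have "exact s"
    unfolding exact_def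
  proof (intro exI conjI allI impI)
    show "(\<Sum>w\<in>V. c w * kcontract w \<phi> G) \<in> R" if "G \<subseteq> V" for G
      using that s \<phi>R by (auto intro!: sum_in mult_in simp: kcontract_def)
    fix G assume G: "G \<subseteq> V" "card G = i"
    have "f ^ s * \<phi> G = (\<Sum>w\<in>V. c w * (g w * \<phi> G))" by (simp add: s sum_distrib_right mult.assoc)
    also have "\<dots> = (\<Sum>w\<in>V. c w * kdiff g (kcontract w \<phi>) G + c w * kcontract w (kdiff g \<phi>) G)"
      using fin[OF G(1)] by (simp add: kdiff_kcontract[symmetric] distrib_left)
    also have "\<dots> = kdiff g (\<lambda>G. \<Sum>w\<in>V. c w * kcontract w \<phi> G) G + (\<Sum>w\<in>V. c w * kcontract w (kdiff g \<phi>) G)"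
      by (simp add: kdiff_sum kdiff_scale sum.distrib)
    finally have "f ^ s * \<phi> G - kdiff g (\<lambda>G. \<Sum>w\<in>V. c w * kcontract w \<phi> G) G =
        (\<Sum>w\<in>V. c w * kcontract w (kdiff g \<phi>) G)" by simp
    moreover have "c w * kcontract w (kdiff g \<phi>) G \<in> J" if "w \<in> V" for w
      using coc[of "insert w G"] that G s fin[OF G(1)] idlD[OF J] by (auto simp: kcontract_def)
    ultimately show "f ^ s * \<phi> G - kdiff g (\<lambda>G. \<Sum>w\<in>V. c w * kcontract w \<phi> G) G \<in> J"
      by (auto intro: idl_sum[OF J])
  qed
  \<comment> \<open>Modulo \<open>J + (f)\<close> the primitive \<open>\<psi>\<close> is a cocycle,
    so by induction \<open>\<psi> = d \<theta> + j + f e\<close>. Applying \<open>d\<close> leaves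
    \<open>d \<psi> = d j + f d e\<close>, and one factor \<open>f\<close> cancels. In degree 0
    coboundaries vanish and \<open>e = 0\<close> does.\<close>
  moreover have "exact t" if "exact (Suc t)" for t
  proof -
    obtain \<psi> where \<psi>: "\<And>G. G \<subseteq> V \<Longrightarrow> \<psi> G \<in> R"
      "\<And>G. G \<subseteq> V \<Longrightarrow> card G = i \<Longrightarrow> f ^ Suc t * \<phi> G - kdiff g \<psi> G \<in> J"
      using \<open>exact (Suc t)\<close> unfolding exact_def by blast
    have "\<exists>e j. (\<forall>G\<subseteq>V. e G \<in> R) \<and> (\<forall>G\<subseteq>V. card G = i \<longrightarrow> kdiff g \<psi> G = j G + f * kdiff g e G \<and> j G \<in> J)"
    proof (cases i)
      case 0
      then have "kdiff g \<psi> G = 0 + f * kdiff g (\<lambda>_. 0) G" if "G \<subseteq> V" "card G = i" for G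
        using that fin[of G] by (simp add: kdiff_def)
      then show ?thesis using idlD(2)[OF J] zero_in by (intro exI[of _ "\<lambda>_. 0"]) auto
    next
      case (Suc i')
      have cyc: "kdiff g \<psi> G \<in> ideal_gen R (insert f J)" if "G \<subseteq> V" "card G = Suc i'" for G
      proof -
        have "kdiff g \<psi> G = - (f ^ Suc t * \<phi> G - kdiff g \<psi> G) + (f ^ t * \<phi> G) * f" by simp
        moreover have "- (f ^ Suc t * \<phi> G - kdiff g \<psi> G) \<in> J"
          using \<psi>(2)[of G] that Suc by (intro idlD(6)[OF J]) auto
        moreover have "f ^ t * \<phi> G \<in> R" using \<phi>R that f by auto
        ultimately show ?thesis by (intro gen_insertI[OF J f])
      qed
      have "\<exists>\<theta>. (\<forall>G\<subseteq>V. \<theta> G \<in> R) \<and> (\<forall>G\<subseteq>V. card G = i' \<longrightarrow> \<psi> G - kdiff g \<theta> G \<in> ideal_gen R (insert f J))"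
        by (rule Cons.IH[OF Jf]) (use Cons.prems Suc \<psi>(1) cyc in auto)
      then obtain \<theta> where \<theta>: "\<And>G. G \<subseteq> V \<Longrightarrow> \<theta> G \<in> R"
        "\<And>G. G \<subseteq> V \<Longrightarrow> card G = i' \<Longrightarrow> \<psi> G - kdiff g \<theta> G \<in> ideal_gen R (insert f J)" by blast
      have "\<exists>j e. \<psi> G - kdiff g \<theta> G = j + e * f \<and> j \<in> J \<and> e \<in> R" if "G \<subseteq> V" "card G = i'" for G
        using \<theta>(2)[OF that] by (auto simp: gen_insert[OF J f, simplified])
      then obtain j e where je: "\<And>G. G \<subseteq> V \<Longrightarrow> card G = i' \<Longrightarrow>
          \<psi> G - kdiff g \<theta> G = j G + e G * f \<and> j G \<in> J \<and> e G \<in> R" by metis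
      \<comment> \<open>\<open>e\<close> is controlled only on sets of size \<open>i'\<close>; the
        value 0 elsewhere keeps the cochain in \<open>R\<close>.\<close>
      define e' where "e' = (\<lambda>G. if card G = i' then e G else 0)"
      have "kdiff g \<psi> G = kdiff g j G + f * kdiff g e' G \<and> kdiff g j G \<in> J" if G: "G \<subseteq> V" "card G = i" for G
      proof -
        have sub: "G - {v} \<subseteq> V" "card (G - {v}) = i'" if "v \<in> G" for v
          using that G fin[OF G(1)] Suc by auto
        have "kdiff g \<psi> G = kdiff g (\<lambda>G. kdiff g \<theta> G + (j G + f * e' G)) G"
          unfolding kdiff_def[of g _ G]
        proof (rule sum.cong[OF refl])
          fix v assume "v \<in> G"
          then have "\<psi> (G - {v}) - kdiff g \<theta> (G - {v}) = j (G - {v}) + e' (G - {v}) * f"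
            using je[OF sub] sub by (simp add: e'_def)
          then have "\<psi> (G - {v}) = kdiff g \<theta> (G - {v}) + (j (G - {v}) + f * e' (G - {v}))"
            by (simp add: algebra_simps)
          then show "ksign v G * g v * \<psi> (G - {v}) =
              ksign v G * g v * (kdiff g \<theta> (G - {v}) + (j (G - {v}) + f * e' (G - {v})))" by simp
        qed
        also have "\<dots> = kdiff g j G + f * kdiff g e' G"
          by (simp add: kdiff_add kdiff_scale kdiff_kdiff[OF fin[OF G(1)]])
        moreover have "kdiff g j G \<in> J" using g G je[OF sub] by (intro kdiff_in_idl[OF J]) auto
        ultimately show ?thesis by simp
      qed
      moreover have "\<forall>G\<subseteq>V. e' G \<in> R" using je by (simp add: e'_def)
      ultimately show ?thesis by (intro exI[of _ e'] exI[of _ "kdiff g j"]) auto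
    qed
    then obtain e j where e: "\<And>G. G \<subseteq> V \<Longrightarrow> e G \<in> R"
      "\<And>G. G \<subseteq> V \<Longrightarrow> card G = i \<Longrightarrow> kdiff g \<psi> G = j G + f * kdiff g e G \<and> j G \<in> J" by blast
    have "f ^ t * \<phi> G - kdiff g e G \<in> J" if G: "G \<subseteq> V" "card G = i" for G
    proof (rule reg)
      show "f ^ t * \<phi> G - kdiff g e G \<in> R" using f \<phi>R[OF G(1)] kR e(1) G by auto
      have eq: "f * (f ^ t * \<phi> G - kdiff g e G) = (f ^ Suc t * \<phi> G - kdiff g \<psi> G) + j G"
        using e(2)[OF G] by (simp add: algebra_simps)
      show "f * (f ^ t * \<phi> G - kdiff g e G) \<in> J"
        unfolding eq by (rule idlD(3)[OF J \<psi>(2)[OF G]]) (use e(2)[OF G] in blast)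
    qed
    then show ?thesis unfolding exact_def using e(1) by blast
  qed
  ultimately have "exact 0" by (induction s) auto
  then show ?case unfolding exact_def by simp
qed

end

section \<open>Upper bounds for the length of regular sequences\<close>

lemma Var_power: "Var v ^ N = (Poly_Mapping.single (Poly_Mapping.single v N) 1 :: 'k::comm_ring_1 mpoly)"
  by (induction N) (simp_all add: Var_def mult_single single_add[symmetric])

lemma Var_in: "v \<in> V \<Longrightarrow> Var v \<in> polys_in V"
  by (auto simp: Var_def polys_in_def)

text \<open>Without constant term, every factor contributes at least 1 to the total degree.\<close>

lemma sum_lookup_power:
  fixes f :: "'k::comm_ring_1 mpoly"
  assumes "finite V" "f \<in> max_ideal (polys_in V)" "\<mu> \<in> Poly_Mapping.keys (f ^ s)"
  shows "s \<le> (\<Sum>v\<in>V. Poly_Mapping.lookup \<mu> v)"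
  using assms(3)
proof (induction s arbitrary: \<mu>)
  case (Suc s)
  then obtain \<kappa> \<nu> where *: "\<mu> = \<kappa> + \<nu>" "\<kappa> \<in> Poly_Mapping.keys f" "\<nu> \<in> Poly_Mapping.keys (f ^ s)"
    using Poly_Mapping.keys_mult[of f "f ^ s"] by auto
  have "\<kappa> \<noteq> 0" using * assms(2) by (auto simp: max_ideal_def in_keys_iff)
  then obtain v where v: "Poly_Mapping.lookup \<kappa> v \<noteq> 0" by (metis lookup_zero poly_mapping_eqI)
  moreover have "Poly_Mapping.keys \<kappa> \<subseteq> V" using * assms(2) by (auto simp: max_ideal_def polys_in_def)
  ultimately have "v \<in> V" by (auto simp: in_keys_iff)
  then have "Poly_Mapping.lookup \<kappa> v \<le> (\<Sum>v\<in>V. Poly_Mapping.lookup \<kappa> v)"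
    using assms(1) by (intro member_le_sum) auto
  then show ?case using Suc.IH[OF *(3)] v by (simp add: * lookup_add sum.distrib)
qed simp

lemma max_ideal_power:
  fixes f :: "'k::comm_ring_1 mpoly"
  assumes V: "finite V" and f: "f \<in> max_ideal (polys_in V)" and N: "0 < N"
  shows "\<exists>s c. f ^ s = (\<Sum>v\<in>V. c v * Var v ^ N) \<and> (\<forall>v\<in>V. c v \<in> polys_in V)"
proof -
  interpret subring "polys_in V :: 'k mpoly set" by (rule subring_polys_in)
  define M where "M = (\<lambda>v. Poly_Mapping.single v N) ` V"
  define h :: "nat + nat \<Rightarrow> 'k mpoly" where "h = (\<lambda>v. Var v ^ N)"
  define T where "T = {\<kappa> + \<nu> | \<kappa> \<nu>. \<nu> \<in> M \<and> Poly_Mapping.keys \<kappa> \<subseteq> V}"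
  \<comment> \<open>Pigeonhole: a monomial with all exponents below \<open>N\<close> has total
    degree at most \<open>N * card V\<close>.\<close>
  define s where "s = Suc (N * card V)"
  have fs: "f ^ s \<in> polys_in V" using f by (simp add: max_ideal_def)
  have "\<mu> \<in> T" if \<mu>: "\<mu> \<in> Poly_Mapping.keys (f ^ s)" for \<mu>
  proof -
    have "\<exists>v\<in>V. N \<le> Poly_Mapping.lookup \<mu> v"
    proof (rule ccontr)
      assume "\<not> ?thesis"
      then have "(\<Sum>v\<in>V. Poly_Mapping.lookup \<mu> v) \<le> (\<Sum>v\<in>V. N)" by (intro sum_mono) auto
      then show False using sum_lookup_power[OF V f \<mu>] by (simp add: s_def mult.commute)
    qed
    then obtain v where v: "v \<in> V" "N \<le> Poly_Mapping.lookup \<mu> v" by blast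
    have "\<mu> = (\<mu> - Poly_Mapping.single v N) + Poly_Mapping.single v N"
      using v by (intro poly_mapping_eqI) (auto simp: lookup_add lookup_minus lookup_single when_def)
    moreover have "Poly_Mapping.keys (\<mu> - Poly_Mapping.single v N) \<subseteq> V"
    proof
      fix x assume "x \<in> Poly_Mapping.keys (\<mu> - Poly_Mapping.single v N)"
      then have "x \<in> Poly_Mapping.keys \<mu>" by (auto simp: in_keys_iff lookup_minus)
      then show "x \<in> V" using fs \<mu> by (auto simp: polys_in_def)
    qed
    ultimately show ?thesis unfolding T_def M_def using v by blast
  qed
  then have "f ^ s \<in> mon_ideal V T" using fs by (auto simp: mon_ideal_def)
  then have "f ^ s \<in> ideal_gen (polys_in V) ((\<lambda>\<nu>. Poly_Mapping.single \<nu> 1) ` M)"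
    by (subst mon_ideal_gen[OF _ T_def]) (auto simp: M_def split: if_splits)
  also have "(\<lambda>\<nu>. Poly_Mapping.single \<nu> 1) ` M = h ` V"
    by (auto simp: M_def h_def Var_power)
  finally obtain F c where F: "f ^ s = (\<Sum>g\<in>F. c g * g)" "F \<subseteq> h ` V" "\<forall>g\<in>F. c g \<in> polys_in V"
    by (auto simp: ideal_gen_def)
  \<comment> \<open>\<open>ideal_gen\<close> sums over a set of generators, the goal over variables;
    distinct variables have distinct powers because \<open>N\<close> is positive.\<close>
  have inj: "inj h"
  proof (rule injI)
    fix u v assume "h u = h v"
    then have "Poly_Mapping.keys (h u) = Poly_Mapping.keys (h v)" by simp
    then have "Poly_Mapping.keys (Poly_Mapping.single u N) = Poly_Mapping.keys (Poly_Mapping.single v N)"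
      by (simp add: h_def Var_power)
    then show "u = v" using N by simp
  qed
  have "f ^ s = (\<Sum>v\<in>{v\<in>V. h v \<in> F}. c (h v) * h v)"
    unfolding F(1) using F(2) inj
    by (subst sum.reindex[symmetric, of h, unfolded o_def]) (auto intro: inj_on_subset intro!: sum.cong)
  also have "\<dots> = (\<Sum>v\<in>V. (if h v \<in> F then c (h v) else 0) * h v)"
    using V by (intro sum.mono_neutral_cong_left) auto
  finally show ?thesis using F(3) unfolding h_def
    by (intro exI[of _ s] exI[of _ "\<lambda>v. if Var v ^ N \<in> F then c (Var v ^ N) else 0"]) auto
qed

text \<open>The coefficient at a monomial \<open>\<mu>\<close> shows that cocycles are not exact: if the exponents of \<open>\<mu>\<close> are
  below \<open>N\<close> outside \<open>X\<close>, only few terms of a coboundary contribute.\<close>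

lemma lookup_kdiff_Var:
  fixes \<eta> :: "(nat + nat) set \<Rightarrow> 'k::comm_ring_1 mpoly"
  assumes "finite G" "\<And>v. v \<in> G - X \<Longrightarrow> Poly_Mapping.lookup \<mu> v < N"
  shows "Poly_Mapping.lookup (kdiff (\<lambda>v. Var v ^ N) \<eta> G) \<mu> =
    (\<Sum>v\<in>G \<inter> X. Poly_Mapping.lookup (ksign v G * Var v ^ N * \<eta> (G - {v})) \<mu>)"
proof -
  have "Poly_Mapping.lookup (ksign v G * Var v ^ N * \<eta> (G - {v})) \<mu> = 0" if "v \<in> G - X" for v
  proof -
    have "\<nexists>\<kappa>. \<mu> = \<kappa> + Poly_Mapping.single v N"
      using assms(2)[OF that] by (auto simp: lookup_add)
    then show ?thesis
      using lookup_times_single(2)[of \<mu> "Poly_Mapping.single v N" "ksign v G * \<eta> (G - {v})" 1]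
      by (simp add: Var_power mult_ac)
  qed
  then show ?thesis unfolding kdiff_def lookup_sum using assms(1)
    by (intro sum.mono_neutral_right) auto
qed

lemma ksign_cases: "ksign v G = (1 :: 'k::comm_ring_1 mpoly) \<or> ksign v G = (- 1 :: 'k mpoly)"
  by (simp add: ksign_def minus_one_power_iff)

context
  fixes V :: "(nat + nat) set" and T :: "((nat + nat) \<Rightarrow>\<^sub>0 nat) set" and fs :: "'k::comm_ring_1 mpoly list"
    and m :: "(nat + nat) \<Rightarrow>\<^sub>0 nat" and F :: "(nat + nat) set" and N :: nat
  assumes V: "finite V" and up: "upclosed V T" and fs: "set fs \<subseteq> max_ideal (polys_in V)"
    and weak: "weak_reg_seq (polys_in V) (mon_ideal V T) fs"
    and m: "Poly_Mapping.keys m \<subseteq> V" and FV: "F \<subseteq> V"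
    and small: "\<And>v. v \<in> F \<Longrightarrow> Poly_Mapping.lookup m v < N" and N: "0 < N"
begin

interpretation subring "polys_in V :: 'k mpoly set" by (rule subring_polys_in)

abbreviation (input) pow_monom :: "nat + nat \<Rightarrow> (nat + nat) \<Rightarrow>\<^sub>0 nat" where
  "pow_monom v \<equiv> Poly_Mapping.single v N"

definition point_cochain :: "(nat + nat) set \<Rightarrow> 'k mpoly" where
  "point_cochain G = (if G = F then Poly_Mapping.single m 1 else 0)"

lemma point_cochain_in: "point_cochain G \<in> polys_in V"
  using m by (auto simp: point_cochain_def polys_in_def)

lemma finF: "finite F"
  using V FV by (rule finite_subset[rotated])

lemma vanish:
  assumes "i < length fs" "\<And>G. G \<subseteq> V \<Longrightarrow> \<phi> G \<in> polys_in V"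
    and "\<And>G. G \<subseteq> V \<Longrightarrow> card G = Suc i \<Longrightarrow> kdiff (\<lambda>v. Var v ^ N) \<phi> G \<in> mon_ideal V T"
  shows "\<exists>\<eta>. \<forall>G\<subseteq>V. card G = i \<longrightarrow> \<phi> G - kdiff (\<lambda>v. Var v ^ N) \<eta> G \<in> (mon_ideal V T :: 'k mpoly set)"
proof -
  have "set fs \<subseteq> polys_in V" using fs by (auto simp: max_ideal_def)
  then have "\<exists>\<eta>. (\<forall>G\<subseteq>V. \<eta> G \<in> (polys_in V :: 'k mpoly set)) \<and>
      (\<forall>G\<subseteq>V. card G = i \<longrightarrow> \<phi> G - kdiff (\<lambda>v. Var v ^ N) \<eta> G \<in> mon_ideal V T)"
  proof (rule koszul_vanish[OF idl_mon_ideal[OF up] _ V])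
    show "\<exists>s c. f ^ s = (\<Sum>v\<in>V. c v * Var v ^ N) \<and> (\<forall>v\<in>V. c v \<in> polys_in V)" if "f \<in> set fs" for f
      using max_ideal_power[OF V _ N] fs that by blast
  qed (use weak assms in \<open>auto simp: Var_in\<close>)
  then show ?thesis by blast
qed

text \<open>The cochain with value \<open>m\<close> at \<open>F\<close> is a cocycle, because every
  further variable pushes \<open>m\<close> into the ideal. It is no coboundary: every term of a
  coboundary at \<open>F\<close> is a multiple of some \<open>Var v ^ N\<close> with
  \<open>v\<close> in \<open>F\<close>, which does not divide \<open>m\<close>. So the cohomology in
  degree \<open>card F\<close> is nonzero.\<close>

theorem weak_reg_length_le:
  assumes mT: "m \<notin> T" and dom: "\<And>v. v \<in> V - F \<Longrightarrow> m + pow_monom v \<in> T"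
  shows "length fs \<le> card F"
proof (rule ccontr)
  assume "\<not> length fs \<le> card F"
  then have len: "card F < length fs" by simp
  have "kdiff (\<lambda>v. Var v ^ N) point_cochain G \<in> mon_ideal V T" if G: "G \<subseteq> V" "card G = Suc (card F)" for G
    unfolding kdiff_def
  proof (rule idl_sum[OF idl_mon_ideal[OF up]])
    fix v assume v: "v \<in> G"
    show "ksign v G * Var v ^ N * point_cochain (G - {v}) \<in> mon_ideal V T"
    proof (cases "G - {v} = F")
      case True
      then have vF: "v \<in> V - F" using v G by auto
      have "Poly_Mapping.single (m + pow_monom v) 1 \<in> (mon_ideal V T :: 'k mpoly set)"
        using dom[OF vF] m vF Poly_Mapping.keys_add[of m "pow_monom v"]
        by (auto simp: mon_ideal_def polys_in_def split: if_splits)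
      then have "ksign v G * Poly_Mapping.single (m + pow_monom v) 1 \<in> (mon_ideal V T :: 'k mpoly set)"
        by (rule idlD(4)[OF idl_mon_ideal[OF up]]) simp
      then show ?thesis using True by (simp add: point_cochain_def Var_power mult_single mult.assoc add.commute)
    qed (simp add: point_cochain_def idlD(2)[OF idl_mon_ideal[OF up]])
  qed
  then obtain \<eta> where \<eta>: "\<And>G. G \<subseteq> V \<Longrightarrow> card G = card F \<Longrightarrow>
      point_cochain G - kdiff (\<lambda>v. Var v ^ N) \<eta> G \<in> (mon_ideal V T :: 'k mpoly set)"
    using vanish[OF len, of point_cochain] point_cochain_in by blast
  have "Poly_Mapping.lookup (point_cochain F - kdiff (\<lambda>v. Var v ^ N) \<eta> F) m = 0"
    using \<eta>[OF FV refl] mT by (auto simp: mon_ideal_def in_keys_iff)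
  moreover have "Poly_Mapping.lookup (kdiff (\<lambda>v. Var v ^ N) \<eta> F) m = 0"
    using lookup_kdiff_Var[OF finF, of "{}" m N \<eta>] small by simp
  ultimately show False by (simp add: lookup_minus point_cochain_def)
qed

text \<open>The class separates the two parts \<open>X\<close> and \<open>Y\<close> of the link of
  \<open>F\<close>: from the coboundary of the point cochain only the values on subsets of
  \<open>F \<union> X\<close> are kept. A primitive would need the coefficient 1 at \<open>F\<close>
  because of an element of \<open>X\<close>, and 0 because of an element of
  \<open>Y\<close>.\<close>

theorem weak_reg_length_le_Suc:
  assumes X: "X \<subseteq> V - F" "X \<noteq> {}" and Y: "Y \<subseteq> V - F" "Y \<noteq> {}" and XY: "X \<inter> Y = {}"
    and nT: "\<And>v. v \<in> X \<union> Y \<Longrightarrow> m + pow_monom v \<notin> T"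
    and dom: "\<And>u v. u \<in> X \<Longrightarrow> v \<in> V - F - X \<Longrightarrow> m + pow_monom u + pow_monom v \<in> T"
  shows "length fs \<le> Suc (card F)"
proof (rule ccontr)
  assume "\<not> length fs \<le> Suc (card F)"
  then have len: "Suc (card F) < length fs" by simp
  let ?d = "kdiff (\<lambda>v. Var v ^ N) :: _ \<Rightarrow> _ \<Rightarrow> 'k mpoly"
  note I = idl_mon_ideal[OF up, where 'k = 'k]
  define \<phi> where "\<phi> = (\<lambda>G. if G \<subseteq> F \<union> X then ?d point_cochain G else 0)"
  have \<phi>R: "\<phi> G \<in> polys_in V" if "G \<subseteq> V" for G
  proof -
    have "?d point_cochain G \<in> polys_in V"
      by (rule kdiff_in_idl[OF idl_R]) (use that point_cochain_in in \<open>auto intro!: power_in Var_in\<close>)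
    then show ?thesis by (simp add: \<phi>_def)
  qed
  \<comment> \<open>The truncation disturbs the cocycle condition only on sets with one element of
    \<open>X\<close> and one outside \<open>F \<union> X\<close>; there \<open>dom\<close> puts the
    term into the ideal.\<close>
  have "?d \<phi> G \<in> mon_ideal V T" if G: "G \<subseteq> V" for G
  proof (cases "G \<subseteq> F \<union> X")
    case True
    then have "\<phi> (G - {v}) = ?d point_cochain (G - {v})" for v by (auto simp: \<phi>_def)
    then have "?d \<phi> G = ?d (?d point_cochain) G" by (simp add: kdiff_def[of _ _ G])
    also have "\<dots> = 0" using finite_subset[OF G V] by (rule kdiff_kdiff)
    finally show ?thesis using idlD(2)[OF I] by simp
  next
    case False
    show ?thesis
      unfolding kdiff_def[of _ \<phi>]
    proof (rule idl_sum[OF I])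
      fix v assume v: "v \<in> G"
      show "ksign v G * Var v ^ N * \<phi> (G - {v}) \<in> mon_ideal V T"
      proof (cases "G - {v} \<subseteq> F \<union> X")
        case True
        then have vFX: "v \<in> V - F - X" using False v G by auto
        have "ksign v G * Var v ^ N * (ksign u (G - {v}) * Var u ^ N * point_cochain (G - {v} - {u})) \<in> mon_ideal V T"
          if u: "u \<in> G - {v}" for u
        proof (cases "G - {v} - {u} = F")
          case Feq: True
          then have uX: "u \<in> X" using u True by auto
          have "Poly_Mapping.single (m + pow_monom u + pow_monom v) 1 \<in> (mon_ideal V T :: 'k mpoly set)"
          proof -
            have "Poly_Mapping.keys (m + pow_monom u + pow_monom v) \<subseteq> V"
              using m uX X vFX Poly_Mapping.keys_add[of m "pow_monom u"]
                Poly_Mapping.keys_add[of "m + pow_monom u" "pow_monom v"]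
              by (auto split: if_splits)
            then show ?thesis using dom[OF uX vFX] by (simp add: mon_ideal_def polys_in_def)
          qed
          then have "(ksign v G * ksign u (G - {v})) * Poly_Mapping.single (m + pow_monom u + pow_monom v) 1
              \<in> (mon_ideal V T :: 'k mpoly set)"
            by (rule idlD(4)[OF I]) simp
          also have "Poly_Mapping.single (m + pow_monom u + pow_monom v) (1 :: 'k) =
              Var v ^ N * (Var u ^ N * point_cochain F)"
            by (simp add: point_cochain_def Var_power mult_single add_ac)
          finally show ?thesis using Feq by (simp add: mult_ac)
        qed (simp add: point_cochain_def idlD(2)[OF I])
        then show ?thesis using True
          by (auto simp: \<phi>_def kdiff_def sum_distrib_left intro: idl_sum[OF I])
      qed (simp add: \<phi>_def idlD(2)[OF I])
    qed
  qed
  then obtain \<eta> where \<eta>: "\<And>G. G \<subseteq> V \<Longrightarrow> card G = Suc (card F) \<Longrightarrow>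
      \<phi> G - ?d \<eta> G \<in> mon_ideal V T"
    using vanish[OF len, of \<phi>] \<phi>R by blast
  \<comment> \<open>No \<open>Var u ^ N\<close> with \<open>u\<close> in \<open>F\<close> divides
    the monomial, so only the face \<open>F\<close> contributes.\<close>
  have look: "Poly_Mapping.lookup (?d \<psi> (insert v F)) (m + pow_monom v) =
      Poly_Mapping.lookup (ksign v (insert v F) * \<psi> F) m" if "v \<notin> F" for v and \<psi> :: "_ \<Rightarrow> 'k mpoly"
  proof -
    have "Poly_Mapping.lookup (?d \<psi> (insert v F)) (m + pow_monom v) =
        Poly_Mapping.lookup (ksign v (insert v F) * Var v ^ N * \<psi> F) (m + pow_monom v)"
    proof -
      have "Poly_Mapping.lookup (m + pow_monom v) u < N" if "u \<in> insert v F - {v}" for u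
        using that small by (auto simp: lookup_add lookup_single when_def)
      then show ?thesis
        using lookup_kdiff_Var[of "insert v F" "{v}" "m + pow_monom v" N \<psi>] finF that by simp
    qed
    then show ?thesis
      using lookup_times_single(1)[of "ksign v (insert v F) * \<psi> F" "pow_monom v" 1 m]
      by (simp add: Var_power mult_ac)
  qed
  have zero: "Poly_Mapping.lookup (\<phi> (insert v F)) (m + pow_monom v) =
      Poly_Mapping.lookup (ksign v (insert v F) * \<eta> F) m" if v: "v \<in> X \<union> Y" for v
  proof -
    have vF: "v \<notin> F" "insert v F \<subseteq> V" using v X Y FV by auto
    have "\<phi> (insert v F) - ?d \<eta> (insert v F) \<in> mon_ideal V T" using \<eta>[OF vF(2)] vF finF by simp
    then have "Poly_Mapping.lookup (\<phi> (insert v F) - ?d \<eta> (insert v F)) (m + pow_monom v) = 0"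
      using nT[OF v] by (auto simp: mon_ideal_def in_keys_iff)
    then show ?thesis using look[OF vF(1), of \<eta>] by (simp add: lookup_minus)
  qed
  obtain x y where x: "x \<in> X" and y: "y \<in> Y" using X Y by blast
  have "Poly_Mapping.lookup (ksign x (insert x F) * point_cochain F) m = Poly_Mapping.lookup (ksign x (insert x F) * \<eta> F) m"
    using zero[of x] look[of x point_cochain] x X by (auto simp: \<phi>_def)
  then have "Poly_Mapping.lookup (\<eta> F) m = 1" using ksign_cases[of x "insert x F", where 'k = 'k] by (auto simp: point_cochain_def)
  moreover have "\<phi> (insert y F) = 0" using y Y XY by (auto simp: \<phi>_def)
  then have "Poly_Mapping.lookup (\<eta> F) m = 0"
    using zero[of y] y ksign_cases[of y "insert y F", where 'k = 'k] by auto
  ultimately show False by simp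
qed

end

section \<open>Elementary symmetric polynomials\<close>

lemma mon_ideal_cong:
  assumes "\<And>\<mu>. Poly_Mapping.keys \<mu> \<subseteq> V \<Longrightarrow> \<mu> \<in> T \<longleftrightarrow> \<mu> \<in> T'"
  shows "mon_ideal V T = mon_ideal V T'"
  using assms by (auto simp: mon_ideal_def polys_in_def subset_iff)

lemma poly_mapping_split:
  fixes \<mu> \<nu> :: "'a \<Rightarrow>\<^sub>0 nat"
  shows "(\<forall>v. Poly_Mapping.lookup \<nu> v \<le> Poly_Mapping.lookup \<mu> v) \<Longrightarrow> \<mu> = (\<mu> - \<nu>) + \<nu>"
  by (rule poly_mapping_eqI) (simp add: lookup_add lookup_minus)

lemma keys_minus_subset:
  fixes \<mu> \<nu> :: "'a \<Rightarrow>\<^sub>0 nat"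
  shows "Poly_Mapping.keys (\<mu> - \<nu>) \<subseteq> Poly_Mapping.keys \<mu>"
  by (auto simp: in_keys_iff lookup_minus)

lemma mon_ideal_insert_Var:
  assumes "upclosed V T" "v \<in> V"
    and T': "\<And>\<mu>. Poly_Mapping.keys \<mu> \<subseteq> V \<Longrightarrow> \<mu> \<in> T' \<longleftrightarrow> \<mu> \<in> T \<or> 0 < Poly_Mapping.lookup \<mu> v"
  shows "ideal_gen (polys_in V) (insert (Var v) (mon_ideal V T)) = (mon_ideal V T' :: 'k::comm_ring_1 mpoly set)"
proof -
  let ?\<nu> = "Poly_Mapping.single v 1"
  let ?T = "T \<union> {\<kappa> + ?\<nu> | \<kappa>. Poly_Mapping.keys \<kappa> \<subseteq> V}"
  have "ideal_gen (polys_in V) (insert (Var v) (mon_ideal V T)) = (mon_ideal V ?T :: 'k mpoly set)"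
    unfolding Var_def by (rule mon_ideal_insert[OF assms(1) _ refl]) (use assms(2) in auto)
  also have "\<dots> = mon_ideal V T'"
  proof (rule mon_ideal_cong)
    fix \<mu> :: "nat + nat \<Rightarrow>\<^sub>0 nat" assume \<mu>: "Poly_Mapping.keys \<mu> \<subseteq> V"
    have "0 < Poly_Mapping.lookup \<mu> v \<Longrightarrow> \<exists>\<kappa>. \<mu> = \<kappa> + ?\<nu> \<and> Poly_Mapping.keys \<kappa> \<subseteq> V"
      using poly_mapping_split[of ?\<nu> \<mu>] keys_minus_subset[of \<mu> ?\<nu>] \<mu>
      by (intro exI[of _ "\<mu> - ?\<nu>"]) (auto simp: lookup_single when_def)
    then show "\<mu> \<in> ?T \<longleftrightarrow> \<mu> \<in> T'" unfolding T'[OF \<mu>] by (auto simp: lookup_add)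
  qed
  finally show ?thesis .
qed

section \<open>The grading by total degree\<close>

definition mdeg :: "('a \<Rightarrow>\<^sub>0 nat) \<Rightarrow> nat" where
  "mdeg \<mu> = (\<Sum>v\<in>Poly_Mapping.keys \<mu>. Poly_Mapping.lookup \<mu> v)"

lemma mdeg_eq: "finite V \<Longrightarrow> Poly_Mapping.keys \<mu> \<subseteq> V \<Longrightarrow> mdeg \<mu> = (\<Sum>v\<in>V. Poly_Mapping.lookup \<mu> v)"
  unfolding mdeg_def by (rule sum.mono_neutral_left) (auto simp: in_keys_iff)

lemma mdeg_add: "mdeg (\<mu> + \<nu>) = mdeg \<mu> + mdeg \<nu>"
proof -
  let ?V = "Poly_Mapping.keys \<mu> \<union> Poly_Mapping.keys \<nu>"
  have "mdeg (\<mu> + \<nu>) = (\<Sum>v\<in>?V. Poly_Mapping.lookup (\<mu> + \<nu>) v)"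
    by (rule mdeg_eq) (use Poly_Mapping.keys_add[of \<mu> \<nu>] in auto)
  also have "\<dots> = mdeg \<mu> + mdeg \<nu>"
    using mdeg_eq[of ?V \<mu>] mdeg_eq[of ?V \<nu>] by (simp add: lookup_add sum.distrib)
  finally show ?thesis .
qed

definition hom_part :: "nat \<Rightarrow> 'k::comm_ring_1 mpoly \<Rightarrow> 'k mpoly" where
  "hom_part n f = (\<Sum>\<mu>\<in>{\<mu> \<in> Poly_Mapping.keys f. mdeg \<mu> = n}. Poly_Mapping.single \<mu> (Poly_Mapping.lookup f \<mu>))"

definition homogeneous :: "nat \<Rightarrow> 'k::comm_ring_1 mpoly \<Rightarrow> bool" where
  "homogeneous d f \<longleftrightarrow> (\<forall>\<mu>\<in>Poly_Mapping.keys f. mdeg \<mu> = d)"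

lemma lookup_hom_part: "Poly_Mapping.lookup (hom_part n f) \<mu> = (if mdeg \<mu> = n then Poly_Mapping.lookup f \<mu> else 0)"
  by (auto simp: hom_part_def lookup_sum lookup_single when_def sum.delta in_keys_iff)

lemma hom_part_add: "hom_part n (f + g) = hom_part n f + hom_part n g"
  by (rule poly_mapping_eqI) (simp add: lookup_hom_part lookup_add)

lemma hom_part_zero [simp]: "hom_part n 0 = 0"
  by (rule poly_mapping_eqI) (simp add: lookup_hom_part)

lemma hom_part_sum: "hom_part n (sum f F) = (\<Sum>i\<in>F. hom_part n (f i))"
  by (induction F rule: infinite_finite_induct) (auto simp: hom_part_add)

lemma hom_part_homogeneous: "homogeneous d f \<Longrightarrow> hom_part n f = (if n = d then f else 0)"
  by (rule poly_mapping_eqI) (auto simp: lookup_hom_part homogeneous_def in_keys_iff)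

lemma homogeneous_hom_part: "homogeneous n (hom_part n f)"
  by (auto simp: homogeneous_def in_keys_iff lookup_hom_part split: if_splits)

lemma homogeneous_mult: "homogeneous d f \<Longrightarrow> homogeneous e g \<Longrightarrow> homogeneous (d + e) (f * g)"
  using Poly_Mapping.keys_mult[of f g] by (force simp: homogeneous_def mdeg_add)

lemma homogeneous_sum: "(\<And>i. i \<in> F \<Longrightarrow> homogeneous d (f i)) \<Longrightarrow> homogeneous d (sum f F)"
  by (induction F rule: infinite_finite_induct)
    (auto simp: homogeneous_def dest!: subsetD[OF Poly_Mapping.keys_add])

lemma homogeneous_prod_Var: "finite F \<Longrightarrow> homogeneous (card F) (\<Prod>v\<in>F. Var v :: 'k::comm_ring_1 mpoly)"
proof (induction F rule: finite_induct)
  case (insert v F)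
  have "homogeneous 1 (Var v :: 'k mpoly)" by (auto simp: homogeneous_def Var_def mdeg_def)
  then show ?case using homogeneous_mult[of 1 "Var v :: 'k mpoly" "card F" "prod Var F"] insert by simp
qed (auto simp: homogeneous_def mdeg_def)

lemma sum_hom_parts: "f = (\<Sum>n\<in>mdeg ` Poly_Mapping.keys f. hom_part n f)"
  by (rule poly_mapping_eqI) (auto simp: lookup_sum lookup_hom_part sum.delta in_keys_iff image_iff)

lemma hom_part_mult:
  assumes f: "homogeneous d f"
  shows "hom_part n (f * g) = (if d \<le> n then f * hom_part (n - d) g else 0)"
proof -
  have "hom_part n (f * g) = (\<Sum>e\<in>mdeg ` Poly_Mapping.keys g. hom_part n (f * hom_part e g))"
    by (subst sum_hom_parts[of g]) (simp add: sum_distrib_left hom_part_sum)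
  also have "\<dots> = (\<Sum>e\<in>mdeg ` Poly_Mapping.keys g. if n = d + e then f * hom_part e g else 0)"
    using hom_part_homogeneous[OF homogeneous_mult[OF f homogeneous_hom_part]] by simp
  also have "\<dots> = (if d \<le> n then f * hom_part (n - d) g else 0)"
  proof (cases "d \<le> n \<and> n - d \<in> mdeg ` Poly_Mapping.keys g")
    case True
    then have "(\<Sum>e\<in>mdeg ` Poly_Mapping.keys g. if n = d + e then f * hom_part e g else 0) =
        (\<Sum>e\<in>mdeg ` Poly_Mapping.keys g. if e = n - d then f * hom_part e g else 0)"
      by (intro sum.cong) auto
    then show ?thesis using True by (simp add: sum.delta)
  next
    case False
    have "hom_part (n - d) g = 0" if "n - d \<notin> mdeg ` Poly_Mapping.keys g"
      using that by (intro poly_mapping_eqI) (auto simp: lookup_hom_part image_iff, metis in_keys_iff)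
    moreover have "(\<Sum>e\<in>mdeg ` Poly_Mapping.keys g. if n = d + e then f * hom_part e g else 0) = 0"
      using False by (intro sum.neutral) auto
    ultimately show ?thesis using False by auto
  qed
  finally show ?thesis .
qed

definition graded :: "'k::comm_ring_1 mpoly set \<Rightarrow> bool" where
  "graded J \<longleftrightarrow> (\<forall>f\<in>J. \<forall>n. hom_part n f \<in> J)"

definition nzd :: "'k::comm_ring_1 mpoly set \<Rightarrow> 'k mpoly set \<Rightarrow> 'k mpoly \<Rightarrow> bool" where
  "nzd R J f \<longleftrightarrow> (\<forall>g\<in>R. f * g \<in> J \<longrightarrow> g \<in> J)"

context subring
begin

lemma graded_insert:
  assumes "idl J" "graded J" "graded R" "f \<in> R" "homogeneous d f"
  shows "graded (ideal_gen R (insert f J))"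
  unfolding graded_def
proof (intro ballI allI)
  fix g n assume "g \<in> ideal_gen R (insert f J)"
  then obtain j c where g: "g = j + f * c" "j \<in> J" "c \<in> R"
    using gen_insert[OF assms(1,4)] by (auto simp: mult.commute)
  have "hom_part n g = hom_part n j + (if d \<le> n then hom_part (n - d) c else 0) * f"
    unfolding g hom_part_add hom_part_mult[OF assms(5)] by (simp add: mult.commute)
  then show "hom_part n g \<in> ideal_gen R (insert f J)"
    by (rule gen_insertI[OF assms(1,4), rotated 2]) (use assms g in \<open>auto simp: graded_def\<close>)
qed

text \<open>Induction on the degree: if \<open>f g\<close> is in \<open>J\<close>, then \<open>g\<close> is, modulo \<open>J\<close>, a multiple \<open>z c\<close> with \<open>f c\<close> in \<open>J\<close>.\<close>

lemma nzd_lift: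
  assumes J: "idl J" "graded J" and R: "graded R" and z: "z \<in> R" "homogeneous 1 z" "nzd R J z"
    and f: "f \<in> R" "homogeneous d f" "nzd R (ideal_gen R (insert z J)) f"
  shows "nzd R J f" and "nzd R (ideal_gen R (insert f J)) z"
proof -
  note D = idlD[OF J(1)]
  have hom: "g \<in> J" if "g \<in> R" "homogeneous n g" "f * g \<in> J" for n g
    using that
  proof (induction n arbitrary: g)
    case 0
    have "g \<in> ideal_gen R (insert z J)" using f(3) 0 gen_in[of "f * g" "insert z J"] by (auto simp: nzd_def)
    then obtain j c where g: "g = j + z * c" "j \<in> J" "c \<in> R"
      using gen_insert[OF J(1) z(1)] by (auto simp: mult.commute)
    \<comment> \<open>A multiple of \<open>z\<close> has no part of degree 0, so \<open>g\<close> is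
      the degree 0 part of \<open>j\<close>.\<close>
    have "g = hom_part 0 g" using hom_part_homogeneous[OF 0(2)] by simp
    also have "\<dots> = hom_part 0 j" by (simp add: g hom_part_add hom_part_mult[OF z(2)])
    finally show ?case using J(2) g by (metis graded_def)
  next
    case (Suc n)
    have "g \<in> ideal_gen R (insert z J)" using f(3) Suc.prems gen_in[of "f * g" "insert z J"] by (auto simp: nzd_def)
    then obtain j c where g: "g = j + z * c" "j \<in> J" "c \<in> R"
      using gen_insert[OF J(1) z(1)] by (auto simp: mult.commute)
    have "g = hom_part (Suc n) g" using hom_part_homogeneous[OF Suc.prems(2)] by simp
    also have "\<dots> = hom_part (Suc n) j + z * hom_part n c" by (simp add: g hom_part_add hom_part_mult[OF z(2)])
    finally have eq: "g = hom_part (Suc n) j + z * hom_part n c" .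
    have jJ: "hom_part (Suc n) j \<in> J" and cR: "hom_part n c \<in> R" using J(2) R g by (auto simp: graded_def)
    have "z * (f * hom_part n c) = f * g - f * hom_part (Suc n) j" by (subst eq) (simp add: algebra_simps)
    then have "z * (f * hom_part n c) \<in> J" using Suc.prems(3) D(4)[OF jJ f(1)] D(7) by simp
    then have "f * hom_part n c \<in> J" using z(3) f(1) cR by (simp add: nzd_def)
    then have "hom_part n c \<in> J" using Suc.IH cR homogeneous_hom_part by blast
    then show ?case using eq D(3)[OF jJ] D(4)[of _ z] z(1) by metis
  qed
  show fJ: "nzd R J f"
    unfolding nzd_def
  proof (intro ballI impI)
    fix g assume g: "g \<in> R" "f * g \<in> J"
    have "hom_part n g \<in> J" for n
    proof (rule hom)
      show "hom_part n g \<in> R" using R g by (simp add: graded_def)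
      have "f * hom_part n g = hom_part (d + n) (f * g)" by (simp add: hom_part_mult[OF f(2)])
      then show "f * hom_part n g \<in> J" using J(2) g by (simp add: graded_def)
    qed (rule homogeneous_hom_part)
    then show "g \<in> J" by (subst sum_hom_parts) (rule idl_sum[OF J(1)])
  qed
  \<comment> \<open>Here the order of \<open>z\<close> and \<open>f\<close> is exchanged: regularity
    of \<open>f\<close> modulo \<open>J + (z)\<close> splits the coefficient \<open>c\<close> of
    \<open>f\<close>, and then \<open>z\<close> cancels modulo \<open>J\<close>.\<close>
  show "nzd R (ideal_gen R (insert f J)) z"
    unfolding nzd_def
  proof (intro ballI impI)
    fix g assume g: "g \<in> R" "z * g \<in> ideal_gen R (insert f J)"
    then obtain j c where c: "z * g = j + c * f" "j \<in> J" "c \<in> R"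
      using gen_insert[OF J(1) f(1)] by auto
    have "f * c = - j + g * z" using c by (simp add: algebra_simps)
    then have "f * c \<in> ideal_gen R (insert z J)"
      using c g D(6) by (intro gen_insertI[OF J(1) z(1), of "- j" g]) auto
    then have "c \<in> ideal_gen R (insert z J)" using f(3) c by (simp add: nzd_def)
    then obtain j' c' where c': "c = j' + c' * z" "j' \<in> J" "c' \<in> R"
      using gen_insert[OF J(1) z(1)] by auto
    have "z * (g - c' * f) = j + j' * f" using c(1) c'(1) by (simp add: algebra_simps)
    then have "z * (g - c' * f) \<in> J" using c c' D f(1) by simp
    then have "g - c' * f \<in> J" using z(3) g c' f(1) by (simp add: nzd_def)
    then show "g \<in> ideal_gen R (insert f J)"
      using c' by (intro gen_insertI[OF J(1) f(1), of "g - c' * f" c']) auto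
  qed
qed

end

fun gen_chain :: "'k::comm_ring_1 mpoly set \<Rightarrow> (nat \<Rightarrow> 'k mpoly) \<Rightarrow> 'k mpoly set \<Rightarrow> nat \<Rightarrow> 'k mpoly set" where
  "gen_chain R f J 0 = J"
| "gen_chain R f J (Suc n) = ideal_gen R (insert (f n) (gen_chain R f J n))"

lemma weak_reg_seq_append:
  "weak_reg_seq R J (fs @ gs) \<longleftrightarrow> weak_reg_seq R J fs \<and>
    weak_reg_seq R (foldl (\<lambda>J f. ideal_gen R (insert f J)) J fs) gs"
  by (induction fs arbitrary: J) auto

text \<open>Unrolls the sequence from its end, so that each condition refers to the ideal generated
  by an initial segment.\<close>

lemma weak_reg_seq_upt:
  "weak_reg_seq R J (map f [0..<n]) \<longleftrightarrow> (\<forall>i<n. nzd R (gen_chain R f J i) (f i))"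
proof -
  have *: "foldl (\<lambda>J f. ideal_gen R (insert f J)) J (map f [0..<n]) = gen_chain R f J n" for n
    by (induction n) auto
  show ?thesis by (induction n) (auto simp: weak_reg_seq_append * nzd_def less_Suc_eq)
qed

definition esym :: "(nat + nat) set \<Rightarrow> nat \<Rightarrow> 'k::comm_ring_1 mpoly" where
  "esym V k = (\<Sum>F\<in>{F. F \<subseteq> V \<and> card F = k}. \<Prod>v\<in>F. Var v)"

definition var_ideal :: "(nat + nat) set \<Rightarrow> (nat + nat) set \<Rightarrow> 'k::comm_ring_1 mpoly set" where
  "var_ideal V K = mon_ideal V {\<mu>. \<exists>v\<in>K. 0 < Poly_Mapping.lookup \<mu> v}"

lemma upclosed_var: "upclosed V {\<mu>. \<exists>v\<in>K. 0 < Poly_Mapping.lookup \<mu> v}"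
  by (auto simp: upclosed_def lookup_add)

context
  fixes V :: "(nat + nat) set"
  assumes V: "finite V"
begin

interpretation subring "polys_in V :: 'k::comm_ring_1 mpoly set" by (rule subring_polys_in)

abbreviation (input) chain :: "(nat + nat) set \<Rightarrow> nat \<Rightarrow> 'k::comm_ring_1 mpoly set" where
  "chain K \<equiv> gen_chain (polys_in V) (\<lambda>i. esym V (Suc i)) (var_ideal V K)"

lemma esym_in: "esym V k \<in> (polys_in V :: 'k::comm_ring_1 mpoly set)"
  unfolding esym_def by (intro sum_in prod_in) (auto intro: Var_in)

lemma homogeneous_esym: "homogeneous k (esym V k :: 'k::comm_ring_1 mpoly)"
  unfolding esym_def using homogeneous_prod_Var finite_subset[OF _ V]
  by (intro homogeneous_sum) auto

lemma graded_polys_in: "graded (polys_in V :: 'k::comm_ring_1 mpoly set)"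
  by (auto simp: graded_def polys_in_def in_keys_iff lookup_hom_part split: if_splits)

lemma graded_var_ideal: "graded (var_ideal V K :: 'k::comm_ring_1 mpoly set)"
  by (auto simp: graded_def polys_in_def var_ideal_def mon_ideal_def in_keys_iff lookup_hom_part split: if_splits)

lemma chain_idl: "idl (chain K n :: 'k::comm_ring_1 mpoly set)" and chain_graded: "graded (chain K n :: 'k mpoly set)"
proof (induction n)
  case 0
  {
    case 1
    then show ?case unfolding var_ideal_def by (simp add: idl_mon_ideal[OF upclosed_var])
  next
    case 2
    then show ?case by (simp add: graded_var_ideal)
  }
next
  case (Suc n)
  {
    case 1
    then show ?case using Suc by (simp add: idl_insert esym_in)
  next
    case 2
    then show ?case using Suc graded_insert[OF _ _ graded_polys_in esym_in homogeneous_esym] by simp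
  }
qed

lemma chain_insert:
  assumes "z \<in> V"
  shows "chain (insert z K) n = (ideal_gen (polys_in V) (insert (Var z) (chain K n)) :: 'k::comm_ring_1 mpoly set)"
proof (induction n)
  case 0
  have "ideal_gen (polys_in V) (insert (Var z) (var_ideal V K)) = (var_ideal V (insert z K) :: 'k mpoly set)"
    unfolding var_ideal_def by (rule mon_ideal_insert_Var[OF upclosed_var assms]) auto
  then show ?case by simp
next
  case (Suc n)
  then show ?case using gen_insert_commute[OF chain_idl Var_in[OF assms] esym_in] by simp
qed

lemma var_nzd: "z \<in> V - K \<Longrightarrow> nzd (polys_in V) (var_ideal V K) (Var z :: 'k::comm_ring_1 mpoly)"
  unfolding nzd_def
proof (intro ballI impI)
  fix g :: "'k mpoly" assume z: "z \<in> V - K" and g: "g \<in> polys_in V" "Var z * g \<in> var_ideal V K"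
  have "(\<lambda>\<mu>. \<mu> + Poly_Mapping.single z 1) ` Poly_Mapping.keys g \<subseteq> {\<mu>. \<exists>v\<in>K. 0 < Poly_Mapping.lookup \<mu> v}"
    using g(2) keys_times_single[of g "Poly_Mapping.single z 1"]
    by (auto simp: var_ideal_def mon_ideal_def Var_def mult.commute)
  then have "Poly_Mapping.keys g \<subseteq> {\<mu>. \<exists>v\<in>K. 0 < Poly_Mapping.lookup \<mu> v}"
    using z by (auto simp: image_subset_iff lookup_add lookup_single when_def split: if_splits)
  then show "g \<in> var_ideal V K" using g by (simp add: var_ideal_def mon_ideal_def)
qed

text \<open>Regularity is lifted from the quotient by \<open>z\<close>, and \<open>z\<close> moves
  past each element of the sequence and so stays regular along the chain.\<close>

lemma chain_step:
  assumes z: "z \<in> V - K"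
    and reg: "\<And>i. i < k \<Longrightarrow> nzd (polys_in V) (chain (insert z K) i) (esym V (Suc i) :: 'k::comm_ring_1 mpoly)"
  shows "i \<le> k \<Longrightarrow> nzd (polys_in V) (chain K i) (Var z :: 'k mpoly)"
    and "i < k \<Longrightarrow> nzd (polys_in V) (chain K i) (esym V (Suc i) :: 'k mpoly)"
proof -
  have zV: "z \<in> V" using z by blast
  have hz: "homogeneous 1 (Var z :: 'k mpoly)" using homogeneous_prod_Var[of "{z}"] by simp
  note lift = nzd_lift[OF chain_idl chain_graded graded_polys_in Var_in[OF zV] hz _ esym_in homogeneous_esym]
  show *: "i \<le> k \<Longrightarrow> nzd (polys_in V) (chain K i) (Var z :: 'k mpoly)" for i
  proof (induction i)
    case 0
    then show ?case using var_nzd[OF z] by simp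
  next
    case (Suc i)
    then show ?case using lift(2)[of K i "Suc i"] reg[of i] by (simp add: chain_insert[OF zV])
  qed
  show "i < k \<Longrightarrow> nzd (polys_in V) (chain K i) (esym V (Suc i) :: 'k mpoly)"
    using lift(1)[OF *] reg[of i] by (simp add: chain_insert[OF zV])
qed

text \<open>In this degree \<open>V - K\<close> is the only set of variables avoiding
  \<open>K\<close>.\<close>

lemma esym_top:
  assumes "K \<subseteq> V" "card (V - K) = k"
  shows "esym V k - (\<Prod>v\<in>V - K. Var v) \<in> (var_ideal V K :: 'k::comm_ring_1 mpoly set)"
proof -
  let ?\<F> = "{F. F \<subseteq> V \<and> card F = k}"
  have fin: "finite ?\<F>" by (rule finite_subset[of _ "Pow V"]) (use V in auto)
  have eq: "esym V k - (\<Prod>v\<in>V - K. Var v) = (\<Sum>F\<in>?\<F> - {V - K}. \<Prod>v\<in>F. Var v :: 'k mpoly)"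
    unfolding esym_def using fin assms by (subst sum_diff1) auto
  have I: "idl (var_ideal V K :: 'k mpoly set)" using chain_idl[of K 0] by simp
  have mem: "(\<Prod>v\<in>F. Var v) \<in> (var_ideal V K :: 'k mpoly set)" if F: "F \<in> ?\<F> - {V - K}" for F
  proof -
    have "finite F" using F V by (auto intro: finite_subset)
    have "\<not> F \<subseteq> V - K" using F assms V card_subset_eq[of "V - K" F] by auto
    then obtain v where v: "v \<in> F" "v \<in> K" "v \<in> V" using F by auto
    have "(Var v :: 'k mpoly) \<in> var_ideal V K"
      using v by (auto simp: var_ideal_def mon_ideal_def Var_def polys_in_def intro!: bexI[of _ v])
    moreover have "(\<Prod>v\<in>F - {v}. Var v) \<in> (polys_in V :: 'k mpoly set)" using F by (auto intro!: prod_in Var_in)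
    ultimately show ?thesis using idlD(4)[OF I] prod.remove[OF \<open>finite F\<close> v(1), of Var] by (metis mult.commute)
  qed
  show ?thesis unfolding eq by (rule idl_sum[OF I mem])
qed

lemma chain_subset: "var_ideal V K \<subseteq> (chain K n :: 'k::comm_ring_1 mpoly set)"
  by (induction n) (auto intro: gen_in)

text \<open>Induction on the number of surviving variables. Below the top degree, set one more
  variable to zero. In the top degree the polynomial is, modulo \<open>K\<close>, the product of all
  surviving variables, each of which is regular by \<open>chain_step\<close>.\<close>

theorem esym_regular:
  assumes "K \<subseteq> V" "k \<le> card (V - K)" "i < k"
  shows "nzd (polys_in V) (chain K i) (esym V (Suc i) :: 'k::comm_ring_1 mpoly)"
  using assms
proof (induction "card (V - K)" arbitrary: K k i)
  case 0
  then show ?case by simp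
next
  case (Suc c)
  have sub: "insert z K \<subseteq> V" "c = card (V - insert z K)" if "z \<in> V - K" for z
  proof -
    have "V - insert z K = (V - K) - {z}" by auto
    then show "c = card (V - insert z K)" using Suc(2) that V by simp
  qed (use that Suc in auto)
  obtain z where z: "z \<in> V - K" using Suc(2) by (metis card.empty ex_in_conv nat.distinct(1))
  show ?case
  proof (cases "i < c")
    case True
    show ?thesis
      by (rule chain_step(2)[OF z _ True]) (use Suc.hyps(1)[OF sub(2,1)[OF z]] sub(2)[OF z] in auto)
  next
    case False
    then have ic: "i = c" using Suc.prems Suc.hyps(2) by simp
    have zz: "nzd (polys_in V) (chain K c) (Var v :: 'k mpoly)" if "v \<in> V - K" for v
      by (rule chain_step(1)[OF that _ order_refl]) (use Suc.hyps(1)[OF sub(2,1)[OF that]] sub(2)[OF that] in auto)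
    show ?thesis
      unfolding nzd_def ic
    proof (intro ballI impI)
      fix g :: "'k mpoly" assume g: "g \<in> polys_in V" "esym V (Suc c) * g \<in> chain K c"
      note D = idlD[OF chain_idl[of K c, where 'k = 'k]]
      have "esym V (Suc c) - (\<Prod>v\<in>V - K. Var v) \<in> (chain K c :: 'k mpoly set)"
        using esym_top[OF Suc.prems(1) Suc.hyps(2)[symmetric]] chain_subset by blast
      then have "esym V (Suc c) * g - (esym V (Suc c) - (\<Prod>v\<in>V - K. Var v)) * g \<in> chain K c"
        using g D(5,7) by blast
      then have "(\<Prod>v\<in>V - K. Var v) * g \<in> chain K c" by (simp add: algebra_simps)
      moreover have "finite F \<Longrightarrow> F \<subseteq> V - K \<Longrightarrow> (\<Prod>v\<in>F. Var v) * g \<in> chain K c \<Longrightarrow> g \<in> chain K c" for F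
      proof (induction F rule: finite_induct)
        case (insert v F)
        have "(\<Prod>v\<in>F. Var v) * g \<in> polys_in V" using insert.prems g by (auto intro!: mult_in prod_in Var_in)
        moreover have "Var v * ((\<Prod>v\<in>F. Var v) * g) \<in> chain K c" using insert by (simp add: mult.assoc)
        ultimately have "(\<Prod>v\<in>F. Var v) * g \<in> chain K c" using zz[of v] insert.prems unfolding nzd_def by blast
        then show ?case using insert by blast
      qed simp
      ultimately show "g \<in> chain K c" using V by blast
    qed
  qed
qed

corollary weak_reg_esym:
  assumes "K \<subseteq> V" "k \<le> card (V - K)"
  shows "weak_reg_seq (polys_in V) (var_ideal V K :: 'k::comm_ring_1 mpoly set) (map (\<lambda>i. esym V (Suc i)) [0..<k])"
  unfolding weak_reg_seq_upt using esym_regular[OF assms] by blast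

end

section \<open>Weighted Ferrers diagrams\<close>

text \<open>The row lengths of a partition enter only as closure of the shape under moving up and
  left.\<close>

locale ferrers =
  fixes P Q :: "nat set" and E :: "nat \<Rightarrow> nat \<Rightarrow> bool" and w :: "nat \<Rightarrow> nat \<Rightarrow> nat"
  assumes finite_rows: "finite P" and finite_cols: "finite Q"
    and box_in: "E i j \<Longrightarrow> i \<in> P \<and> j \<in> Q"
    and box_up: "E i j \<Longrightarrow> i' \<in> P \<Longrightarrow> i' \<le> i \<Longrightarrow> E i' j"
    and box_left: "E i j \<Longrightarrow> j' \<in> Q \<Longrightarrow> j' \<le> j \<Longrightarrow> E i j'"
begin

text \<open>The monomial with row exponents \<open>a\<close> and column exponents \<open>b\<close>
  lies outside the ideal of the diagram.\<close>

definition standard :: "(nat \<Rightarrow> nat) \<Rightarrow> (nat \<Rightarrow> nat) \<Rightarrow> bool" where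
  "standard a b \<longleftrightarrow> (\<forall>i j. E i j \<longrightarrow> a i < w i j \<or> b j < w i j)"

text \<open>Whether a row is live depends on the column exponents alone, and conversely. So lowering
  exponents on one side can only revive variables of the other.\<close>

definition live_rows :: "nat set \<Rightarrow> (nat \<Rightarrow> nat) \<Rightarrow> nat set" where
  "live_rows K b = {i \<in> P - K. \<forall>j. E i j \<longrightarrow> b j < w i j}"

definition live_cols :: "nat set \<Rightarrow> (nat \<Rightarrow> nat) \<Rightarrow> nat set" where
  "live_cols K a = {j \<in> Q - K. \<forall>i. E i j \<longrightarrow> a i < w i j}"

text \<open>The value of the live graph is at most \<open>r\<close>. An edge has a value below
  \<open>card A + card B\<close>, so the two alternatives can stand side by side.\<close>

definition attains :: "nat set \<Rightarrow> nat set \<Rightarrow> nat \<Rightarrow> bool" where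
  "attains A B r \<longleftrightarrow> card A + card B \<le> r \<or>
     (\<exists>i\<in>A. \<exists>j\<in>B. E i j \<and> Suc (card {k\<in>A. i < k} + card {l\<in>B. j < l}) \<le> r)"

text \<open>Here \<open>p\<close>, \<open>q\<close> are lower bounds for the exponents, and \<open>K\<close>, \<open>L\<close> are the rows and columns killed
  by adding their variables to the ideal; their exponents still count for killing others.\<close>

definition depth_le :: "(nat \<Rightarrow> nat) \<Rightarrow> (nat \<Rightarrow> nat) \<Rightarrow> nat set \<Rightarrow> nat set \<Rightarrow> nat \<Rightarrow> bool" where
  "depth_le p q K L r \<longleftrightarrow> (\<exists>a b. (\<forall>i. p i \<le> a i) \<and> (\<forall>j. q j \<le> b j) \<and>
     (\<forall>i\<in>K. a i = p i) \<and> (\<forall>j\<in>L. b j = q j) \<and> standard a b \<and>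
     attains (live_rows K b) (live_cols L a) r)"

lemma standardD_row: "standard a b \<Longrightarrow> E i j \<Longrightarrow> w i j \<le> b j \<Longrightarrow> a i < w i j"
  and standardD_col: "standard a b \<Longrightarrow> E i j \<Longrightarrow> w i j \<le> a i \<Longrightarrow> b j < w i j"
  by (auto simp: standard_def not_le[symmetric])

lemma live_cols_antimono: "(\<And>i. a' i \<le> a i) \<Longrightarrow> live_cols L a \<subseteq> live_cols L a'"
  unfolding live_cols_def by (auto intro: le_less_trans)

lemma finite_live_rows [simp]: "finite (live_rows K b)"
  using finite_rows by (simp add: live_rows_def)

lemma finite_live_cols [simp]: "finite (live_cols L a)"
  using finite_cols by (simp add: live_cols_def)

lemma depth_leI:
  assumes "\<And>i. p i \<le> a i" "\<And>j. q j \<le> b j" "\<And>i. i \<in> K \<Longrightarrow> a i = p i" "\<And>j. j \<in> L \<Longrightarrow> b j = q j"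
    "standard a b" "attains (live_rows K b) (live_cols L a) r"
  shows "depth_le p q K L r"
  using assms unfolding depth_le_def by blast

text \<open>Use the edge from \<open>i\<close> to its rightmost neighbour in \<open>B\<close>: all
  columns of \<open>B\<close> further right are non-neighbours. Counting non-neighbours is more
  stable under changes of exponents than counting columns to the right.\<close>

lemma attains_row:
  assumes "finite B" "i \<in> A" "j \<in> B" "E i j" "Suc (card {k\<in>A. i < k} + card {l\<in>B. \<not> E i l}) \<le> r"
  shows "attains A B r"
proof -
  define m where "m = Max {l\<in>B. E i l}"
  have ne: "{l\<in>B. E i l} \<noteq> {}" "finite {l\<in>B. E i l}" using assms by auto
  have m: "m \<in> B" "E i m" using Max_in[OF ne(2,1)] by (auto simp: m_def)
  have "{l\<in>B. m < l} \<subseteq> {l\<in>B. \<not> E i l}"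
    using Max_ge[OF ne(2)] by (auto simp: m_def leD)
  then have "card {l\<in>B. m < l} \<le> card {l\<in>B. \<not> E i l}" using assms(1) by (simp add: card_mono)
  then show ?thesis using m assms unfolding attains_def by (meson add_left_mono Suc_le_mono le_trans)
qed

context
  fixes p q :: "nat \<Rightarrow> nat" and K L :: "nat set" and \<gamma> \<delta> :: nat
  assumes live_p: "\<And>i j. E i j \<Longrightarrow> j \<notin> L \<Longrightarrow> p i < w i j"
    and live_q: "\<And>i j. E i j \<Longrightarrow> i \<notin> K \<Longrightarrow> q j < w i j"
    and box: "E \<gamma> \<delta>" and gK: "\<gamma> \<notin> K" and dL: "\<delta> \<notin> L"
    and above: "\<And>i. i \<in> P \<Longrightarrow> i \<notin> K \<Longrightarrow> i < \<gamma> \<Longrightarrow> w \<gamma> \<delta> < w i \<delta>"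
begin

lemma above_lt: "E i \<delta> \<Longrightarrow> i < \<gamma> \<Longrightarrow> i \<notin> K \<Longrightarrow> w \<gamma> \<delta> < w i \<delta>"
  using above box_in by blast

lemma gP: "\<gamma> \<in> P" and dQ: "\<delta> \<in> Q"
  using box box_in by auto

text \<open>The modification of exponents used throughout the proof that killing row \<open>\<gamma>\<close> creates no smaller
  value: reset the rows from \<open>\<gamma>\<close> on, and kill row \<open>\<gamma>\<close> through column \<open>\<delta>\<close>. The rows above survive
  since their weights in column \<open>\<delta>\<close> are larger.\<close>

lemma standard_reset:
  assumes "standard a b" "\<And>i. i \<in> K \<Longrightarrow> a i = p i"
    and a': "\<And>i. a' i = (if i < \<gamma> then a i else p i)"
    and b': "\<And>j. j \<noteq> \<delta> \<Longrightarrow> b' j \<le> b j" "b' \<delta> = w \<gamma> \<delta>"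
    and pa: "\<And>i. p i \<le> a i"
  shows "standard a' b'"
  unfolding standard_def
proof (intro allI impI)
  fix k l assume kl: "E k l"
  show "a' k < w k l \<or> b' l < w k l"
  proof (cases "l = \<delta>")
    case True
    \<comment> \<open>Above \<open>\<gamma>\<close> an unkilled row has a weight in this column
      exceeding the new exponent; killed rows and rows from \<open>\<gamma>\<close> on carry the
      exponent \<open>p\<close>, too small for a column outside \<open>L\<close>.\<close>
    have pk: "p k < w k \<delta>" using live_p kl dL True by blast
    show ?thesis
      using True pk b'(2) above_lt kl assms(2)[of k] by (cases "k < \<gamma>"; cases "k \<in> K") (auto simp: a')
  next
    case False
    have "a k < w k l \<or> b l < w k l" using assms(1) kl by (auto simp: standard_def)
    moreover have "a' k \<le> a k" using pa by (simp add: a')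
    ultimately show ?thesis using b'(1)[OF False] by linarith
  qed
qed

text \<open>A column missing row \<open>i\<close> has boxes only above row \<open>i\<close>, hence
  above \<open>\<gamma>\<close>, where the exponents agree.\<close>

lemma live_cols_reset:
  assumes a': "\<And>i. i < \<gamma> \<Longrightarrow> a' i = a i" and "i < \<gamma>" "i \<in> P"
  shows "{l \<in> live_cols L a'. \<not> E i l} = {l \<in> live_cols L a. \<not> E i l}"
proof -
  have "\<And>k l. E k l \<Longrightarrow> \<not> E i l \<Longrightarrow> k < \<gamma>"
    using assms(2,3) box_up by (meson le_trans less_imp_le_nat not_le)
  then show ?thesis using a' unfolding live_cols_def by (smt (verit, best) Collect_cong mem_Collect_eq)
qed

text \<open>Trouble arises only if \<open>\<gamma>\<close> is live for the given exponents, since it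
  then joins the counted rows. Either an edge keeps the value of the enlarged graph at
  \<open>r\<close>, or new exponents make \<open>\<gamma>\<close> dead. The hard case is a value
  \<open>card A + card B\<close> with \<open>\<gamma>\<close> above all of \<open>A\<close> and
  adjacent to nothing in \<open>B\<close>.\<close>

theorem depth_le_kill_row:
  assumes "depth_le p q (insert \<gamma> K) L r"
  shows "depth_le p q K L r"
proof -
  obtain a b where pa: "\<And>i. p i \<le> a i" and qb: "\<And>j. q j \<le> b j"
    and aK: "\<And>i. i \<in> insert \<gamma> K \<Longrightarrow> a i = p i" and bL: "\<And>j. j \<in> L \<Longrightarrow> b j = q j"
    and st: "standard a b" and att: "attains (live_rows (insert \<gamma> K) b) (live_cols L a) r"
    using assms unfolding depth_le_def by blast
  define A where "A = live_rows (insert \<gamma> K) b"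
  define B where "B = live_cols L a"
  have [simp]: "finite A" "finite B" by (auto simp: A_def B_def)
  have gA: "\<gamma> \<notin> A" by (simp add: A_def live_rows_def)
  have AK: "live_rows K b = A \<or> live_rows K b = insert \<gamma> A"
    unfolding A_def live_rows_def by auto
  show ?thesis
  proof (cases "live_rows K b = A")
    case True
    then show ?thesis using att pa qb aK bL st by (intro depth_leI[of p a q b]) (auto simp: A_def)
  next
    case False
    then have rowsK: "live_rows K b = insert \<gamma> A" using AK by blast
    have g_live: "\<And>j. E \<gamma> j \<Longrightarrow> b j < w \<gamma> j"
      using rowsK unfolding live_rows_def by blast
    have bd: "b \<delta> < w \<gamma> \<delta>" using g_live box by blast
    define a1 where "a1 = (\<lambda>i. if i < \<gamma> then a i else p i)"
    define b1 where "b1 = b(\<delta> := w \<gamma> \<delta>)"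
    have a1: "a1 i \<le> a i" "p i \<le> a1 i" for i using pa by (auto simp: a1_def)
    have b1: "b j \<le> b1 j" "q j \<le> b1 j" for j using qb bd by (auto simp: b1_def order.trans[OF qb])
    have st1: "standard a1 b1"
      by (rule standard_reset[OF st]) (use aK pa in \<open>auto simp: a1_def b1_def\<close>)
    define A1 where "A1 = live_rows K b1"
    define B1 where "B1 = live_cols L a1"
    have [simp]: "finite A1" "finite B1" by (auto simp: A1_def B1_def)
    have A1A: "A1 \<subseteq> A"
    proof
      fix k assume k: "k \<in> A1"
      then have "k \<noteq> \<gamma>" using box by (auto simp: A1_def live_rows_def b1_def)
      then show "k \<in> A" using k b1(1) unfolding A1_def A_def live_rows_def
        by simp (meson le_less_trans)
    qed
    have A1_above: "i \<in> A1" if "i \<in> A" "i < \<gamma>" for i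
      using that above_lt[of i] unfolding A1_def A_def live_rows_def b1_def by auto
    have BB1: "B \<subseteq> B1" unfolding B_def B1_def by (rule live_cols_antimono) (rule a1)
    have B1_right: "{l \<in> B1. \<not> E i l} = {l \<in> B. \<not> E i l}" if "i < \<gamma>" "i \<in> P" for i
      unfolding B1_def B_def by (rule live_cols_reset) (use that in \<open>auto simp: a1_def\<close>)
    have inP: "i \<in> P" if "i \<in> A" for i using that by (auto simp: A_def live_rows_def)
    have reset: "depth_le p q K L r" if "attains A1 B1 r"
      by (rule depth_leI[of p a1 q b1])
        (use that a1 b1 st1 aK bL dL in \<open>auto simp: A1_def B1_def a1_def b1_def\<close>)
    have keep: "depth_le p q K L r" if "attains (insert \<gamma> A) B r"
      by (rule depth_leI[of p a q b]) (use that rowsK pa qb st aK bL in \<open>auto simp: B_def\<close>)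
    consider (edge) i j where "i \<in> A" "j \<in> B" "E i j" "Suc (card {k\<in>A. i < k} + card {l\<in>B. j < l}) \<le> r"
      | (size) "card A + card B \<le> r"
      using att unfolding attains_def A_def B_def by blast
    then show ?thesis
    proof cases
      case edge
      show ?thesis
      proof (cases "\<gamma> < i")
        case True
        then have "{k \<in> insert \<gamma> A. i < k} = {k \<in> A. i < k}" by auto
        then have "attains (insert \<gamma> A) B r" unfolding attains_def using edge by (metis insertI2)
        then show ?thesis by (rule keep)
      next
        case False
        \<comment> \<open>Row \<open>i\<close> survives the reset and keeps its non-neighbours among
          the live columns, while no new live row appears.\<close>
        then have ig: "i < \<gamma>" using edge(1) gA by (metis linorder_neqE_nat)
        have "{k\<in>A1. i < k} \<subseteq> {k\<in>A. i < k}" using A1A by auto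
        then have 1: "card {k\<in>A1. i < k} \<le> card {k\<in>A. i < k}" by (simp add: card_mono)
        have "{l\<in>B. \<not> E i l} \<subseteq> {l\<in>B. j < l}"
          using edge(3) box_left unfolding B_def live_cols_def by (auto simp: not_less) (meson not_less)
        then have 2: "card {l\<in>B. \<not> E i l} \<le> card {l\<in>B. j < l}" by (simp add: card_mono)
        have "attains A1 B1 r"
          by (rule attains_row[of _ i _ j])
            (use edge ig A1_above BB1 B1_right[OF ig inP] 1 2 in auto)
        then show ?thesis by (rule reset)
      qed
    next
      case size
      consider (g) j where "j \<in> B" "E \<gamma> j" | (up) i where "\<forall>j\<in>B. \<not> E \<gamma> j" "i \<in> A" "i < \<gamma>"
        | (low) "\<forall>j\<in>B. \<not> E \<gamma> j" "\<forall>i\<in>A. \<gamma> < i" using gA by (metis linorder_neqE_nat)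
      then show ?thesis
      proof cases
        case g
        \<comment> \<open>The edge at \<open>\<gamma>\<close> leaves the column \<open>j\<close>
          uncounted, which makes up for its extra 1; \<open>\<gamma>\<close> itself is not
          counted.\<close>
        have "card {k \<in> insert \<gamma> A. \<gamma> < k} \<le> card A" by (rule card_mono) auto
        moreover have "card {l\<in>B. j < l} < card B" by (rule psubset_card_mono) (use g in auto)
        ultimately have "attains (insert \<gamma> A) B r" unfolding attains_def using g size
          by (intro disjI2 bexI[of _ \<gamma>] bexI[of _ j]) auto
        then show ?thesis by (rule keep)
      next
        case up
        show ?thesis
        proof (cases "\<exists>j\<in>B1. E i j")
          case True
          then obtain j where j: "j \<in> B1" "E i j" by blast
          have "card {k\<in>A1. i < k} < card A" by (rule psubset_card_mono) (use up A1A in auto)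
          moreover have "card {l\<in>B. \<not> E i l} \<le> card B" by (rule card_mono) auto
          ultimately have "attains A1 B1 r"
            by (intro attains_row[of _ i _ j]) (use up A1_above j B1_right[of i] inP size in auto)
          then show ?thesis by (rule reset)
        next
          case False
          then have "B1 \<subseteq> B" using B1_right[OF up(3) inP[OF up(2)]] by blast
          then have "card A1 + card B1 \<le> card A + card B" using A1A by (intro add_mono card_mono) auto
          then have "attains A1 B1 r" using size by (simp add: attains_def)
          then show ?thesis by (rule reset)
        qed
      next
        case low
        \<comment> \<open>Lower the exponents of the live rows as far as allowed. Either this
          revives a column adjacent to them, which yields an edge, or the columns outside
          \<open>B\<close> and \<open>L\<close> are killed by dead rows alone.\<close>
        define a2 where "a2 = (\<lambda>i. if i \<in> A then p i else a i)"
        define B2 where "B2 = live_cols L a2"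
        have [simp]: "finite B2" by (simp add: B2_def)
        have a2: "a2 i \<le> a i" "p i \<le> a2 i" for i using pa by (auto simp: a2_def)
        have st2: "standard a2 b" using st a2(1) unfolding standard_def by (meson le_less_trans)
        have keep2: "depth_le p q K L r" if "attains (insert \<gamma> A) B2 r"
          by (rule depth_leI[of p a2 q b])
            (use that rowsK a2 qb st2 aK bL in \<open>auto simp: B2_def a2_def\<close>)
        have BB2: "B \<subseteq> B2" unfolding B_def B2_def by (rule live_cols_antimono) (rule a2)
        have a2g: "a2 i = a i" if "i \<le> \<gamma>" for i using that low(2) by (auto simp: a2_def)
        show ?thesis
        proof (cases "\<exists>t\<in>A. \<exists>j\<in>B2. E t j")
          case True
          \<comment> \<open>If some row of \<open>A\<close> meets a column of \<open>B2\<close>, so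
            does the topmost one. A live column missing it has boxes only above \<open>t\<close>,
            where no exponent was lowered, and so was live before.\<close>
          define t where "t = Min A"
          have tA: "t \<in> A" using True by (auto simp: t_def intro!: Min_in)
          have tmin: "k < t \<Longrightarrow> k \<notin> A" for k by (simp add: t_def) (meson Min_le \<open>finite A\<close> not_le)
          obtain j where j: "j \<in> B2" "E t j"
            using True tmin inP tA box_up by (metis linorder_not_le)
          have "{l \<in> B2. \<not> E t l} \<subseteq> B"
          proof
            fix l assume l: "l \<in> {l \<in> B2. \<not> E t l}"
            have "a2 k = a k" if "E k l" for k
            proof -
              have "\<not> t \<le> k" using l box_up[OF that inP[OF tA]] by auto
              then show ?thesis using tmin[of k] by (simp add: a2_def)
            qed
            then show "l \<in> B" using l by (auto simp: B_def B2_def live_cols_def)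
          qed
          then have "card {l \<in> B2. \<not> E t l} \<le> card B" by (simp add: card_mono)
          moreover have "card {k \<in> insert \<gamma> A. t < k} < card A"
            by (rule psubset_card_mono) (use tA low(2) in auto)
          ultimately have "attains (insert \<gamma> A) B2 r"
            by (intro attains_row[of _ t _ j]) (use tA j size in auto)
          then show ?thesis by (rule keep2)
        next
          case False
          have B2B: "B2 = B"
          proof (rule antisym[OF _ BB2], rule subsetI)
            fix l assume l: "l \<in> B2"
            have "a2 k = a k" if "E k l" for k
              using that l False by (auto simp: a2_def)
            then show "l \<in> B" using l by (auto simp: B_def B2_def live_cols_def)
          qed
          \<comment> \<open>Since \<open>p\<close> alone kills no column outside \<open>L\<close>,
            only rows of \<open>D\<close> can kill the columns outside \<open>B\<close> and
            \<open>L\<close>.\<close>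
          define D where "D = {k\<in>P. a2 k \<noteq> p k}"
          have Dfin: "finite D" using finite_rows by (simp add: D_def)
          have Ddead: "k \<notin> insert \<gamma> A" "k \<notin> K" if "k \<in> D" for k
          proof -
            have ne: "a2 k \<noteq> p k" using that unfolding D_def by blast
            then have "k \<notin> A" unfolding a2_def by presburger
            moreover from this ne have "a k \<noteq> p k" unfolding a2_def by presburger
            then have "k \<notin> insert \<gamma> K" using aK by blast
            ultimately show "k \<notin> insert \<gamma> A" "k \<notin> K" by blast+
          qed
          have killed: "\<exists>k\<in>D. E k j \<and> w k j \<le> a2 k" if jj: "j \<in> Q" "j \<notin> L" "j \<notin> B" for j
          proof -
            obtain k where k: "E k j" "w k j \<le> a2 k"
              using jj(1,2) jj(3)[folded B2B] unfolding B2_def live_cols_def by (auto simp: not_less)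
            then have "k \<in> D" using live_p[OF k(1) jj(2)] box_in by (auto simp: D_def)
            then show ?thesis using k by blast
          qed
          have "D \<noteq> {}" using killed[OF dQ dL] low(1) box by blast
          \<comment> \<open>Maximality of \<open>a2 s\<close> ensures that only columns of
            \<open>B\<close> kill row \<open>s\<close>: another such column \<open>j\<close> would
            be killed by some \<open>k\<close> in \<open>D\<close>, and standardness would give
            \<open>a2 s < w s j \<le> b j < w k j \<le> a2 k\<close>.\<close>
          then obtain s where s: "s \<in> D" "\<And>k. k \<in> D \<Longrightarrow> a2 k \<le> a2 s"
            using obtains_MAX[OF Dfin, of a2] Max_ge[of "a2 ` D"] Dfin
            by (metis finite_imageI imageI)
          have sP: "s \<in> P" using s by (auto simp: D_def)
          have sB: "j \<in> B" if j: "E s j" "w s j \<le> b j" for j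
          proof (rule ccontr)
            assume jB: "j \<notin> B"
            have jL: "j \<notin> L" using live_q[OF j(1) Ddead(2)[OF s(1)]] j(2) bL[of j] by auto
            obtain k where k: "k \<in> D" "E k j" "w k j \<le> a2 k"
              using killed jB jL box_in j(1) by blast
            have "a2 s < w s j" using standardD_row[OF st2 j] .
            moreover have "b j < w k j" using standardD_col[OF st2 k(2,3)] .
            ultimately show False using s(2)[OF k(1)] k(3) j(2) by linarith
          qed
          have "s \<notin> live_rows K b" using Ddead[OF s(1)] rowsK by simp
          then obtain j where j: "E s j" "w s j \<le> b j"
            using Ddead(2)[OF s(1)] sP by (auto simp: live_rows_def not_less)
          have sg: "s < \<gamma>"
          proof (rule ccontr)
            assume "\<not> s < \<gamma>"
            then have "E \<gamma> j" using box_up[OF j(1) gP] by simp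
            then show False using sB[OF j] low(1) by blast
          qed
          \<comment> \<open>Lowering the columns of \<open>B\<close> revives row \<open>s\<close>;
            raising column \<open>\<delta>\<close> kills row \<open>\<gamma>\<close>.\<close>
          define b3 where "b3 = (\<lambda>l. if l = \<delta> then w \<gamma> \<delta> else if l \<in> B then q l else b l)"
          have dB: "\<delta> \<notin> B" using low(1) box by blast
          have b3: "q l \<le> b3 l" for l using qb b1(2)[of \<delta>] by (auto simp: b3_def b1_def)
          have b3b: "b l \<le> b3 l" if "l \<notin> B" for l using that bd by (auto simp: b3_def)
          define a3 where "a3 = (\<lambda>i. if i < \<gamma> then a2 i else p i)"
          have st3: "standard a3 b3"
            by (rule standard_reset[OF st2])
              (use aK a2 qb in \<open>auto simp: a2_def a3_def b3_def\<close>)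
          define A3 where "A3 = live_rows K b3"
          define B3 where "B3 = live_cols L a3"
          have [simp]: "finite A3" "finite B3" by (auto simp: A3_def B3_def)
          have done3: "depth_le p q K L r" if "attains A3 B3 r"
            by (rule depth_leI[of p a3 q b3])
              (use that b3 a2 st3 aK bL dL in \<open>auto simp: A3_def B3_def a3_def a2_def b3_def\<close>)
          have sA3: "s \<in> A3"
            using sP Ddead[OF s(1)] sB above_lt[of s] sg live_q
            by (auto simp: A3_def live_rows_def b3_def not_less[symmetric])
          \<comment> \<open>This lowest live row above \<open>\<gamma>\<close> was dead before, so a
            column of \<open>B\<close> used to kill it. That column is adjacent to \<open>t\<close>,
            and the edge saves the 1 needed in the count.\<close>
          define t where "t = Max {k\<in>A3. k < \<gamma>}"
          have fin: "finite {k\<in>A3. k < \<gamma>}" and ne: "{k\<in>A3. k < \<gamma>} \<noteq> {}" using sA3 sg by auto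
          have t: "t \<in> A3" "t < \<gamma>" using Max_in[OF fin ne] by (auto simp: t_def)
          have tmax: "k \<le> t" if "k \<in> A3" "k < \<gamma>" for k using that Max_ge[OF fin] by (auto simp: t_def)
          have tP: "t \<in> P" using t by (auto simp: A3_def live_rows_def)
          have "t \<notin> live_rows K b" using rowsK t(2) low(2) by auto
          then obtain l where l: "E t l" "w t l \<le> b l" "b3 l < w t l"
            using t(1) by (auto simp: A3_def live_rows_def not_less)
          then have lB: "l \<in> B" using b3b[of l] by linarith
          have BB3: "B \<subseteq> B3"
            unfolding B3_def B2B[symmetric] B2_def
            by (rule live_cols_antimono) (use a2(2) in \<open>auto simp: a3_def\<close>)
          \<comment> \<open>No row of \<open>A3\<close> lies strictly between \<open>t\<close> and
            \<open>\<gamma>\<close>, and \<open>\<gamma>\<close> is dead. Rows further down meet no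
            column of \<open>B\<close>, so no exponent relevant to them was lowered.\<close>
          have "{k\<in>A3. t < k} \<subseteq> A"
          proof
            fix k assume k: "k \<in> {k\<in>A3. t < k}"
            have "k \<noteq> \<gamma>" using k box by (auto simp: A3_def live_rows_def b3_def)
            then have kg: "\<gamma> < k" using k tmax[of k] by (metis (lifting) leD linorder_neqE_nat mem_Collect_eq)
            have "b i < w k i" if "E k i" for i
            proof -
              have "i \<notin> B" using that low(1) box_up[OF that gP] kg by auto
              then show ?thesis using b3b[of i] k that by (auto simp: A3_def live_rows_def intro: le_less_trans)
            qed
            then show "k \<in> A" using k \<open>k \<noteq> \<gamma>\<close> by (auto simp: A_def A3_def live_rows_def)
          qed
          then have "card {k\<in>A3. t < k} \<le> card A" by (simp add: card_mono)
          moreover have "{i\<in>B3. \<not> E t i} = {i\<in>B2. \<not> E t i}"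
            unfolding B3_def B2_def by (rule live_cols_reset) (use t tP in \<open>auto simp: a3_def\<close>)
          moreover have "card {i\<in>B2. \<not> E t i} < card B"
            unfolding B2B by (rule psubset_card_mono) (use lB l in auto)
          ultimately have "attains A3 B3 r"
            by (intro attains_row[of _ t _ l]) (use t lB BB3 l size in auto)
          then show ?thesis by (rule done3)
        qed
      qed
    qed
  qed
qed

end

lemma live_cols_lower:
  assumes "\<And>j. E \<gamma> j \<Longrightarrow> a \<gamma> < w \<gamma> j" "c \<le> a \<gamma>"
  shows "live_cols L (a(\<gamma> := c)) = live_cols L a"
  using assms by (auto simp: live_cols_def intro: le_less_trans)

text \<open>An exponent below all weights of its row kills no column, so resetting it to 0, as the
  killed row requires, changes no live column.\<close>

lemma depth_le_restrict:
  assumes st: "standard a b" and lt: "\<And>j. E \<gamma> j \<Longrightarrow> a \<gamma> < w \<gamma> j"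
    and att: "attains (live_rows {} b - {\<gamma>}) (live_cols {} a) r"
  shows "depth_le (\<lambda>_. 0) (\<lambda>_. 0) {\<gamma>} {} r"
proof (rule depth_leI[of _ "a(\<gamma> := 0)" _ b])
  show "standard (a(\<gamma> := 0)) b"
    using st lt by (auto simp: standard_def) (metis gr_zeroI not_less_zero)
  have "live_rows {\<gamma>} b = live_rows {} b - {\<gamma>}" by (auto simp: live_rows_def)
  then show "attains (live_rows {\<gamma>} b) (live_cols {} (a(\<gamma> := 0))) r"
    using att live_cols_lower[of \<gamma> a 0, OF lt] by simp
qed auto

section \<open>Transposition of the diagram\<close>

lemma swap_ferrers: "ferrers Q P (\<lambda>j i. E i j)"
  using finite_rows finite_cols box_in box_up box_left by unfold_locales blast+

interpretation swap: ferrers Q P "\<lambda>j i. E i j" "\<lambda>j i. w i j"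
  by (rule swap_ferrers)

lemma swap_live_rows: "swap.live_rows = live_cols"
  by (intro ext) (simp add: swap.live_rows_def live_cols_def)

lemma swap_live_cols: "swap.live_cols = live_rows"
  by (intro ext) (simp add: swap.live_cols_def live_rows_def)

lemma swap_attains: "swap.attains B A r \<longleftrightarrow> attains A B r"
  unfolding swap.attains_def attains_def by (subst (1 2) add.commute) blast

lemma swap_standard: "swap.standard b a \<longleftrightarrow> standard a b"
  unfolding swap.standard_def standard_def by blast

lemma swap_depth_le: "swap.depth_le q p L K r \<longleftrightarrow> depth_le p q K L r"
  unfolding swap.depth_le_def depth_le_def swap_live_rows swap_live_cols swap_attains swap_standard
  by blast

theorem depth_le_kill_col:
  assumes "\<And>i j. E i j \<Longrightarrow> j \<notin> L \<Longrightarrow> p i < w i j" "\<And>i j. E i j \<Longrightarrow> i \<notin> K \<Longrightarrow> q j < w i j"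
    and "E \<gamma> \<delta>" "\<gamma> \<notin> K" "\<delta> \<notin> L"
    and "\<And>j. j \<in> Q \<Longrightarrow> j \<notin> L \<Longrightarrow> j < \<delta> \<Longrightarrow> w \<gamma> \<delta> < w \<gamma> j"
    and "depth_le p q K (insert \<delta> L) r"
  shows "depth_le p q K L r"
  using swap.depth_le_kill_row[of K q L p \<gamma> \<delta> r] assms by (simp add: swap_depth_le)

text \<open>Standardness at a box of least weight puts \<open>a \<gamma>\<close> or
  \<open>b \<delta>\<close> below every weight, so \<open>depth_le_restrict\<close> applies to that
  row or column. It remains to see that the value does not grow when the row or column is
  dropped.\<close>

theorem depth_le_branch:
  assumes box: "E \<gamma> \<delta>" and min: "\<And>i j. E i j \<Longrightarrow> w \<gamma> \<delta> \<le> w i j"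
    and le: "depth_le (\<lambda>_. 0) (\<lambda>_. 0) {} {} r"
  shows "depth_le (\<lambda>_. 0) (\<lambda>_. 0) {\<gamma>} {} r \<or> depth_le (\<lambda>_. 0) (\<lambda>_. 0) {} {\<delta>} r"
proof -
  obtain a b where st: "standard a b" and att: "attains (live_rows {} b) (live_cols {} a) r"
    using le unfolding depth_le_def by blast
  define A where "A = live_rows {} b"
  define B where "B = live_cols {} a"
  have [simp]: "finite A" "finite B" by (auto simp: A_def B_def)
  have row: ?thesis if "a \<gamma> < w \<gamma> \<delta>" "attains (A - {\<gamma>}) B r"
    using depth_le_restrict[OF st, of \<gamma> r] that min by (auto simp: A_def B_def intro: less_le_trans)
  have col: ?thesis if "b \<delta> < w \<gamma> \<delta>" "attains A (B - {\<delta>}) r"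
    using swap.depth_le_restrict[of b a \<delta> r] that min st
    by (auto simp: A_def B_def swap_attains swap_live_rows swap_live_cols swap_standard swap_depth_le
        intro: less_le_trans)
  have sub: "card (A - {\<gamma>}) \<le> card A" "card (B - {\<delta>}) \<le> card B"
    "card {k\<in>A - {\<gamma>}. i < k} \<le> card {k\<in>A. i < k}" "card {k\<in>B - {\<delta>}. j < k} \<le> card {k\<in>B. j < k}" for i j
    by (auto intro!: card_mono)
  have lt: "a \<gamma> < w \<gamma> \<delta> \<or> b \<delta> < w \<gamma> \<delta>" using st box by (auto simp: standard_def)
  consider (size) "card A + card B \<le> r"
    | (edge) i j where "i \<in> A" "j \<in> B" "E i j" "Suc (card {k\<in>A. i < k} + card {l\<in>B. j < l}) \<le> r"
    using att unfolding attains_def A_def B_def by blast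
  then show ?thesis
  proof cases
    case size
    then have "attains (A - {\<gamma>}) B r" "attains A (B - {\<delta>}) r"
      unfolding attains_def using sub by (meson add_le_mono le_refl le_trans)+
    then show ?thesis using lt row col by blast
  next
    case edge
    have r: "attains (A - {\<gamma>}) B r" if "i \<noteq> \<gamma>"
    proof -
      have "Suc (card {k\<in>A - {\<gamma>}. i < k} + card {l\<in>B. j < l}) \<le> r" using edge(4) sub(3)[of i] by linarith
      then show ?thesis unfolding attains_def using edge that by blast
    qed
    have c: "attains A (B - {\<delta>}) r" if "j \<noteq> \<delta>"
    proof -
      have "Suc (card {k\<in>A. i < k} + card {l\<in>B - {\<delta>}. j < l}) \<le> r" using edge(4) sub(4)[of j] by linarith
      then show ?thesis unfolding attains_def using edge that by blast
    qed
    have bd: "b \<delta> < w \<gamma> \<delta>" if "\<gamma> \<in> A" using that box by (auto simp: A_def live_rows_def)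
    have ag: "a \<gamma> < w \<gamma> \<delta>" if "\<delta> \<in> B" using that box by (auto simp: B_def live_cols_def)
    show ?thesis
    proof (cases "i = \<gamma> \<and> j = \<delta>")
      case False
      then show ?thesis using r c lt row col bd ag edge by metis
    next
      case True
      note ij = True
      have gA: "\<gamma> \<in> A" and dB: "\<delta> \<in> B" using True edge by auto
      have v: "Suc (card {k\<in>A. \<gamma> < k} + card {l\<in>B. \<delta> < l}) \<le> r" using True edge by blast
      \<comment> \<open>Dropping \<open>\<gamma>\<close> or \<open>\<delta>\<close> destroys this
        edge. The nearest live row above or live column to the left replaces it at no higher value.
        If there is neither, the edge has value \<open>card A + card B - 1\<close>, the number of
        live variables after \<open>\<gamma>\<close> is dropped.\<close>
      consider (up) "{k\<in>A. k < \<gamma>} \<noteq> {}" | (left) "{l\<in>B. l < \<delta>} \<noteq> {}"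
        | (none) "{k\<in>A. k < \<gamma>} = {}" "{l\<in>B. l < \<delta>} = {}" by blast
      then show ?thesis
      proof cases
        case up
        define k where "k = Max {k\<in>A. k < \<gamma>}"
        have k: "k \<in> A" "k < \<gamma>" using Max_in[OF _ up] by (auto simp: k_def)
        have "x \<le> k" if "x \<in> A" "x < \<gamma>" for x using that by (auto simp: k_def intro: Max_ge)
        then have "{x\<in>A - {\<gamma>}. k < x} \<subseteq> {x\<in>A. \<gamma> < x}" by (auto simp: not_less) (meson leD linorder_neqE_nat)
        then have "card {x\<in>A - {\<gamma>}. k < x} \<le> card {x\<in>A. \<gamma> < x}" by (simp add: card_mono)
        then have "Suc (card {x\<in>A - {\<gamma>}. k < x} + card {l\<in>B. \<delta> < l}) \<le> r" using v by linarith
        moreover have "E k \<delta>" using box_up[OF box, of k] k by (auto simp: A_def live_rows_def)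
        ultimately have "attains (A - {\<gamma>}) B r" unfolding attains_def using k dB by blast
        then show ?thesis using row ag[OF dB] by blast
      next
        case left
        define k where "k = Max {k\<in>B. k < \<delta>}"
        have k: "k \<in> B" "k < \<delta>" using Max_in[OF _ left] by (auto simp: k_def)
        have "x \<le> k" if "x \<in> B" "x < \<delta>" for x using that by (auto simp: k_def intro: Max_ge)
        then have "{x\<in>B - {\<delta>}. k < x} \<subseteq> {x\<in>B. \<delta> < x}" by (auto simp: not_less) (meson leD linorder_neqE_nat)
        then have "card {x\<in>B - {\<delta>}. k < x} \<le> card {x\<in>B. \<delta> < x}" by (simp add: card_mono)
        then have "Suc (card {l\<in>A. \<gamma> < l} + card {x\<in>B - {\<delta>}. k < x}) \<le> r" using v by linarith
        moreover have "E \<gamma> k" using box_left[OF box, of k] k by (auto simp: B_def live_cols_def)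
        ultimately have "attains A (B - {\<delta>}) r" unfolding attains_def using k gA by blast
        then show ?thesis using col bd[OF gA] by blast
      next
        case none
        have "A - {\<gamma>} \<subseteq> {k\<in>A. \<gamma> < k}" using none(1) by auto
        then have 1: "card (A - {\<gamma>}) \<le> card {k\<in>A. \<gamma> < k}" by (simp add: card_mono)
        have "B \<subseteq> insert \<delta> {k\<in>B. \<delta> < k}" using none(2) by auto
        then have "card B \<le> card (insert \<delta> {k\<in>B. \<delta> < k})" by (intro card_mono) auto
        then have "card B \<le> Suc (card {k\<in>B. \<delta> < k})" by simp
        then have "attains (A - {\<gamma>}) B r" unfolding attains_def using 1 v by linarith
        then show ?thesis using row ag[OF dB] by blast
      qed
    qed
  qed
qed

text \<open>In the complex of independent sets of the live graph, the link of \<open>FA \<union> FB\<close> is the disjoint union of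
  the simplices \<open>X\<close> and \<open>Y\<close>, or just the empty face; this is the source of the nonzero cohomology. It is
  read off from an edge of minimal value.\<close>

lemma attains_split:
  assumes att: "attains A B r" and [simp]: "finite A" "finite B" and "A \<subseteq> P" "B \<subseteq> Q"
  obtains FA FB X Y where "FA \<subseteq> A" "FB \<subseteq> B" "X \<subseteq> A - FA" "Y \<subseteq> B - FB"
    "\<And>i j. i \<in> FA \<Longrightarrow> j \<in> FB \<union> Y \<Longrightarrow> \<not> E i j" "\<And>i j. i \<in> X \<Longrightarrow> j \<in> FB \<Longrightarrow> \<not> E i j"
    "\<And>i j. i \<in> X \<Longrightarrow> j \<in> Y \<Longrightarrow> E i j"
    "\<And>i. i \<in> A - FA - X \<Longrightarrow> \<exists>j\<in>FB. E i j" "\<And>j. j \<in> B - FB - Y \<Longrightarrow> \<exists>i\<in>FA. E i j"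
    "X = {} \<and> Y = {} \<and> card FA + card FB \<le> r \<or> X \<noteq> {} \<and> Y \<noteq> {} \<and> Suc (card FA + card FB) \<le> r"
proof (cases "\<exists>i\<in>A. \<exists>j\<in>B. E i j")
  case False
  then have "card A + card B \<le> r" using att by (auto simp: attains_def)
  then show ?thesis using False by (intro that[of A B "{}" "{}"]) auto
next
  case True
  define val where "val = (\<lambda>(i, j). card {k\<in>A. i < k} + card {l\<in>B. j < l})"
  define S where "S = {(i, j). i \<in> A \<and> j \<in> B \<and> E i j}"
  have "S \<noteq> {}" using True by (auto simp: S_def)
  moreover have "finite S" by (rule finite_subset[of _ "A \<times> B"]) (auto simp: S_def)
  ultimately obtain e where e: "e \<in> S" "\<And>e'. e' \<in> S \<Longrightarrow> val e \<le> val e'"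
    using ex_min_if_finite[of "val ` S"] by (metis (no_types, lifting) finite_imageI image_iff image_is_empty not_less)
  obtain i j where ij: "e = (i, j)" by force
  have iA: "i \<in> A" and jB: "j \<in> B" and Eij: "E i j" using e(1) by (auto simp: ij S_def)
  have le: "val (i, j) \<le> val (k, l)" if "k \<in> A" "l \<in> B" "E k l" for k l
    using e(2)[of "(k, l)"] that by (simp add: ij S_def)
  \<comment> \<open>By minimality \<open>j\<close> is the rightmost live neighbour of
    \<open>i\<close>, and \<open>i\<close> the lowest live neighbour of \<open>j\<close>.\<close>
  have right: "\<not> E i l" if "l \<in> B" "j < l" for l
  proof
    assume "E i l"
    moreover have "card {m\<in>B. l < m} < card {m\<in>B. j < m}"
      by (rule psubset_card_mono) (use that in auto)
    ultimately show False using le[of i l] iA that by (simp add: val_def)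
  qed
  have below: "\<not> E k j" if "k \<in> A" "i < k" for k
  proof
    assume "E k j"
    moreover have "card {m\<in>A. k < m} < card {m\<in>A. i < m}"
      by (rule psubset_card_mono) (use that in auto)
    ultimately show False using le[of k j] jB that by (simp add: val_def)
  qed
  have "Suc (val (i, j)) \<le> r"
  proof -
    consider (size) "card A + card B \<le> r" | k l where "k \<in> A" "l \<in> B" "E k l" "Suc (val (k, l)) \<le> r"
      using att by (auto simp: attains_def val_def)
    then show ?thesis
    proof cases
      case size
      have "card {k\<in>A. i < k} < card A" by (rule psubset_card_mono) (use iA in auto)
      moreover have "card {l\<in>B. j < l} \<le> card B" by (rule card_mono) auto
      ultimately show ?thesis using size by (simp add: val_def)
    qed (use le in fastforce)
  qed
  then have r: "Suc (card {k\<in>A. i < k} + card {l\<in>B. j < l}) \<le> r" by (simp add: val_def)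
  have iP: "i \<in> P" and jQ: "j \<in> Q" using box_in Eij by auto
  show ?thesis
  \<comment> \<open>\<open>X\<close> and \<open>Y\<close> collect the remaining rows and columns
    without a neighbour beyond the corner \<open>(i, j)\<close>. They lie weakly above and to the
    left of this box, so the staircase shape joins them completely.\<close>
  proof (rule that[of "{k\<in>A. i < k}" "{l\<in>B. j < l}"
        "{k\<in>A. k \<le> i \<and> (\<forall>l\<in>B. j < l \<longrightarrow> \<not> E k l)}" "{l\<in>B. l \<le> j \<and> (\<forall>k\<in>A. i < k \<longrightarrow> \<not> E k l)}"])
    show "\<not> E k l" if "k \<in> {k\<in>A. i < k}" "l \<in> {l\<in>B. j < l} \<union> {l\<in>B. l \<le> j \<and> (\<forall>k\<in>A. i < k \<longrightarrow> \<not> E k l)}" for k l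
      using that right[of l] box_up[of k l i] iP by auto
    show "E k l" if "k \<in> {k\<in>A. k \<le> i \<and> (\<forall>l\<in>B. j < l \<longrightarrow> \<not> E k l)}"
      "l \<in> {l\<in>B. l \<le> j \<and> (\<forall>k\<in>A. i < k \<longrightarrow> \<not> E k l)}" for k l
      using that box_up[OF Eij, of k] box_left[of k j l] assms(4,5) by auto
  qed (use right below iA jB r in \<open>auto simp: not_le\<close>)
qed

end

section \<open>Depth of the ideals of weighted Ferrers diagrams\<close>

text \<open>The unit ideal occurs among the colon ideals of the filtration; weak regularity admits
  it.\<close>

lemma weak_reg_seq_top: "set fs \<subseteq> R \<Longrightarrow> subring R \<Longrightarrow> weak_reg_seq R R fs"
proof (induction fs)
  case (Cons f fs)
  interpret subring R by fact
  have "ideal_gen R (insert f R) = R" using Cons.prems by (intro gen_insert_absorb idl_R) auto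
  then show ?case using Cons by simp
qed simp

context ferrers
begin

definition vars :: "(nat + nat) set" where
  "vars = Inl ` P \<union> Inr ` Q"

text \<open>The exponents of the monomials in \<open>(I : x\<^sup>p y\<^sup>q) + (x\<^sub>i | i \<in> K) + (y\<^sub>j | j \<in> L)\<close>. This class of
  ideals is closed under the exact sequences for variables.\<close>

definition exps :: "(nat \<Rightarrow> nat) \<Rightarrow> (nat \<Rightarrow> nat) \<Rightarrow> nat set \<Rightarrow> nat set \<Rightarrow> ((nat + nat) \<Rightarrow>\<^sub>0 nat) set" where
  "exps p q K L = {\<mu>. (\<exists>i\<in>K. 0 < Poly_Mapping.lookup \<mu> (Inl i)) \<or> (\<exists>j\<in>L. 0 < Poly_Mapping.lookup \<mu> (Inr j)) \<or>
     \<not> standard (\<lambda>i. p i + Poly_Mapping.lookup \<mu> (Inl i)) (\<lambda>j. q j + Poly_Mapping.lookup \<mu> (Inr j))}"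

abbreviation ideal_of :: "(nat \<Rightarrow> nat) \<Rightarrow> (nat \<Rightarrow> nat) \<Rightarrow> nat set \<Rightarrow> nat set \<Rightarrow> 'k::comm_ring_1 mpoly set" where
  "ideal_of p q K L \<equiv> mon_ideal vars (exps p q K L)"

lemma finite_vars: "finite vars"
  using finite_rows finite_cols by (simp add: vars_def)

lemma standard_antimono:
  assumes "standard a b" "\<And>i. a' i \<le> a i" "\<And>j. b' j \<le> b j"
  shows "standard a' b'"
  using assms unfolding standard_def by (meson le_less_trans)

lemma upclosed_exps: "upclosed vars (exps p q K L)"
  unfolding upclosed_def
proof (intro ballI allI impI)
  fix \<mu> \<nu> :: "nat + nat \<Rightarrow>\<^sub>0 nat" assume \<mu>: "\<mu> \<in> exps p q K L"
  have "standard (\<lambda>i. p i + Poly_Mapping.lookup (\<nu> + \<mu>) (Inl i)) (\<lambda>j. q j + Poly_Mapping.lookup (\<nu> + \<mu>) (Inr j)) \<Longrightarrow>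
    standard (\<lambda>i. p i + Poly_Mapping.lookup \<mu> (Inl i)) (\<lambda>j. q j + Poly_Mapping.lookup \<mu> (Inr j))"
    by (erule standard_antimono) (auto simp: lookup_add)
  then show "\<nu> + \<mu> \<in> exps p q K L" using \<mu> by (auto simp: exps_def lookup_add)
qed

lemma depth_le_shift_row: "i \<notin> K \<Longrightarrow> depth_le (p(i := Suc (p i))) q K L r \<Longrightarrow> depth_le p q K L r"
  unfolding depth_le_def by (metis fun_upd_apply Suc_leD)

lemma depth_le_shift_col: "j \<notin> L \<Longrightarrow> depth_le p (q(j := Suc (q j))) K L r \<Longrightarrow> depth_le p q K L r"
  unfolding depth_le_def by (metis fun_upd_apply Suc_leD)

text \<open>The row is dead for all column exponents above \<open>q\<close>, so killing it leaves
  the live rows unchanged.\<close>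

lemma depth_le_dead_row:
  assumes "E i j" "w i j \<le> q j" "depth_le p q (insert i K) L r"
  shows "depth_le p q K L r"
proof -
  obtain a b where *: "\<forall>i. p i \<le> a i" "\<forall>j. q j \<le> b j" "\<forall>x\<in>insert i K. a x = p x" "\<forall>j\<in>L. b j = q j"
    "standard a b" "attains (live_rows (insert i K) b) (live_cols L a) r"
    using assms(3) unfolding depth_le_def by blast
  have "w i j \<le> b j" using *(2) assms(2) le_trans by blast
  then have "live_rows (insert i K) b = live_rows K b" using assms(1) by (auto simp: live_rows_def not_less)
  then show ?thesis using * by (intro depth_leI[of p a q b]) auto
qed

lemma depth_le_dead_col:
  assumes "E i j" "w i j \<le> p i" "depth_le p q K (insert j L) r"
  shows "depth_le p q K L r"
proof -
  obtain a b where *: "\<forall>i. p i \<le> a i" "\<forall>j. q j \<le> b j" "\<forall>i\<in>K. a i = p i" "\<forall>x\<in>insert j L. b x = q x"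
    "standard a b" "attains (live_rows K b) (live_cols (insert j L) a) r"
    using assms(3) unfolding depth_le_def by blast
  have "w i j \<le> a i" using *(1) assms(2) le_trans by blast
  then have "live_cols (insert j L) a = live_cols L a" using assms(1) by (auto simp: live_cols_def not_less)
  then show ?thesis using * by (intro depth_leI[of p a q b]) auto
qed

lemma colon_row:
  assumes "i \<in> P - K"
  shows "{c \<in> polys_in vars. c * Var (Inl i) \<in> ideal_of p q K L} =
    (ideal_of (p(i := Suc (p i))) q K L :: 'k::comm_ring_1 mpoly set)"
proof -
  have "\<mu> + Poly_Mapping.single (Inl i) 1 \<in> exps p q K L \<longleftrightarrow> \<mu> \<in> exps (p(i := Suc (p i))) q K L" for \<mu>
  proof -
    let ?\<mu> = "\<mu> + Poly_Mapping.single (Inl i) 1"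
    have 1: "(\<lambda>x. p x + Poly_Mapping.lookup ?\<mu> (Inl x)) = (\<lambda>x. (p(i := Suc (p i))) x + Poly_Mapping.lookup \<mu> (Inl x))"
      by (auto simp: lookup_add lookup_single when_def)
    have 2: "(\<exists>x\<in>K. 0 < Poly_Mapping.lookup ?\<mu> (Inl x)) \<longleftrightarrow> (\<exists>x\<in>K. 0 < Poly_Mapping.lookup \<mu> (Inl x))"
      using assms by (auto simp: lookup_add lookup_single when_def split: if_splits)
    have 3: "Poly_Mapping.lookup ?\<mu> (Inr x) = Poly_Mapping.lookup \<mu> (Inr x)" for x
      by (simp add: lookup_add lookup_single)
    show ?thesis by (simp only: exps_def mem_Collect_eq 1 2 3)
  qed
  then show ?thesis unfolding Var_def
    by (subst mon_ideal_colon) (use assms in \<open>auto simp: vars_def\<close>)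
qed

lemma colon_col:
  assumes "j \<in> Q - L"
  shows "{c \<in> polys_in vars. c * Var (Inr j) \<in> ideal_of p q K L} =
    (ideal_of p (q(j := Suc (q j))) K L :: 'k::comm_ring_1 mpoly set)"
proof -
  have "\<mu> + Poly_Mapping.single (Inr j) 1 \<in> exps p q K L \<longleftrightarrow> \<mu> \<in> exps p (q(j := Suc (q j))) K L" for \<mu>
  proof -
    let ?\<mu> = "\<mu> + Poly_Mapping.single (Inr j) 1"
    have 1: "(\<lambda>x. q x + Poly_Mapping.lookup ?\<mu> (Inr x)) = (\<lambda>x. (q(j := Suc (q j))) x + Poly_Mapping.lookup \<mu> (Inr x))"
      by (auto simp: lookup_add lookup_single when_def)
    have 2: "(\<exists>x\<in>L. 0 < Poly_Mapping.lookup ?\<mu> (Inr x)) \<longleftrightarrow> (\<exists>x\<in>L. 0 < Poly_Mapping.lookup \<mu> (Inr x))"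
      using assms by (auto simp: lookup_add lookup_single when_def split: if_splits)
    have 3: "Poly_Mapping.lookup ?\<mu> (Inl x) = Poly_Mapping.lookup \<mu> (Inl x)" for x
      by (simp add: lookup_add lookup_single)
    show ?thesis by (simp only: exps_def mem_Collect_eq 1 2 3)
  qed
  then show ?thesis unfolding Var_def
    by (subst mon_ideal_colon) (use assms in \<open>auto simp: vars_def\<close>)
qed

lemma insert_row:
  "i \<in> P \<Longrightarrow> ideal_gen (polys_in vars) (insert (Var (Inl i)) (ideal_of p q K L)) =
    (ideal_of p q (insert i K) L :: 'k::comm_ring_1 mpoly set)"
  by (rule mon_ideal_insert_Var[OF upclosed_exps]) (auto simp: vars_def exps_def)

lemma insert_col:
  "j \<in> Q \<Longrightarrow> ideal_gen (polys_in vars) (insert (Var (Inr j)) (ideal_of p q K L)) =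
    (ideal_of p q K (insert j L) :: 'k::comm_ring_1 mpoly set)"
  by (rule mon_ideal_insert_Var[OF upclosed_exps]) (auto simp: vars_def exps_def)

lemma ideal_of_top:
  assumes "\<not> standard p q"
  shows "ideal_of p q K L = (polys_in vars :: 'k::comm_ring_1 mpoly set)"
proof -
  have "\<not> standard (\<lambda>i. p i + Poly_Mapping.lookup \<mu> (Inl i)) (\<lambda>j. q j + Poly_Mapping.lookup \<mu> (Inr j))" for \<mu> :: "nat + nat \<Rightarrow>\<^sub>0 nat"
    using assms by (rule contrapos_nn) (erule standard_antimono, auto)
  then show ?thesis by (auto simp: mon_ideal_def exps_def)
qed

text \<open>In a monomial free of killed variables, the exponent at a killed end of a box stays at
  its lower bound. Liveness, or standardness if both ends are killed, puts one such bound below the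
  weight, so no box contributes beyond the killed variables.\<close>

lemma ideal_of_leaf:
  assumes st: "standard p q" and KL: "K \<subseteq> P" "L \<subseteq> Q"
    and live_p: "\<And>i j. E i j \<Longrightarrow> j \<notin> L \<Longrightarrow> p i < w i j"
    and live_q: "\<And>i j. E i j \<Longrightarrow> i \<notin> K \<Longrightarrow> q j < w i j"
    and killed: "\<And>i j. E i j \<Longrightarrow> i \<in> K \<or> j \<in> L"
  shows "ideal_of p q K L = (var_ideal vars (Inl ` K \<union> Inr ` L) :: 'k::comm_ring_1 mpoly set)"
  unfolding var_ideal_def
proof (rule mon_ideal_cong)
  fix \<mu> :: "nat + nat \<Rightarrow>\<^sub>0 nat"
  have "standard (\<lambda>i. p i + Poly_Mapping.lookup \<mu> (Inl i)) (\<lambda>j. q j + Poly_Mapping.lookup \<mu> (Inr j))"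
    if "\<not> (\<exists>i\<in>K. 0 < Poly_Mapping.lookup \<mu> (Inl i))" "\<not> (\<exists>j\<in>L. 0 < Poly_Mapping.lookup \<mu> (Inr j))"
    unfolding standard_def
  proof (intro allI impI)
    fix i j assume ij: "E i j"
    show "p i + Poly_Mapping.lookup \<mu> (Inl i) < w i j \<or> q j + Poly_Mapping.lookup \<mu> (Inr j) < w i j"
      using that killed[OF ij] live_p[OF ij] live_q[OF ij] st ij unfolding standard_def
      by (cases "i \<in> K"; cases "j \<in> L") auto
  qed
  note st' = this
  show "\<mu> \<in> exps p q K L \<longleftrightarrow> \<mu> \<in> {\<mu>. \<exists>v\<in>Inl ` K \<union> Inr ` L. 0 < Poly_Mapping.lookup \<mu> v}"
  proof (cases "(\<exists>i\<in>K. 0 < Poly_Mapping.lookup \<mu> (Inl i)) \<or> (\<exists>j\<in>L. 0 < Poly_Mapping.lookup \<mu> (Inr j))")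
    case True
    then show ?thesis by (auto simp: exps_def bex_Un)
  next
    case False
    then have "standard (\<lambda>i. p i + Poly_Mapping.lookup \<mu> (Inl i)) (\<lambda>j. q j + Poly_Mapping.lookup \<mu> (Inr j))"
      using st' by blast
    then show ?thesis by (auto simp: exps_def bex_Un)
  qed
qed

lemma exists_min_box:
  assumes "E i0 j0" "i0 \<notin> K" "j0 \<notin> L"
  obtains \<gamma> \<delta> where "E \<gamma> \<delta>" "\<gamma> \<notin> K" "\<delta> \<notin> L"
    "\<And>i. i \<in> P \<Longrightarrow> i \<notin> K \<Longrightarrow> i < \<gamma> \<Longrightarrow> w \<gamma> \<delta> < w i \<delta>"
proof -
  define \<omega> where "\<omega> = (LEAST x. \<exists>i j. E i j \<and> i \<notin> K \<and> j \<notin> L \<and> w i j = x)"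
  have ex: "\<exists>i j. E i j \<and> i \<notin> K \<and> j \<notin> L \<and> w i j = \<omega>"
    unfolding \<omega>_def by (rule LeastI[of _ "w i0 j0"]) (use assms in blast)
  have min: "\<omega> \<le> w i j" if "E i j" "i \<notin> K" "j \<notin> L" for i j
    unfolding \<omega>_def by (rule Least_le) (use that in blast)
  \<comment> \<open>The topmost row among boxes of least weight makes the comparison upwards in the
    column strict, as \<open>depth_le_kill_row\<close> demands.\<close>
  define \<gamma> where "\<gamma> = (LEAST i. \<exists>j. E i j \<and> i \<notin> K \<and> j \<notin> L \<and> w i j = \<omega>)"
  obtain \<delta> where \<delta>: "E \<gamma> \<delta>" "\<gamma> \<notin> K" "\<delta> \<notin> L" "w \<gamma> \<delta> = \<omega>"
    using LeastI_ex[OF ex] unfolding \<gamma>_def by blast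
  have "\<omega> < w i \<delta>" if "i \<in> P" "i \<notin> K" "i < \<gamma>" for i
  proof -
    have "E i \<delta>" using box_up[OF \<delta>(1) that(1)] that(3) by simp
    moreover have "w i \<delta> \<noteq> \<omega>" using not_less_Least[OF that(3)[unfolded \<gamma>_def]] \<delta>(3) that calculation by blast
    ultimately show ?thesis using min[of i \<delta>] \<delta>(3) that by simp
  qed
  then show ?thesis using that[OF \<delta>(1-3)] \<delta>(4) by simp
qed

context
  fixes k :: nat
begin

abbreviation (input) esyms :: "'k::comm_ring_1 mpoly list" where
  "esyms \<equiv> map (\<lambda>i. esym vars (Suc i)) [0..<k]"

text \<open>The lower bound on the values passes to the colon ideal because raising \<open>p\<close>
  or \<open>q\<close> leaves fewer exponents to choose from, and to the quotient because killing the
  variable creates no smaller value.\<close>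

theorem weak_reg_esym_ideal_of:
  assumes "K \<subseteq> P" "L \<subseteq> Q" "standard p q" "\<And>r. depth_le p q K L r \<Longrightarrow> k \<le> r"
  shows "weak_reg_seq (polys_in vars) (ideal_of p q K L :: 'k::comm_ring_1 mpoly set) esyms"
proof -
  interpret subring "polys_in vars :: 'k mpoly set" by (rule subring_polys_in)
  define W where "W = (\<Sum>i\<in>P. \<Sum>j\<in>Q. w i j)"
  have W: "w i j \<le> W" if "E i j" for i j
  proof -
    have "w i j \<le> (\<Sum>j\<in>Q. w i j)" using box_in[OF that] finite_cols by (intro member_le_sum) auto
    also have "\<dots> \<le> W" unfolding W_def using box_in[OF that] finite_rows
      by (intro member_le_sum[of i P "\<lambda>i. \<Sum>j\<in>Q. w i j"]) auto
    finally show ?thesis .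
  qed
  \<comment> \<open>Both ends of the exact sequence decrease this measure. \<open>Suc W\<close>
    keeps the summand of an unkilled variable positive while its exponent is at most the common
    bound \<open>W\<close> of the weights.\<close>
  define msr where "msr = (\<lambda>p q K L. (\<Sum>i\<in>P - K. Suc W - p i) + (\<Sum>j\<in>Q - L. Suc W - q j))"
  have es: "set esyms \<subseteq> (polys_in vars :: 'k mpoly set)" using esym_in[OF finite_vars] by auto
  show ?thesis using assms
  proof (induction "msr p q K L" arbitrary: p q K L rule: less_induct)
    case less
    note fin = finite_rows finite_cols
    have row: ?case if i: "i \<in> P - K" "p i \<le> W"
      and loss: "\<And>r. depth_le p q (insert i K) L r \<Longrightarrow> depth_le p q K L r" for i
    proof (rule weak_reg_seq_exact[OF idl_mon_ideal[OF upclosed_exps] Var_in es])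
      show "weak_reg_seq (polys_in vars) {c \<in> polys_in vars. c * Var (Inl i) \<in> (ideal_of p q K L :: 'k mpoly set)} esyms"
      proof (cases "standard (p(i := Suc (p i))) q")
        case True
        have "(\<Sum>x\<in>P - K. Suc W - (p(i := Suc (p i))) x) < (\<Sum>x\<in>P - K. Suc W - p x)"
          by (rule sum_strict_mono_ex1) (use i fin in auto)
        then have "msr (p(i := Suc (p i))) q K L < msr p q K L" by (simp add: msr_def)
        then show ?thesis unfolding colon_row[OF i(1)]
          using less.hyps[of "p(i := Suc (p i))" q K L] True less.prems depth_le_shift_row[of i K p] i by auto
      qed (simp add: colon_row[OF i(1)] ideal_of_top weak_reg_seq_top[OF es subring_polys_in])
      have "msr p q (insert i K) L < msr p q K L"
        unfolding msr_def by (rule add_strict_right_mono, rule sum_strict_mono2[of _ _ i]) (use i fin in auto)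
      then show "weak_reg_seq (polys_in vars) (ideal_gen (polys_in vars) (insert (Var (Inl i) :: 'k mpoly) (ideal_of p q K L))) esyms"
        using less.hyps[of p q "insert i K" L] less.prems loss i by (simp add: insert_row)
    qed (use i in \<open>auto simp: vars_def\<close>)
    have col: ?case if j: "j \<in> Q - L" "q j \<le> W"
      and loss: "\<And>r. depth_le p q K (insert j L) r \<Longrightarrow> depth_le p q K L r" for j
    proof (rule weak_reg_seq_exact[OF idl_mon_ideal[OF upclosed_exps] Var_in es])
      show "weak_reg_seq (polys_in vars) {c \<in> polys_in vars. c * Var (Inr j) \<in> (ideal_of p q K L :: 'k mpoly set)} esyms"
      proof (cases "standard p (q(j := Suc (q j)))")
        case True
        have "(\<Sum>x\<in>Q - L. Suc W - (q(j := Suc (q j))) x) < (\<Sum>x\<in>Q - L. Suc W - q x)"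
          by (rule sum_strict_mono_ex1) (use j fin in auto)
        then have "msr p (q(j := Suc (q j))) K L < msr p q K L" by (simp add: msr_def)
        then show ?thesis unfolding colon_col[OF j(1)]
          using less.hyps[of p "q(j := Suc (q j))" K L] True less.prems depth_le_shift_col[of j L p q] j by auto
      qed (simp add: colon_col[OF j(1)] ideal_of_top weak_reg_seq_top[OF es subring_polys_in])
      have "msr p q K (insert j L) < msr p q K L"
        unfolding msr_def by (rule add_strict_left_mono, rule sum_strict_mono2[of _ _ j]) (use j fin in auto)
      then show "weak_reg_seq (polys_in vars) (ideal_gen (polys_in vars) (insert (Var (Inr j) :: 'k mpoly) (ideal_of p q K L))) esyms"
        using less.hyps[of p q K "insert j L"] less.prems loss j by (simp add: insert_col)
    qed (use j in \<open>auto simp: vars_def\<close>)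
    \<comment> \<open>Dead variables go first: \<open>depth_le_kill_row\<close> assumes that the
      lower bounds \<open>p\<close> and \<open>q\<close> alone kill nothing that is left.\<close>
    consider (dead_row) i j where "E i j" "i \<notin> K" "w i j \<le> q j" | (dead_col) i j where "E i j" "j \<notin> L" "w i j \<le> p i"
      | (live) "\<And>i j. E i j \<Longrightarrow> j \<notin> L \<Longrightarrow> p i < w i j" "\<And>i j. E i j \<Longrightarrow> i \<notin> K \<Longrightarrow> q j < w i j"
      by (meson not_less)
    then show ?case
    proof cases
      case dead_row
      have "p i < w i j" using standardD_row[OF less.prems(3)] dead_row by blast
      then show ?thesis using row[of i] dead_row box_in W[of i j] depth_le_dead_row[of i j q p K L] by fastforce
    next
      case dead_col
      have "q j < w i j" using standardD_col[OF less.prems(3)] dead_col by blast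
      then show ?thesis using col[of j] dead_col box_in W[of i j] depth_le_dead_col[of i j p q K L] by fastforce
    next
      case live
      show ?thesis
      proof (cases "\<exists>i j. E i j \<and> i \<notin> K \<and> j \<notin> L")
        case True
        then obtain \<gamma> \<delta> where *: "E \<gamma> \<delta>" "\<gamma> \<notin> K" "\<delta> \<notin> L"
          "\<And>i. i \<in> P \<Longrightarrow> i \<notin> K \<Longrightarrow> i < \<gamma> \<Longrightarrow> w \<gamma> \<delta> < w i \<delta>"
          using exists_min_box by metis
        have "p \<gamma> \<le> W" using live(1)[OF *(1,3)] W[OF *(1)] by simp
        then show ?thesis using row[of \<gamma>] depth_le_kill_row[OF live *(1-4)] box_in * by blast
      next
        case False
        have leaf: "ideal_of p q K L = (var_ideal vars (Inl ` K \<union> Inr ` L) :: 'k mpoly set)"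
          by (rule ideal_of_leaf) (use less.prems live False in auto)
        have lv: "live_rows K q = P - K" "live_cols L p = Q - L"
          using live by (auto simp: live_rows_def live_cols_def)
        have "depth_le p q K L (card (P - K) + card (Q - L))"
          by (rule depth_leI[of p p q q]) (use less.prems in \<open>auto simp: lv attains_def\<close>)
        then have "k \<le> card (P - K) + card (Q - L)" by (rule less.prems(4))
        also have "\<dots> = card (Inl ` (P - K) \<union> Inr ` (Q - L) :: (nat + nat) set)"
          using fin by (subst card_Un_disjoint) (auto simp: card_image)
        also have "Inl ` (P - K) \<union> Inr ` (Q - L) = vars - (Inl ` K \<union> Inr ` L)" by (auto simp: vars_def)
        finally show ?thesis unfolding leaf
          by (intro weak_reg_esym[OF finite_vars]) (use less.prems in \<open>auto simp: vars_def\<close>)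
      qed
    qed
  qed
qed

end

theorem weak_reg_length_le_depth:
  fixes fs :: "'k::comm_ring_1 mpoly list"
  assumes KL: "K \<subseteq> P" "L \<subseteq> Q" and wpos: "\<And>i j. E i j \<Longrightarrow> 0 < w i j"
    and le: "depth_le (\<lambda>_. 0) (\<lambda>_. 0) K L r"
    and fs: "set fs \<subseteq> max_ideal (polys_in vars)"
    and weak: "weak_reg_seq (polys_in vars) (ideal_of (\<lambda>_. 0) (\<lambda>_. 0) K L) fs"
  shows "length fs \<le> r"
proof -
  obtain a b where aK: "\<And>i. i \<in> K \<Longrightarrow> a i = 0" and bL: "\<And>j. j \<in> L \<Longrightarrow> b j = 0" and st: "standard a b"
    and att: "attains (live_rows K b) (live_cols L a) r"
    using le unfolding depth_le_def by blast
  define A where "A = live_rows K b"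
  define B where "B = live_cols L a"
  have AB: "A \<subseteq> P - K" "B \<subseteq> Q - L" by (auto simp: A_def B_def live_rows_def live_cols_def)
  then have AB': "A \<subseteq> P" "B \<subseteq> Q" by auto
  have Alive: "b j < w i j" if "i \<in> A" "E i j" for i j using that by (auto simp: A_def live_rows_def)
  have Blive: "a i < w i j" if "j \<in> B" "E i j" for i j using that by (auto simp: B_def live_cols_def)
  obtain FA FB X Y where F: "FA \<subseteq> A" "FB \<subseteq> B" "X \<subseteq> A - FA" "Y \<subseteq> B - FB"
    and FAF: "\<And>i j. i \<in> FA \<Longrightarrow> j \<in> FB \<union> Y \<Longrightarrow> \<not> E i j" and XF: "\<And>i j. i \<in> X \<Longrightarrow> j \<in> FB \<Longrightarrow> \<not> E i j"
    and XY: "\<And>i j. i \<in> X \<Longrightarrow> j \<in> Y \<Longrightarrow> E i j"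
    and domA: "\<And>i. i \<in> A - FA - X \<Longrightarrow> \<exists>j\<in>FB. E i j" and domB: "\<And>j. j \<in> B - FB - Y \<Longrightarrow> \<exists>i\<in>FA. E i j"
    and card: "X = {} \<and> Y = {} \<and> card FA + card FB \<le> r \<or> X \<noteq> {} \<and> Y \<noteq> {} \<and> Suc (card FA + card FB) \<le> r"
    by (rule attains_split[OF att[folded A_def B_def]]) (use AB' in \<open>auto simp: A_def B_def\<close>)
  define M where "M = (\<Sum>i\<in>P. a i) + (\<Sum>j\<in>Q. b j) + (\<Sum>i\<in>P. \<Sum>j\<in>Q. w i j)"
  have Ma: "a i \<le> M" if "i \<in> P" for i
    using member_le_sum[OF that, of a] finite_rows by (simp add: M_def)
  have Mb: "b j \<le> M" if "j \<in> Q" for j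
    using member_le_sum[OF that, of b] finite_cols by (simp add: M_def)
  have Mw: "w i j \<le> M" if "E i j" for i j
  proof -
    have "w i j \<le> (\<Sum>j\<in>Q. w i j)" using box_in[OF that] finite_cols by (intro member_le_sum) auto
    also have "\<dots> \<le> (\<Sum>i\<in>P. \<Sum>j\<in>Q. w i j)" using box_in[OF that] finite_rows
      by (intro member_le_sum[of i P "\<lambda>i. \<Sum>j\<in>Q. w i j"]) auto
    finally show ?thesis by (simp add: M_def)
  qed
  define N where "N = Suc M"
  \<comment> \<open>Exponent \<open>M\<close> on \<open>FA\<close> and \<open>FB\<close> reaches
    every weight, so these variables kill their neighbours, yet stays below \<open>N\<close>. The
    monomial remains outside the ideal because no edge joins \<open>FA\<close> to
    \<open>FB\<close>.\<close>
  define e where "e = case_sum (\<lambda>i. if i \<in> FA then M else a i) (\<lambda>j. if j \<in> FB then M else b j)"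
  define m where "m = (\<Sum>v\<in>vars. Poly_Mapping.single v (e v))"
  have lm: "Poly_Mapping.lookup m v = (if v \<in> vars then e v else 0)" for v
    using finite_vars by (auto simp: m_def lookup_sum lookup_single when_def sum.delta)
  have mrow: "Poly_Mapping.lookup m (Inl i) = (if i \<in> FA then M else a i)" if "i \<in> P" for i
    using that by (simp add: lm e_def vars_def)
  have mcol: "Poly_Mapping.lookup m (Inr j) = (if j \<in> FB then M else b j)" if "j \<in> Q" for j
    using that by (simp add: lm e_def vars_def image_iff)
  have keys_m: "Poly_Mapping.keys m \<subseteq> vars" by (auto simp: in_keys_iff lm split: if_splits)
  define F where "F = (Inl ` FA \<union> Inr ` FB :: (nat + nat) set)"
  have FV: "F \<subseteq> vars" using F AB' by (auto simp: F_def vars_def)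
  have finFAB: "finite FA" "finite FB" using F AB' finite_rows finite_cols by (meson finite_subset)+
  have cardF: "card F = card FA + card FB"
    unfolding F_def using finFAB by (subst card_Un_disjoint) (auto simp: card_image)
  have small: "Poly_Mapping.lookup m v < N" if "v \<in> F" for v
    using that F AB' mrow mcol by (auto simp: F_def N_def)
  let ?T = "exps (\<lambda>_. 0) (\<lambda>_. 0) K L"
  let ?s = "\<lambda>v. Poly_Mapping.single v N"
  have rK: "Poly_Mapping.lookup m (Inl i) = 0" if "i \<in> K" for i
  proof -
    have "i \<in> P" "i \<notin> FA" using that KL AB F by blast+
    then show ?thesis using mrow aK that by simp
  qed
  have rL: "Poly_Mapping.lookup m (Inr j) = 0" if "j \<in> L" for j
  proof -
    have "j \<in> Q" "j \<notin> FB" using that KL AB F by blast+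
    then show ?thesis using mcol bL that by simp
  qed
  have box: "Poly_Mapping.lookup m (Inl i) < w i j \<or> Poly_Mapping.lookup m (Inr j) < w i j"
    "i \<in> X \<Longrightarrow> Poly_Mapping.lookup m (Inr j) < w i j" "j \<in> Y \<Longrightarrow> Poly_Mapping.lookup m (Inl i) < w i j"
    if ij: "E i j" for i j
  proof -
    note PQ = box_in[OF ij]
    show "Poly_Mapping.lookup m (Inl i) < w i j \<or> Poly_Mapping.lookup m (Inr j) < w i j"
      using FAF[of i j] ij Alive[of i j] Blive[of j i] F st PQ mrow mcol
      by (cases "i \<in> FA"; cases "j \<in> FB") (auto simp: standard_def)
    show "i \<in> X \<Longrightarrow> Poly_Mapping.lookup m (Inr j) < w i j"
      using XF[of i j] ij Alive[of i j] F PQ mcol by auto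
    show "j \<in> Y \<Longrightarrow> Poly_Mapping.lookup m (Inl i) < w i j"
      using FAF[of i j] ij Blive[of j i] F PQ mrow by auto
  qed
  have mT: "m \<notin> ?T" using rK rL box(1) by (auto simp: exps_def standard_def)
  have XT: "m + ?s (Inl x) \<notin> ?T" if "x \<in> X" for x
  proof -
    have "x \<notin> K" using that F AB by auto
    then show ?thesis using rK rL box that
      by (auto simp: exps_def standard_def lookup_add lookup_single when_def)
  qed
  have YT: "m + ?s (Inr y) \<notin> ?T" if "y \<in> Y" for y
  proof -
    have "y \<notin> L" using that F AB by auto
    then show ?thesis using rK rL box that
      by (auto simp: exps_def standard_def lookup_add lookup_single when_def)
  qed
  have dead: "\<mu> \<in> ?T" if "E i j" "w i j \<le> Poly_Mapping.lookup \<mu> (Inl i)" "w i j \<le> Poly_Mapping.lookup \<mu> (Inr j)"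
    for \<mu> :: "nat + nat \<Rightarrow>\<^sub>0 nat" and i j
    using that by (auto simp: exps_def standard_def not_less)
  have domrow: "m + ?s (Inl i) \<in> ?T" if i: "i \<in> P - FA - X" for i
  proof -
    have big: "w i j \<le> Poly_Mapping.lookup (m + ?s (Inl i)) (Inl i)" if "E i j" for j
      using Mw[OF that] by (simp add: lookup_add N_def)
    consider "i \<in> K" | "i \<notin> K" "i \<notin> A" | "i \<in> A - FA - X" using i by blast
    then show ?thesis
    proof cases
      case 1
      then show ?thesis by (auto simp: exps_def lookup_add N_def intro!: bexI[of _ i])
    next
      case 2
      then obtain j where j: "E i j" "w i j \<le> b j" using i by (auto simp: A_def live_rows_def not_less)
      have "b j \<le> Poly_Mapping.lookup m (Inr j)" using mcol[of j] Mb[of j] box_in[OF j(1)] by auto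
      then show ?thesis by (intro dead[OF j(1) big[OF j(1)]]) (use j in \<open>simp add: lookup_add\<close>)
    next
      case 3
      then obtain j where j: "j \<in> FB" "E i j" using domA by blast
      show ?thesis
        by (rule dead[OF j(2) big[OF j(2)]]) (use j mcol[of j] Mw[of i j] box_in[OF j(2)] in \<open>simp add: lookup_add\<close>)
    qed
  qed
  have domcol: "m + ?s (Inr j) \<in> ?T" if j: "j \<in> Q - FB - Y" for j
  proof -
    have big: "w i j \<le> Poly_Mapping.lookup (m + ?s (Inr j)) (Inr j)" if "E i j" for i
      using Mw[OF that] by (simp add: lookup_add N_def)
    consider "j \<in> L" | "j \<notin> L" "j \<notin> B" | "j \<in> B - FB - Y" using j by blast
    then show ?thesis
    proof cases
      case 1
      then show ?thesis by (auto simp: exps_def lookup_add N_def intro!: bexI[of _ j])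
    next
      case 2
      then obtain i where i: "E i j" "w i j \<le> a i" using j by (auto simp: B_def live_cols_def not_less)
      have "a i \<le> Poly_Mapping.lookup m (Inl i)" using mrow[of i] Ma[of i] box_in[OF i(1)] by auto
      then show ?thesis by (intro dead[OF i(1) _ big[OF i(1)]]) (use i in \<open>simp add: lookup_add\<close>)
    next
      case 3
      then obtain i where i: "i \<in> FA" "E i j" using domB by blast
      show ?thesis
        by (rule dead[OF i(2) _ big[OF i(2)]]) (use i mrow[of i] Mw[of i j] box_in[OF i(2)] in \<open>simp add: lookup_add\<close>)
    qed
  qed
  have dom: "m + ?s v \<in> ?T" if "v \<in> vars - F - Inl ` X - Inr ` Y" for v
  proof (cases v)
    case (Inl i)
    then have "i \<in> P - FA - X" using that by (auto simp: vars_def F_def)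
    then show ?thesis using Inl domrow by simp
  next
    case (Inr j)
    then have "j \<in> Q - FB - Y" using that by (auto simp: vars_def F_def)
    then show ?thesis using Inr domcol by simp
  qed
  show ?thesis
  \<comment> \<open>If \<open>X\<close> is empty so is \<open>Y\<close>, every variable outside
    \<open>F\<close> is dead, and the point class applies; otherwise \<open>X\<close> and
    \<open>Y\<close> form the two parts of the link.\<close>
  proof (cases "X = {}")
    case True
    then have "length fs \<le> card F"
      using card dom by (intro weak_reg_length_le[OF finite_vars upclosed_exps fs weak keys_m FV small _ mT]) (auto simp: N_def)
    then show ?thesis using card True cardF by auto
  next
    case False
    then have ne: "X \<noteq> {}" "Y \<noteq> {}" using card by auto
    have "length fs \<le> Suc (card F)"
    proof (rule weak_reg_length_le_Suc[OF finite_vars upclosed_exps fs weak keys_m FV small,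
          where X = "Inl ` X" and Y = "Inr ` Y"])
      show "m + ?s u + ?s v \<in> ?T" if u: "u \<in> Inl ` X" and v: "v \<in> vars - F - Inl ` X" for u v
      proof (cases "v \<in> Inr ` Y")
        case True
        then obtain x y where xy: "u = Inl x" "v = Inr y" "x \<in> X" "y \<in> Y" using u by blast
        then show ?thesis using XY[of x y] Mw[of x y]
          by (intro dead[of x y]) (auto simp: lookup_add N_def)
      next
        case False
        then have "m + ?s v \<in> ?T" using dom v by blast
        moreover have "u \<in> vars" using u F AB' by (auto simp: vars_def)
        ultimately have "?s u + (m + ?s v) \<in> ?T" using upclosed_exps by (auto simp: upclosed_def N_def)
        then show ?thesis by (simp add: add_ac)
      qed
    qed (use ne F AB' XT YT in \<open>auto simp: F_def vars_def N_def\<close>)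
    then show ?thesis using card False cardF by auto
  qed
qed

theorem depth_ideal_of:
  assumes KL: "K \<subseteq> P" "L \<subseteq> Q" and wpos: "\<And>i j. E i j \<Longrightarrow> 0 < w i j"
    and le: "depth_le (\<lambda>_. 0) (\<lambda>_. 0) K L k" and min: "\<And>r. depth_le (\<lambda>_. 0) (\<lambda>_. 0) K L r \<Longrightarrow> k \<le> r"
  shows "depth (polys_in vars) (ideal_of (\<lambda>_. 0) (\<lambda>_. 0) K L :: 'k::comm_ring_1 mpoly set) = k"
proof -
  interpret subring "polys_in vars :: 'k mpoly set" by (rule subring_polys_in)
  let ?J = "ideal_of (\<lambda>_. 0) (\<lambda>_. 0) K L :: 'k mpoly set"
  let ?fs = "map (\<lambda>i. esym vars (Suc i)) [0..<k] :: 'k mpoly list"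
  have st: "standard (\<lambda>_. 0) (\<lambda>_. 0)" using wpos by (auto simp: standard_def)
  have max: "max_ideal (polys_in vars) = (mon_ideal vars {\<mu>. \<mu> \<noteq> 0} :: 'k mpoly set)"
    by (auto simp: max_ideal_def mon_ideal_def in_keys_iff)
  have "\<nu> + \<mu> \<noteq> 0" if "\<mu> \<noteq> 0" for \<mu> \<nu> :: "nat + nat \<Rightarrow>\<^sub>0 nat"
  proof
    assume "\<nu> + \<mu> = 0"
    then have "Poly_Mapping.lookup \<nu> v + Poly_Mapping.lookup \<mu> v = 0" for v by (metis lookup_add lookup_zero)
    then show False using that by (metis add_is_0 lookup_zero poly_mapping_eqI)
  qed
  then have "upclosed vars {\<mu>. \<mu> \<noteq> 0}" by (auto simp: upclosed_def)
  then have maxI: "idl (max_ideal (polys_in vars) :: 'k mpoly set)" unfolding max by (rule idl_mon_ideal)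
  have esM: "esym vars (Suc i) \<in> (max_ideal (polys_in vars) :: 'k mpoly set)" for i
  proof -
    have "0 \<notin> Poly_Mapping.keys (esym vars (Suc i) :: 'k mpoly)"
      using homogeneous_esym[OF finite_vars, of "Suc i", where 'k = 'k] by (auto simp: homogeneous_def mdeg_def)
    then show ?thesis using esym_in[OF finite_vars] by (simp add: max_ideal_def in_keys_iff)
  qed
  have "0 \<notin> exps (\<lambda>_. 0) (\<lambda>_. 0) K L" using st by (simp add: exps_def)
  then have JM: "?J \<subseteq> max_ideal (polys_in vars)" unfolding max by (auto simp: mon_ideal_def)
  have "ideal_gen (polys_in vars) (?J \<union> set ?fs) \<subseteq> max_ideal (polys_in vars)"
    using JM esM by (intro gen_least[OF maxI]) auto
  moreover have "1 \<notin> (max_ideal (polys_in vars) :: 'k mpoly set)" by (simp add: max_ideal_def)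
  ultimately have "reg_seq (polys_in vars) ?J ?fs"
    unfolding reg_seq_def using esM weak_reg_esym_ideal_of[OF KL st min] by auto
  then have "k \<in> {length fs | fs. reg_seq (polys_in vars) ?J fs}" by (intro CollectI exI[of _ ?fs]) simp
  moreover have "x \<le> k" if "x \<in> {length fs | fs. reg_seq (polys_in vars) ?J fs}" for x
    using that weak_reg_length_le_depth[OF KL wpos le] by (auto simp: reg_seq_def)
  ultimately show ?thesis unfolding depth_def by (rule cSup_eq_maximum)
qed

lemma depth_le_exists:
  assumes wpos: "\<And>i j. E i j \<Longrightarrow> 0 < w i j"
  shows "\<exists>r. depth_le (\<lambda>_. 0) (\<lambda>_. 0) K L r"
proof -
  have "standard (\<lambda>_. 0) (\<lambda>_. 0)" using wpos by (auto simp: standard_def)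
  then show ?thesis
    by (intro exI depth_leI[of _ "\<lambda>_. 0" _ "\<lambda>_. 0"]) (auto simp: attains_def intro: disjI1[OF order_refl])
qed

end

theorem theorem3p5:
  fixes lam :: "nat \<Rightarrow> nat" and n :: nat and w :: "nat \<Rightarrow> nat \<Rightarrow> nat"
    and \<gamma> \<delta> :: nat
  assumes n_pos: "n \<ge> 1"
    and lam_mono: "\<And>i j. 1 \<le> i \<Longrightarrow> i \<le> j \<Longrightarrow> j \<le> n \<Longrightarrow> lam j \<le> lam i"
    and lam_pos: "\<And>i. 1 \<le> i \<Longrightarrow> i \<le> n \<Longrightarrow> lam i \<ge> 1"
    and w_pos: "\<And>i j. 1 \<le> i \<Longrightarrow> i \<le> n \<Longrightarrow> 1 \<le> j \<Longrightarrow> j \<le> lam i \<Longrightarrow> w i j \<ge> 1"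
    and box: "1 \<le> \<gamma>" "\<gamma> \<le> n" "1 \<le> \<delta>" "\<delta> \<le> lam \<gamma>"
    and minval: "w \<gamma> \<delta> = Min {w i j | i j. 1 \<le> i \<and> i \<le> n \<and> 1 \<le> j \<and> j \<le> lam i}"
    and minbox: "\<And>i j. 1 \<le> i \<Longrightarrow> i \<le> n \<Longrightarrow> 1 \<le> j \<Longrightarrow> j \<le> lam i \<Longrightarrow>
                   (i, j) \<noteq> (\<gamma>, \<delta>) \<Longrightarrow> i \<le> \<gamma> \<Longrightarrow> j \<le> \<delta> \<Longrightarrow> w i j > w \<gamma> \<delta>"
  defines "S \<equiv> (polys_in (Inl ` {1..n} \<union> Inr ` {1..lam 1}) :: 'k::field mpoly set)"
    and "I \<equiv> ideal_gen (polys_in (Inl ` {1..n} \<union> Inr ` {1..lam 1})) {(Var (Inl i) * Var (Inr j)) ^ (w i j) | i j.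
                              1 \<le> i \<and> i \<le> n \<and> 1 \<le> j \<and> j \<le> lam i}"
  shows "depth S I = min (depth S (ideal_gen S (I \<union> {Var (Inl \<gamma>)})))
                         (depth S (ideal_gen S (I \<union> {Var (Inr \<delta>)})))"
proof -
  define E where "E = (\<lambda>i j. 1 \<le> i \<and> i \<le> n \<and> 1 \<le> j \<and> j \<le> lam i)"
  define P where "P = {1..n}"
  define Q where "Q = {1..lam 1}"
  interpret ferrers P Q E w
  proof
    show "E i j \<Longrightarrow> i \<in> P \<and> j \<in> Q" for i j
      using lam_mono[of 1 i] by (auto simp: E_def P_def Q_def)
    show "E i j \<Longrightarrow> i' \<in> P \<Longrightarrow> i' \<le> i \<Longrightarrow> E i' j" for i i' j
      using lam_mono[of i' i] by (auto simp: E_def P_def)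
  qed (auto simp: E_def P_def Q_def)
  let ?z = "\<lambda>_::nat. 0::nat"
  have wpos: "0 < w i j" if "E i j" for i j using w_pos[of i j] that by (simp add: E_def)
  have fin: "finite {w i j | i j. E i j}"
  proof (rule finite_subset)
    show "{w i j | i j. E i j} \<subseteq> (\<lambda>(i, j). w i j) ` (P \<times> Q)" using box_in by force
  qed (simp add: P_def Q_def)
  have min: "w \<gamma> \<delta> \<le> w i j" if "E i j" for i j
    using minval Min_le[OF fin, of "w i j"] that by (auto simp: E_def)
  have gd: "E \<gamma> \<delta>" using box by (simp add: E_def)
  have gP: "\<gamma> \<in> P" and dQ: "\<delta> \<in> Q" using box_in[OF gd] by auto
  have V: "vars = Inl ` {1..n} \<union> Inr ` {1..lam 1}" unfolding vars_def unfolding P_def Q_def ..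
  have S: "S = polys_in vars" by (simp add: S_def V)
  define mn where "mn = (\<lambda>(i, j). Poly_Mapping.single (Inl i :: nat + nat) (w i j) + Poly_Mapping.single (Inr j) (w i j))"
  have lookup_mn: "Poly_Mapping.lookup (mn (i, j)) v = (if v = Inl i \<or> v = Inr j then w i j else 0)" for i j v
    by (auto simp: mn_def lookup_add lookup_single when_def)
  have keys_mn: "Poly_Mapping.keys (mn (i, j)) \<subseteq> vars" if "E i j" for i j
    using box_in[OF that] by (auto simp: in_keys_iff lookup_mn vars_def split: if_splits)
  have pow: "(Var (Inl i) * Var (Inr j)) ^ w i j = (Poly_Mapping.single (mn (i, j)) 1 :: 'k mpoly)" for i j
    by (simp add: power_mult_distrib Var_power mult_single mn_def)
  have gens: "{(Var (Inl i) * Var (Inr j)) ^ (w i j) | i j. 1 \<le> i \<and> i \<le> n \<and> 1 \<le> j \<and> j \<le> lam i} =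
      (\<lambda>\<nu>. Poly_Mapping.single \<nu> (1::'k)) ` (mn ` {(i, j). E i j})"
    unfolding pow E_def by force
  have I: "I = ideal_of ?z ?z {} {}"
  proof -
    have "I = mon_ideal vars {\<kappa> + \<nu> | \<kappa> \<nu>. \<nu> \<in> mn ` {(i, j). E i j} \<and> Poly_Mapping.keys \<kappa> \<subseteq> vars}"
      unfolding I_def V[symmetric] gens by (rule mon_ideal_gen[OF _ refl]) (use keys_mn in auto)
    also have "\<dots> = ideal_of ?z ?z {} {}"
    proof (rule mon_ideal_cong)
      fix \<mu> :: "nat + nat \<Rightarrow>\<^sub>0 nat" assume \<mu>: "Poly_Mapping.keys \<mu> \<subseteq> vars"
      \<comment> \<open>Divisibility by the generator of a box is failure of standardness at that
        box.\<close>
      have "(\<exists>\<kappa>. \<mu> = \<kappa> + mn (i, j) \<and> Poly_Mapping.keys \<kappa> \<subseteq> vars) \<longleftrightarrow>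
          w i j \<le> Poly_Mapping.lookup \<mu> (Inl i) \<and> w i j \<le> Poly_Mapping.lookup \<mu> (Inr j)" for i j
      proof (intro iffI)
        assume "w i j \<le> Poly_Mapping.lookup \<mu> (Inl i) \<and> w i j \<le> Poly_Mapping.lookup \<mu> (Inr j)"
        then have "\<mu> = (\<mu> - mn (i, j)) + mn (i, j)" by (intro poly_mapping_split) (auto simp: lookup_mn)
        then show "\<exists>\<kappa>. \<mu> = \<kappa> + mn (i, j) \<and> Poly_Mapping.keys \<kappa> \<subseteq> vars"
          using keys_minus_subset[of \<mu> "mn (i, j)"] \<mu> by blast
      qed (auto simp: lookup_add lookup_mn)
      then show "\<mu> \<in> {\<kappa> + \<nu> | \<kappa> \<nu>. \<nu> \<in> mn ` {(i, j). E i j} \<and> Poly_Mapping.keys \<kappa> \<subseteq> vars} \<longleftrightarrow> \<mu> \<in> exps ?z ?z {} {}"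
        unfolding exps_def standard_def by (simp add: not_less) blast
    qed
    finally show ?thesis .
  qed
  have Ix: "ideal_gen S (I \<union> {Var (Inl \<gamma>)}) = ideal_of ?z ?z {\<gamma>} {}"
    using insert_row[OF gP] by (simp add: S I)
  have Iy: "ideal_gen S (I \<union> {Var (Inr \<delta>)}) = ideal_of ?z ?z {} {\<delta>}"
    using insert_col[OF dQ] by (simp add: S I)
  define d where "d = (\<lambda>K L. LEAST r. depth_le ?z ?z K L r)"
  have d_le: "depth_le ?z ?z K L (d K L)" for K L
    unfolding d_def by (rule LeastI_ex[OF depth_le_exists[OF wpos]])
  have d_least: "depth_le ?z ?z K L r \<Longrightarrow> d K L \<le> r" for K L r
    unfolding d_def by (rule Least_le)
  have depth: "depth S (ideal_of ?z ?z K L) = d K L" if "K \<subseteq> P" "L \<subseteq> Q" for K L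
    unfolding S by (rule depth_ideal_of[OF that wpos d_le d_least])
  \<comment> \<open>For row \<open>\<gamma>\<close> the minimal box condition is used on the boxes
    above it in column \<open>\<delta>\<close>; for column \<open>\<delta>\<close> below, on the
    boxes to its left in row \<open>\<gamma>\<close>.\<close>
  have "depth_le ?z ?z {} {} r" if "depth_le ?z ?z {\<gamma>} {} r" for r
    by (rule depth_le_kill_row[OF _ _ gd _ _ _ that]) (use wpos minbox[of _ \<delta>] box box_up[OF gd] in \<open>auto simp: E_def\<close>)
  then have 1: "d {} {} \<le> d {\<gamma>} {}" using d_le d_least by blast
  have "depth_le ?z ?z {} {} r" if "depth_le ?z ?z {} {\<delta>} r" for r
    by (rule depth_le_kill_col[OF _ _ gd _ _ _ that]) (use wpos minbox[of \<gamma>] box box_left[OF gd] in \<open>auto simp: E_def\<close>)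
  then have 2: "d {} {} \<le> d {} {\<delta>}" using d_le d_least by blast
  have "d {\<gamma>} {} \<le> d {} {} \<or> d {} {\<delta>} \<le> d {} {}"
    using depth_le_branch[OF gd min d_le] d_least by blast
  then have "d {} {} = min (d {\<gamma>} {}) (d {} {\<delta>})" using 1 2 by linarith
  then show ?thesis unfolding Ix Iy using depth[of "{}" "{}"] depth[of "{\<gamma>}" "{}"] depth[of "{}" "{\<delta>}"] gP dQ
    by (simp add: I)
qed

end
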